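(* Let $\nu\ge 3$ be an integer, let $\tau>0$, and let $\Sigma=\Sigma(\nu,\tau)\subset\{0,1,\dots,2\nu\}^{\mathbb Z}$ be the two-coloured subshift defined in the context. Let $f:\Sigma_{\mathcal G}\to\mathbb{R}$ be a Hölder continuous function with $P_{\mathcal G}(f)>\sup f+\log 2$, where $P_{\mathcal G}(f)$ is the pressure of $f$ on the full shift $\Sigma_{\mathcal G}$, and let $g:\Sigma\to\mathbb{R}$ be the Hölder continuous extension of $f$ described in the context. If $$\tau\ge\frac{\log(3\nu)}{P_{\mathcal G}(f)-\sup f}-1,$$ then there are two mutually singular equilibrium states for $g$ on $\Sigma$.
   Context: Alphabet: $\mathcal{A}=\{0,1,\dots,2\nu\}=\{0\}\cup\mathcal{G}\cup\mathcal{Y}$, where $\mathcal{G}=\{1,\dots,\nu\}$ are the green symbols and $\mathcal{Y}=\{\nu+1,\dots,2\nu\}$ the yellow symbols; the symbols in $\mathcal{G}\cup\mathcal{Y}$ are called coloured. $\Sigma_{\mathcal G}=\mathcal{G}^{\mathbb Z}$ and $\Sigma_{\mathcal Y}=\mathcal{Y}^{\mathbb Z}$ are the green and yellow full $\nu$-shifts. Definition of $\Sigma$: a sequence $x\in\mathcal{A}^{\mathbb Z}$ belongs to $\Sigma$ if and only if either $x\in\Sigma_{\mathcal G}\cup\Sigma_{\mathcal Y}$ (then $x$ is called monochromatic), or the following holds. Every maximal block of consecutive coloured symbols in $x$ consists of symbols of a single colour. Any two successive such blocks (i.e. separated only by zeros) have different colours, are both of finite lengths $a$ and $b$, and are separated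 by a string of zeros $0^\lambda$ whose length satisfies $\lambda\ge\tau(a+b)$. In particular, an infinitely long coloured block can only be adjacent to an infinite string of zeros. Sequences with at most one coloured block, and zeros elsewhere, are allowed. The shift is $(\sigma x)_i=x_{i+1}$, and $\Sigma$ carries the topology induced from the product topology. Hölder continuity: a real function $f$ on a shift space is Hölder continuous if there are $\vartheta\in(0,1)$ and $C$ such that for every $n>0$, $|f(x)-f(y)|\le C\vartheta^n$ for all $x,y$ in the space with $x_i=y_i$ for all $|i|<n$ and either $x_{-n}\ne y_{-n}$ or $x_n\neq y_n$. Extension $g$ of $f$: (1) on $\Sigma_{\mathcal G}$, $g=f$. (2) On $\Sigma_{\mathcal Y}$, $g(y)=f(x)$, where $x\in\Sigma_{\mathcal G}$ is given by $y_i=x_i+\nu$ for all $i$. (3) If $x\in\Sigma$ and $x_0=0$, then $g(x)=\sup f$. (4) If $x\in\Sigma$ is not monochromatic and $x_0\neq 0$, let $x_{-n}\cdots x_n$ be the longest symmetric string around coordinate $0$ consisting of symbols of one colour $*\in\{\mathcal G,\mathcal Y\}$ (so $x_{-n-1}=0$ or $x_{n+1}=0$). Then $g(x)=g(y)$, where $y\in\Sigma_*$ is a monochromatic point with $y_i=x_i$ for $|i|\le n$, one such $y$ being fixed for each word $x_{-n}\cdots x_n$. Pressure: for a Hölder continuous $\varphi$ on a subshift $X$, $P(\varphi)$ is the exponential growth rate in $n$ of the partition function $Z_n=\sum_{\alpha}e^{\varphi^n(x(\alpha))}$, the sum being over words $\alpha$ of length $n$ occurring in $X$, with $x(\alpha)$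 an arbitrary point of the cylinder of $\alpha$ and $\varphi^n=\varphi+\varphi\circ\sigma+\cdots+\varphi\circ\sigma^{n-1}$. $P_{\mathcal G}(f)$ is the pressure for $X=\Sigma_{\mathcal G}$, and $P(g)$ is the pressure for $X=\Sigma$. An equilibrium state for $g$ on $\Sigma$ is a $\sigma$-invariant Borel probability measure $\mu$ with $h_\mu(\sigma)+\int g\,d\mu=P(g)$, where $h_\mu(\sigma)$ is the metric entropy. *)

theory Defs
  imports "HOL-Probability.Probability"
begin

section \<open>Bi-infinite sequences\<close>

text \<open>
  Points are functions \<open>int \<Rightarrow> nat\<close>. The type class topology on this function type is the product
  topology (\<open>nat\<close> being discrete), so \<open>borel\<close> is the Borel sigma-algebra of the product topology and
  \<open>restrict_space borel X\<close> that of the induced topology on \<open>X\<close>.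
\<close>

type_synonym point = "int \<Rightarrow> nat"

definition shift :: "point \<Rightarrow> point" where
  "shift x = (\<lambda>i. x (i + 1))"

definition full_shift :: "nat set \<Rightarrow> point set" where
  "full_shift S = {x. \<forall>i. x i \<in> S}"

definition holder_continuous_on :: "point set \<Rightarrow> (point \<Rightarrow> real) \<Rightarrow> bool" where
  "holder_continuous_on X f \<longleftrightarrow>
     (\<exists>\<theta> C. 0 < \<theta> \<and> \<theta> < 1 \<and>
       (\<forall>n>0. \<forall>x\<in>X. \<forall>y\<in>X.
          (\<forall>i. \<bar>i\<bar> < int n \<longrightarrow> x i = y i) \<and>
          (x (- int n) \<noteq> y (- int n) \<or> x (int n) \<noteq> y (int n))
          \<longrightarrow> \<bar>f x - f y\<bar> \<le> C * \<theta> ^ n))"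


section \<open>The two-coloured subshift\<close>

definition green :: "nat \<Rightarrow> nat set" where
  "green \<nu> = {1..\<nu>}"

definition yellow :: "nat \<Rightarrow> nat set" where
  "yellow \<nu> = {\<nu> + 1..2 * \<nu>}"

definition coloured_interval :: "nat \<Rightarrow> point \<Rightarrow> int set \<Rightarrow> bool" where
  "coloured_interval \<nu> x B \<longleftrightarrow>
     B \<noteq> {} \<and> (\<forall>i\<in>B. \<forall>k\<in>B. {i..k} \<subseteq> B) \<and> x ` B \<subseteq> green \<nu> \<union> yellow \<nu>"

text \<open>A maximal block is identified with its set of coordinates, which may be infinite.\<close>

definition coloured_block :: "nat \<Rightarrow> point \<Rightarrow> int set \<Rightarrow> bool" where
  "coloured_block \<nu> x B \<longleftrightarrow>
     coloured_interval \<nu> x B \<and> (\<forall>B'. coloured_interval \<nu> x B' \<and> B \<subseteq> B' \<longrightarrow> B' = B)"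

definition gap :: "int set \<Rightarrow> int set \<Rightarrow> int set" where
  "gap B C = {k. (\<forall>i\<in>B. i < k) \<and> (\<forall>j\<in>C. k < j)}"

definition successive_blocks :: "nat \<Rightarrow> point \<Rightarrow> int set \<Rightarrow> int set \<Rightarrow> bool" where
  "successive_blocks \<nu> x B C \<longleftrightarrow>
     coloured_block \<nu> x B \<and> coloured_block \<nu> x C \<and>
     (\<forall>i\<in>B. \<forall>j\<in>C. i < j) \<and> (\<forall>k\<in>gap B C. x k = 0)"

definition two_coloured_shift :: "nat \<Rightarrow> real \<Rightarrow> point set" where
  "two_coloured_shift \<nu> \<tau> =
     {x. (\<forall>i. x i \<in> {0..2 * \<nu>}) \<and>
         (x \<in> full_shift (green \<nu>) \<union> full_shift (yellow \<nu>) \<or>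
          (\<forall>B. coloured_block \<nu> x B \<longrightarrow> x ` B \<subseteq> green \<nu> \<or> x ` B \<subseteq> yellow \<nu>) \<and>
          (\<forall>B C. successive_blocks \<nu> x B C \<longrightarrow>
             (x ` B \<subseteq> green \<nu> \<and> x ` C \<subseteq> yellow \<nu> \<or> x ` B \<subseteq> yellow \<nu> \<and> x ` C \<subseteq> green \<nu>) \<and>
             finite B \<and> finite C \<and>
             real (card (gap B C)) \<ge> \<tau> * real (card B + card C)))}"


section \<open>The extension of a potential\<close>

definition longest_symmetric :: "nat set \<Rightarrow> point \<Rightarrow> nat \<Rightarrow> bool" where
  "longest_symmetric S x n \<longleftrightarrow>
     (\<forall>i. \<bar>i\<bar> \<le> int n \<longrightarrow> x i \<in> S) \<and>
     (\<forall>m. (\<forall>i. \<bar>i\<bar> \<le> int m \<longrightarrow> x i \<in> S) \<longrightarrow> m \<le> n)"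

text \<open>
  The extension depends on the choice, for each word, of a monochromatic point; this choice is the
  function \<open>Y\<close> below, and \<open>is_extension\<close> accepts the result of any such choice.
\<close>

definition is_extension :: "nat \<Rightarrow> real \<Rightarrow> (point \<Rightarrow> real) \<Rightarrow> (point \<Rightarrow> real) \<Rightarrow> bool" where
  "is_extension \<nu> \<tau> f g \<longleftrightarrow>
     (\<forall>x\<in>full_shift (green \<nu>). g x = f x) \<and>
     (\<forall>x\<in>full_shift (green \<nu>). g (\<lambda>i. x i + \<nu>) = f x) \<and>
     (\<forall>x\<in>two_coloured_shift \<nu> \<tau>. x 0 = 0 \<longrightarrow> g x = (SUP z\<in>full_shift (green \<nu>). f z)) \<and>
     (\<exists>Y :: nat list \<Rightarrow> point.
        \<forall>x\<in>two_coloured_shift \<nu> \<tau>.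
          x \<notin> full_shift (green \<nu>) \<union> full_shift (yellow \<nu>) \<and> x 0 \<noteq> 0 \<longrightarrow>
          (\<forall>S\<in>{green \<nu>, yellow \<nu>}. \<forall>n. longest_symmetric S x n \<longrightarrow>
             (let y = Y (map x [- int n..int n])
              in y \<in> full_shift S \<and> (\<forall>i. \<bar>i\<bar> \<le> int n \<longrightarrow> y i = x i) \<and> g x = g y)))"


section \<open>Pressure\<close>

definition words :: "point set \<Rightarrow> nat \<Rightarrow> nat list set" where
  "words X n = {\<alpha>. length \<alpha> = n \<and> (\<exists>x\<in>X. \<exists>k. \<forall>i<n. x (k + int i) = \<alpha> ! i)}"

definition cylinder :: "point set \<Rightarrow> nat list \<Rightarrow> point set" where
  "cylinder X \<alpha> = {x\<in>X. \<forall>i<length \<alpha>. x (int i) = \<alpha> ! i}"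

definition birkhoff_sum :: "(point \<Rightarrow> real) \<Rightarrow> nat \<Rightarrow> point \<Rightarrow> real" where
  "birkhoff_sum \<phi> n x = (\<Sum>k<n. \<phi> ((shift ^^ k) x))"

definition partition_function :: "point set \<Rightarrow> (point \<Rightarrow> real) \<Rightarrow> nat \<Rightarrow> real" where
  "partition_function X \<phi> n =
     (\<Sum>\<alpha>\<in>words X n. exp (birkhoff_sum \<phi> n (SOME x. x \<in> cylinder X \<alpha>)))"

text \<open>
  For a Hoelder continuous potential on a subshift the upper limit is a finite limit which does not
  depend on the points chosen in the cylinders.
\<close>

definition pressure :: "point set \<Rightarrow> (point \<Rightarrow> real) \<Rightarrow> real" where
  "pressure X \<phi> =
     real_of_ereal (limsup (\<lambda>n. ereal (ln (partition_function X \<phi> n) / real n)))"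


section \<open>Metric entropy and equilibrium states\<close>

definition measurable_partition :: "'a measure \<Rightarrow> 'a set set \<Rightarrow> bool" where
  "measurable_partition M \<xi> \<longleftrightarrow> finite \<xi> \<and> \<xi> \<subseteq> sets M \<and> partition_on (space M) \<xi>"

text \<open>The convention \<open>0 log 0 = 0\<close> holds automatically.\<close>

definition partition_entropy :: "'a measure \<Rightarrow> 'a set set \<Rightarrow> real" where
  "partition_entropy M \<xi> = - (\<Sum>A\<in>\<xi>. measure M A * ln (measure M A))"

text \<open>The common refinement of the preimages of \<open>\<xi>\<close> under \<open>T ^^ i\<close>, \<open>i < n\<close>.\<close>

definition refined_partition :: "'a measure \<Rightarrow> ('a \<Rightarrow> 'a) \<Rightarrow> 'a set set \<Rightarrow> nat \<Rightarrow> 'a set set" where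
  "refined_partition M T \<xi> n =
     {{x \<in> space M. \<forall>i<n. (T ^^ i) x \<in> A i} |A. \<forall>i<n. A i \<in> \<xi>} - {{}}"

text \<open>For \<open>T\<close> preserving the probability measure \<open>M\<close> the upper limit is a limit.\<close>

definition metric_entropy :: "'a measure \<Rightarrow> ('a \<Rightarrow> 'a) \<Rightarrow> ereal" where
  "metric_entropy M T =
     (SUP \<xi>\<in>{\<xi>. measurable_partition M \<xi>}.
        limsup (\<lambda>n. ereal (partition_entropy M (refined_partition M T \<xi> n) / real n)))"

definition invariant_probability :: "point set \<Rightarrow> point measure \<Rightarrow> bool" where
  "invariant_probability X M \<longleftrightarrow>
     prob_space M \<and> sets M = sets (restrict_space borel X) \<and>
     shift \<in> measurable M M \<and> distr M M shift = M"

definition equilibrium_state :: "point set \<Rightarrow> (point \<Rightarrow> real) \<Rightarrow> point measure \<Rightarrow> bool" where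
  "equilibrium_state X \<phi> M \<longleftrightarrow>
     invariant_probability X M \<and> integrable M \<phi> \<and>
     metric_entropy M shift + ereal (integral\<^sup>L M \<phi>) = ereal (pressure X \<phi>)"

definition mutually_singular :: "'a measure \<Rightarrow> 'a measure \<Rightarrow> bool" where
  "mutually_singular M N \<longleftrightarrow>
     sets M = sets N \<and> (\<exists>A\<in>sets M. emeasure M A = 0 \<and> emeasure N (space N - A) = 0)"

end

theory Submission
  imports Defs
begin

text \<open>
  Each colour carries a Gibbs measure of the extended potential: an invariant measure with
  \<open>\<mu>[w] \<le> C exp (S_n g) / Z_n\<close>, obtained as a limit of averaged marginals of the normalised weights
  \<open>exp (S_N g) / Z_N\<close>. Its entropy plus the integral of \<open>g\<close> is the pressure \<open>P\<close> of the monochromatic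
  shift, and the two measures live on disjoint sets. So everything reduces to showing that the larger
  subshift has no larger pressure.

  Write \<open>r = P - sup f\<close>, and divide all weights by \<open>e^{nP}\<close>. A symbol then has weight at most \<open>e^{-r}\<close>.
  A coloured block of length \<open>a\<close> which is followed by another one is followed by at least \<open>\<tau> a\<close>
  zeros. Since \<open>e^{-r} < 1/2\<close>, all such blocks together with their gaps have total weight at most
  \<open>2 \<nu>^a e^{-ra} e^{-r \<tau> a} \<le> 2 / 3^a\<close>, by the hypothesis on \<open>\<tau>\<close>. The sum over \<open>a\<close> is at most \<open>1\<close>, so
  prepending a block and a gap does not increase the total weight. Only the last block has to be
  estimated by the true partition function, and the words of length \<open>n\<close> have total weight \<open>O(n)\<close>.
\<close>

section \<open>Stationary measures from consistent word distributions\<close>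

text \<open>Estimating a block by the true partition function costs a distortion constant, and one
  constant per block would grow exponentially with the number of blocks. So a block that is followed
  by another is estimated only through g <= sup f, which multiplies without any constant, and its
  gap pays for the \<nu>^a words. The last block may have no gap behind it inside the word, and as P
  <= sup f + log \<nu> its crude weight \<nu>^a e^{-ra} need not decay; hence the exact estimate
  there, used once. A word may also cut its first and its last block. Of the rule \<lambda> >=
  \<tau> (a + b) only \<lambda> >= \<tau> a is kept, where a counts the visible symbols of the left
  block: this survives the cutting. The pressure allows an arbitrary point in each cylinder, so all
  sums are estimated for arbitrary choices of points.

  No variational principle enters. Entropy is the supremum over all finite partitions, and for each
  of the two measures it is computed outright: the coordinate partition gives P minus the integral
  as a lower bound, and every partition obeys the same upper bound.\<close>

definition window :: "int \<Rightarrow> nat \<Rightarrow> (int \<Rightarrow> 'a) \<Rightarrow> 'a list" where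
  "window a n x = map (\<lambda>i. x (a + int i)) [0..<n]"

lemma length_window[simp]: "length (window a n x) = n"
  by (simp add: window_def)

lemma nth_window[simp]: "i < n \<Longrightarrow> window a n x ! i = x (a + int i)"
  by (simp add: window_def)

lemma sets_borel_point: "sets (borel :: point measure) = sets (PiM UNIV (\<lambda>_. borel :: nat measure))"
  by (rule sets_PiM_equal_borel[symmetric])

lemma measurable_coordinate[measurable]: "(\<lambda>x::point. x i) \<in> borel \<rightarrow>\<^sub>M count_space UNIV"
proof -
  have "(\<lambda>x::point. x i) \<in> borel_measurable borel" by (rule measurable_product_coordinates)
  then show ?thesis
    by (simp only: measurable_cong_sets[OF refl sets_borel_eq_count_space])
qed

lemma measurable_map_upt:
  fixes h :: "nat \<Rightarrow> 'a \<Rightarrow> 'b :: countable"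
  assumes h: "\<And>i. i < n \<Longrightarrow> h i \<in> M \<rightarrow>\<^sub>M count_space UNIV"
  shows "(\<lambda>y. map (\<lambda>i. h i y) [0..<n]) \<in> M \<rightarrow>\<^sub>M count_space UNIV"
  unfolding measurable_count_space_eq_countable[OF countableI_type]
proof (intro conjI ballI)
  fix w :: "'b list"
  have "{y \<in> space M. \<forall>i\<in>{..<n}. h i y = w ! i} \<in> sets M"
  proof (rule sets.sets_Collect_finite_All)
    fix i assume "i \<in> {..<n}"
    then have "h i -` {w ! i} \<inter> space M \<in> sets M" by (intro measurable_sets[OF h]) auto
    moreover have "h i -` {w ! i} \<inter> space M = {y \<in> space M. h i y = w ! i}" by blast
    ultimately show "{y \<in> space M. h i y = w ! i} \<in> sets M" by (simp only:)
  qed simp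
  moreover have "(map (\<lambda>i. h i y) [0..<n] = w) = (length w = n \<and> (\<forall>i\<in>{..<n}. h i y = w ! i))" for y
    by (auto simp only: list_eq_iff_nth_eq length_map length_upt nth_map nth_upt lessThan_iff diff_zero add_0_left)
  then have "(\<lambda>y. map (\<lambda>i. h i y) [0..<n]) -` {w} \<inter> space M =
    (if length w = n then {y \<in> space M. \<forall>i\<in>{..<n}. h i y = w ! i} else {})"
    by (auto simp only: vimage_def mem_Collect_eq singleton_iff split: if_split)
  ultimately show "(\<lambda>y. map (\<lambda>i. h i y) [0..<n]) -` {w} \<inter> space M \<in> sets M"
    by (cases "length w = n") (simp_all only: if_True if_False sets.empty_sets refl simp_thms)
qed simp

lemma measurable_window: "window a n \<in> (borel :: point measure) \<rightarrow>\<^sub>M count_space UNIV"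
  unfolding window_def by (rule measurable_map_upt) (rule measurable_coordinate)

lemma measurable_shift[measurable]: "shift \<in> (borel :: point measure) \<rightarrow>\<^sub>M borel"
  unfolding shift_def
  by (rule borel_measurable_continuous_onI, rule continuous_on_coordinatewise_then_product)
    (rule continuous_on_product_coordinates)

text \<open>A cylinder over finitely many coordinates \<open>J\<close> is the preimage of a set of
  words under one window that covers \<open>J\<close>, so the window laws determine the measure on a
  generating family.\<close>

lemma measure_eqI_window:
  fixes M N :: "point measure"
  assumes "prob_space M" "sets M = sets borel" "sets N = sets borel"
  and "\<And>a n. distr M (count_space UNIV) (window a n) = distr N (count_space UNIV) (window a n)"
  shows "M = N"
proof (rule measure_eqI_PiM_infinite[of _ UNIV "\<lambda>_. borel"])
  show "sets M = sets (PiM UNIV (\<lambda>_. borel))" "sets N = sets (PiM UNIV (\<lambda>_. borel))"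
    using assms sets_borel_point by simp_all
  interpret prob_space M by fact
  show "finite_measure M" by unfold_locales
  fix A :: "int \<Rightarrow> nat set" and J :: "int set" assume J: "finite J"
  \<comment> \<open>The window is the symmetric interval from \<open>a\<close> to \<open>-a\<close>,
    of length \<open>1 - 2 * a\<close>; the inserted 0 makes the maximum meaningful for empty
    \<open>J\<close>.\<close>
  define a where "a = - Max (insert 0 (abs ` J))"
  define n where "n = nat (1 - 2 * a)"
  have a: "a \<le> j \<and> j < a + int n \<and> nat (j - a) < n" if "j \<in> J" for j
  proof -
    have "\<bar>j\<bar> \<le> Max (insert 0 (abs ` J))" using that J by (simp add: Max_ge)
    then have "\<bar>j\<bar> \<le> -a" unfolding a_def by linarith
    then have "a \<le> j" "j \<le> -a" by linarith+
    then show ?thesis unfolding n_def by linarith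
  qed
  have spaces: "space M = UNIV" "space N = UNIV"
    using assms(2,3)[THEN sets_eq_imp_space_eq] by simp_all
  have mm: "window a n \<in> M \<rightarrow>\<^sub>M count_space UNIV" "window a n \<in> N \<rightarrow>\<^sub>M count_space UNIV"
    unfolding measurable_cong_sets[OF assms(2) refl] measurable_cong_sets[OF assms(3) refl]
    by (rule measurable_window)+
  have *: "prod_emb UNIV (\<lambda>_. borel) J (Pi\<^sub>E J A) = window a n -` {w. \<forall>j\<in>J. w ! nat (j - a) \<in> A j} \<inter> UNIV"
  proof -
    have "window a n x ! nat (j - a) = x j" if "j \<in> J" for x :: point and j
    proof -
      have "a + int (nat (j - a)) = j" using a[OF that] by simp
      then show ?thesis using a[OF that] by simp
    qed
    then show ?thesis by (auto simp: prod_emb_def PiE_iff)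
  qed
  have "emeasure M (prod_emb UNIV (\<lambda>_. borel) J (Pi\<^sub>E J A)) =
     emeasure (distr M (count_space UNIV) (window a n)) {w. \<forall>j\<in>J. w ! nat (j - a) \<in> A j}"
    unfolding * by (subst emeasure_distr[OF mm(1)]) (auto simp: spaces)
  also have "\<dots> = emeasure N (prod_emb UNIV (\<lambda>_. borel) J (Pi\<^sub>E J A))"
    unfolding assms(4) * by (subst emeasure_distr[OF mm(2)]) (auto simp: spaces)
  finally show "emeasure M (prod_emb UNIV (\<lambda>_. borel) J (Pi\<^sub>E J A)) = emeasure N (prod_emb UNIV (\<lambda>_. borel) J (Pi\<^sub>E J A))" .
qed

text \<open>The Kolmogorov extension theorem of the library needs a Polish space, which the type of natural numbers
  is not declared to be; hence the detour through real coordinates.\<close>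

lemma stationary_extension:
  fixes R :: "nat \<Rightarrow> nat list pmf"
  assumes len: "\<And>n w. w \<in> set_pmf (R n) \<Longrightarrow> length w = n"
    and tl: "\<And>n. map_pmf tl (R (Suc n)) = R n"
    and butlast: "\<And>n. map_pmf butlast (R (Suc n)) = R n"
  shows "\<exists>M :: point measure. prob_space M \<and> sets M = sets borel \<and>
    (\<forall>a n. distr M (count_space UNIV) (window a n) = measure_pmf (R n)) \<and> distr M borel shift = M"
proof -
  have drop: "map_pmf (drop k) (R (k + n)) = R n" for k n
  proof (induction k)
    case (Suc k)
    have "map_pmf (drop (Suc k)) (R (Suc k + n)) = map_pmf (drop k) (map_pmf tl (R (Suc (k + n))))"
      unfolding pmf.map_comp by (rule map_pmf_cong) (simp_all add: drop_Suc)
    then show ?case using Suc tl by simp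
  qed (simp add: pmf.map_ident)
  have take: "map_pmf (take n) (R (n + k)) = R n" for k n
  proof (induction k)
    case 0
    have "map_pmf (take n) (R n) = map_pmf id (R n)" by (rule map_pmf_cong) (auto dest: len)
    then show ?case by (simp add: pmf.map_id)
  next
    case (Suc k)
    have "map_pmf (take n) (R (n + Suc k)) = map_pmf (take n \<circ> butlast) (R (Suc (n + k)))"
      by (intro map_pmf_cong) (auto dest!: len simp: take_butlast)
    also have "\<dots> = map_pmf (take n) (map_pmf butlast (R (Suc (n + k))))"
      by (simp add: pmf.map_comp)
    finally show ?case using Suc butlast by simp
  qed
  have td: "map_pmf (\<lambda>w. take n (drop d w)) (R N) = R n" if "d + n \<le> N" for d n N
  proof -
    have "map_pmf (\<lambda>w. take n (drop d w)) (R N) = map_pmf (take n) (map_pmf (drop d) (R (d + (n + (N - d - n)))))"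
      using that by (simp add: pmf.map_comp o_def)
    then show ?thesis by (simp only: drop take)
  qed
  \<comment> \<open>\<open>rd J a\<close> reads a word as the stretch that starts at coordinate
    \<open>a\<close>, so \<open>PJ J a n\<close> is the marginal on \<open>J\<close> computed from
    the words on the coordinates \<open>a\<close> to \<open>a + n - 1\<close>.\<close>
  define rd :: "int set \<Rightarrow> int \<Rightarrow> nat list \<Rightarrow> (int \<Rightarrow> real)" where
    "rd J a w = (\<lambda>j\<in>J. real (w ! nat (j - a)))" for J a w
  define PJ :: "int set \<Rightarrow> int \<Rightarrow> nat \<Rightarrow> (int \<Rightarrow> real) measure" where
    "PJ J a n = distr (measure_pmf (R n)) (PiM J (\<lambda>_. borel)) (rd J a)" for J a n
  have rdm: "rd J a \<in> measure_pmf (R n) \<rightarrow>\<^sub>M PiM J (\<lambda>_. borel)" for J a n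
    by (auto simp: rd_def space_PiM)
  \<comment> \<open>Consistency: every window that covers \<open>J\<close> gives the same marginal
    on \<open>J\<close>. Nested windows are compared through \<open>td\<close>; \<open>P_eq\<close>
    then passes between two windows through a common larger one.\<close>
  have PJ_indep: "PJ J a n = PJ J b m" if "b \<le> a" "a + int n \<le> b + int m" "J \<subseteq> {a..<a + int n}" for J a n b m
  proof -
    define d where "d = nat (a - b)"
    have d: "d + n \<le> m" "int d = a - b" using that by (auto simp: d_def)
    have "PJ J a n = distr (measure_pmf (map_pmf (\<lambda>w. take n (drop d w)) (R m))) (PiM J (\<lambda>_. borel)) (rd J a)"
      unfolding PJ_def td[OF d(1)] ..
    also have "\<dots> = distr (measure_pmf (R m)) (PiM J (\<lambda>_. borel)) (rd J a \<circ> (\<lambda>w. take n (drop d w)))"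
      unfolding map_pmf_rep_eq by (rule distr_distr) (auto simp: rd_def space_PiM)
    also have "\<dots> = PJ J b m"
      unfolding PJ_def
    proof (rule distr_cong_AE)
      show "AE x in measure_pmf (R m). (rd J a \<circ> (\<lambda>w. take n (drop d w))) x = rd J b x"
      proof (rule AE_pmfI)
        fix w assume "w \<in> set_pmf (R m)"
        then have l: "length w = m" by (rule len)
        have "take n (drop d w) ! nat (j - a) = w ! nat (j - b)" if j: "j \<in> J" for j
        proof -
          have "a \<le> j" "j < a + int n" using j \<open>J \<subseteq> _\<close> by auto
          then have "nat (j - a) < n" "d + nat (j - a) = nat (j - b)" using d by linarith+
          then show ?thesis using d l by simp
        qed
        then show "(rd J a \<circ> (\<lambda>w. take n (drop d w))) w = rd J b w"
          by (auto simp: rd_def)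
      qed
    qed (auto intro: rdm simp: rd_def space_PiM)
    finally show ?thesis .
  qed
  define ra where "ra J = - Max (insert 0 (abs ` J))" for J :: "int set"
  define rn where "rn J = nat (1 - 2 * ra J)" for J :: "int set"
  have ra: "J \<subseteq> {ra J..<ra J + int (rn J)}" if "finite J" for J
  proof
    fix j assume "j \<in> J"
    then have "\<bar>j\<bar> \<le> Max (insert 0 (abs ` J))" using that by (simp add: Max_ge)
    then have "\<bar>j\<bar> \<le> - ra J" unfolding ra_def by linarith
    then have "ra J \<le> j" "j \<le> - ra J" by linarith+
    then show "j \<in> {ra J..<ra J + int (rn J)}" unfolding rn_def by simp
  qed
  define P where "P J = PJ J (ra J) (rn J)" for J
  have P_eq: "P J = PJ J a n" if "J \<subseteq> {a..<a + int n}" for J a n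
  proof -
    have fJ: "finite J" using that finite_subset by blast
    define b where "b = min a (ra J)"
    define m where "m = nat (max (a + int n) (ra J + int (rn J)) - b)"
    have m: "a + int n \<le> b + int m" "ra J + int (rn J) \<le> b + int m"
      by (auto simp: m_def b_def)
    have "P J = PJ J b m" unfolding P_def
      by (rule PJ_indep) (use m ra[OF fJ] in \<open>auto simp: b_def\<close>)
    also have "\<dots> = PJ J a n"
      by (rule PJ_indep[symmetric]) (use m that in \<open>auto simp: b_def\<close>)
    finally show ?thesis .
  qed
  interpret polish_projective UNIV P
    unfolding polish_projective_def projective_family_def
  proof (intro conjI allI impI)
    fix J H :: "int set" assume JH: "J \<subseteq> H" "finite H"
    have "P J = PJ J (ra H) (rn H)" using ra[OF JH(2)] JH by (intro P_eq) auto
    also have "\<dots> = distr (P H) (PiM J (\<lambda>_. borel)) (\<lambda>f. restrict f J)"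
      unfolding P_def PJ_def using JH

    proof (subst distr_distr)
      show "distr (measure_pmf (R (rn H))) (PiM J (\<lambda>_. borel)) (rd J (ra H)) =
        distr (measure_pmf (R (rn H))) (PiM J (\<lambda>_. borel)) ((\<lambda>f. restrict f J) \<circ> rd H (ra H))"
        using JH by (intro distr_cong) (auto simp: rd_def fun_eq_iff)
    qed (auto simp: rd_def space_PiM intro!: measurable_restrict_subset JH)
    finally show "P J = distr (P H) (PiM J (\<lambda>_. borel)) (\<lambda>f. restrict f J)" .
  next
    fix J :: "int set" assume "finite J"
    show "prob_space (P J)" unfolding P_def PJ_def
      by (rule measure_pmf.prob_space_distr) (rule rdm)
  qed
  \<comment> \<open>The coordinates of the limit are real; taking integer parts returns to symbols
    and undoes the embedding of the natural numbers exactly.\<close>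
  define \<pi> :: "(int \<Rightarrow> real) \<Rightarrow> point" where "\<pi> y = (\<lambda>i. nat \<lfloor>y i\<rfloor>)" for y
  have limS: "sets lim = sets (PiM UNIV (\<lambda>_. borel :: real measure))" by simp
  have pim: "\<pi> \<in> lim \<rightarrow>\<^sub>M borel"
    unfolding measurable_cong_sets[OF limS sets_borel_point] \<pi>_def
  proof (rule measurable_PiM_single')
    fix i :: int
    have "(\<lambda>y. y i) \<in> PiM UNIV (\<lambda>_. borel :: real measure) \<rightarrow>\<^sub>M borel"
      by (rule measurable_component_singleton) simp
    then show "(\<lambda>y. nat \<lfloor>y i\<rfloor>) \<in> PiM UNIV (\<lambda>_. borel :: real measure) \<rightarrow>\<^sub>M borel"
      by measurable
  qed (simp add: space_PiM)
  define M where "M = distr lim borel \<pi>"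
  have M: "prob_space M" "sets M = sets borel"
    by (auto simp: M_def intro: P.prob_space_distr pim)
  have win: "distr M (count_space UNIV) (window a n) = measure_pmf (R n)" for a n
  proof (rule measure_eqI)
    fix W :: "nat list set"
    define J where "J = {a..<a + int n}"
    define X where "X = {y \<in> space (PiM J (\<lambda>_. borel::real measure)). map (\<lambda>i. nat \<lfloor>y (a + int i)\<rfloor>) [0..<n] \<in> W}"
    have fm: "(\<lambda>y. map (\<lambda>i. nat \<lfloor>y (a + int i)\<rfloor>) [0..<n]) \<in> PiM J (\<lambda>_. borel :: real measure) \<rightarrow>\<^sub>M count_space UNIV"
    proof (rule measurable_map_upt)
      fix i assume "i < n"
      then have "(\<lambda>y. y (a + int i)) \<in> PiM J (\<lambda>_. borel :: real measure) \<rightarrow>\<^sub>M borel"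
        by (intro measurable_component_singleton) (simp add: J_def)
      moreover have "(\<lambda>r :: real. nat \<lfloor>r\<rfloor>) \<in> borel \<rightarrow>\<^sub>M count_space UNIV" by measurable
      ultimately show "(\<lambda>y. nat \<lfloor>y (a + int i)\<rfloor>) \<in> PiM J (\<lambda>_. borel :: real measure) \<rightarrow>\<^sub>M count_space UNIV"
        by (rule measurable_compose)
    qed
    have X: "X \<in> sets (PiM J (\<lambda>_. borel))"
    proof -
      have "X = (\<lambda>y. map (\<lambda>i. nat \<lfloor>y (a + int i)\<rfloor>) [0..<n]) -` W \<inter> space (PiM J (\<lambda>_. borel))"
        unfolding X_def by blast
      then show ?thesis using measurable_sets[OF fm, of W] by simp
    qed
    have "emeasure (distr M (count_space UNIV) (window a n)) W = emeasure lim ((\<lambda>y. window a n (\<pi> y)) -` W \<inter> space lim)"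
      unfolding M_def by (subst distr_distr[OF measurable_window pim], subst emeasure_distr)
        (simp_all only: o_def measurable_compose[OF pim measurable_window] space_count_space sets_count_space Pow_UNIV UNIV_I)
    also have "(\<lambda>y. window a n (\<pi> y)) -` W \<inter> space lim = emb UNIV J X"
    proof -
      have "map (\<lambda>i. nat \<lfloor>restrict y J (a + int i)\<rfloor>) [0..<n] = window a n (\<pi> y)" for y
        by (auto simp: window_def \<pi>_def J_def)
      then show ?thesis unfolding prod_emb_def X_def by (auto simp: space_PiM)
    qed
    also have "emeasure lim (emb UNIV J X) = P J X"
      by (rule emeasure_lim_emb) (use X in \<open>auto simp: J_def\<close>)
    also have "\<dots> = emeasure (measure_pmf (R n)) (rd J a -` X)"
      unfolding P_eq[of J a n, unfolded J_def, OF order_refl, folded J_def] PJ_def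
      by (subst emeasure_distr[OF rdm X]) simp
    also have "\<dots> = emeasure (measure_pmf (R n)) W"
    proof (rule emeasure_eq_AE)
      show "AE w in measure_pmf (R n). (w \<in> rd J a -` X) = (w \<in> W)"
      proof (rule AE_pmfI)
        fix w assume "w \<in> set_pmf (R n)"
        then have "length w = n" by (rule len)
        then have "map (\<lambda>i. nat \<lfloor>rd J a w (a + int i)\<rfloor>) [0..<n] = w"
          by (auto simp: list_eq_iff_nth_eq rd_def J_def)
        then show "(w \<in> rd J a -` X) = (w \<in> W)"
          by (auto simp: X_def space_PiM rd_def)
      qed
    qed auto
    finally show "emeasure (distr M (count_space UNIV) (window a n)) W = emeasure (measure_pmf (R n)) W" .
  qed simp
  \<comment> \<open>The window laws do not depend on the position \<open>a\<close>, and shifting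
    only replaces \<open>a\<close> by \<open>a + 1\<close>.\<close>
  have "distr M borel shift = M"
  proof (rule measure_eqI_window)
    have sm: "shift \<in> M \<rightarrow>\<^sub>M borel" using measurable_shift
      unfolding measurable_cong_sets[OF M(2) refl] .
    show "prob_space (distr M borel shift)" using M(1) sm by (rule prob_space.prob_space_distr)
    fix a n
    have "distr (distr M borel shift) (count_space UNIV) (window a n) = distr M (count_space UNIV) (window (a + 1) n)"
      by (subst distr_distr[OF measurable_window sm]) (auto simp: o_def shift_def window_def[abs_def] ac_simps)
    then show "distr (distr M borel shift) (count_space UNIV) (window a n) = distr M (count_space UNIV) (window a n)"
      by (simp add: win)
  qed (use M in auto)
  with M win show ?thesis by blast
qed

section \<open>Quasi-multiplicative weights on words\<close>

text \<open>Replaces a diagonal extraction: the unit cube indexed by a countable type is compact,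
  hence here sequentially compact, and coordinates are continuous.\<close>

lemma bounded_pointwise_subsequence:
  fixes f :: "nat \<Rightarrow> 'a::countable \<Rightarrow> real"
  assumes "\<And>n a. f n a \<in> {0..1}"
  shows "\<exists>l r. strict_mono (r :: nat \<Rightarrow> nat) \<and> (\<forall>a. (\<lambda>n. f (r n) a) \<longlonglongrightarrow> l a)"
proof -
  have "compact (PiE UNIV (\<lambda>_::'a. {0..1::real}))"
    unfolding compactin_euclidean_iff[symmetric] euclidean_product_topology[symmetric]
    by (simp add: compactin_PiE)
  then have "seq_compact (PiE UNIV (\<lambda>_::'a. {0..1::real}))"
    by (rule compact_imp_seq_compact)
  moreover have "\<forall>n. f n \<in> PiE UNIV (\<lambda>_. {0..1})" using assms by auto
  ultimately obtain l r where r: "strict_mono (r :: nat \<Rightarrow> nat)" "(f \<circ> r) \<longlonglongrightarrow> l"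
    by (rule seq_compactE) auto
  have "(\<lambda>n. f (r n) a) \<longlonglongrightarrow> l a" for a
    using continuous_on_tendsto_compose[OF continuous_on_product_coordinates[of a] r(2)] by (simp add: o_def)
  with r(1) show ?thesis by blast
qed

definition lists_of :: "'a set \<Rightarrow> nat \<Rightarrow> 'a list set" where
  "lists_of S n = {w. set w \<subseteq> S \<and> length w = n}"

lemma lists_ofD: "w \<in> lists_of S n \<Longrightarrow> set w \<subseteq> S" "w \<in> lists_of S n \<Longrightarrow> length w = n"
  by (auto simp: lists_of_def)

lemma finite_lists_of[simp]: "finite S \<Longrightarrow> finite (lists_of S n)"
  unfolding lists_of_def by (rule finite_lists_length_eq)

lemma lists_of_0[simp]: "lists_of S 0 = {[]}"
  by (auto simp: lists_of_def)

lemma lists_of_nonempty: "S \<noteq> {} \<Longrightarrow> lists_of S n \<noteq> {}"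
proof -
  assume "S \<noteq> {}"
  then obtain s where "s \<in> S" by blast
  then have "replicate n s \<in> lists_of S n" by (auto simp: lists_of_def)
  then show ?thesis by blast
qed

lemma sum_lists_of_append:
  "(\<Sum>w\<in>lists_of S (m + n). h w) = (\<Sum>u\<in>lists_of S m. \<Sum>v\<in>lists_of S n. h (u @ v))"
proof -
  have "(\<Sum>w\<in>lists_of S (m + n). h w) = (\<Sum>(u,v)\<in>lists_of S m \<times> lists_of S n. h (u @ v))"
    by (rule sum.reindex_bij_witness[of _ "\<lambda>(u,v). u @ v" "\<lambda>w. (take m w, drop m w)"])
       (auto simp: lists_of_def dest: in_set_takeD in_set_dropD)
  then show ?thesis by (simp add: sum.cartesian_product)
qed

lemma sum_lists_of_1: "(\<Sum>w\<in>lists_of S 1. h w) = (\<Sum>a\<in>S. h [a])"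
  by (rule sum.reindex_bij_witness[of _ "\<lambda>a. [a]" hd]) (auto simp: lists_of_def length_Suc_conv)

lemma sum_lists_of_Suc_left:
  "(\<Sum>w\<in>lists_of S (Suc n). h w) = (\<Sum>a\<in>S. \<Sum>v\<in>lists_of S n. h (a # v))"
  using sum_lists_of_append[of h S 1 n] by (simp add: sum_lists_of_1[unfolded One_nat_def])

lemma sum_lists_of_Suc_right:
  "(\<Sum>w\<in>lists_of S (Suc n). h w) = (\<Sum>v\<in>lists_of S n. \<Sum>a\<in>S. h (v @ [a]))"
  using sum_lists_of_append[of h S n 1] by (simp add: sum_lists_of_1[unfolded One_nat_def])

text \<open>An abstract form of the weights e^{S_n \<phi>}, whose bounded distortion makes them
  multiplicative up to a constant. This is all that the construction of the stationary measure
  uses.\<close>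

locale quasi_multiplicative =
  fixes S :: "nat set" and F :: "nat list \<Rightarrow> real" and K :: real
  assumes finite_S[simp]: "finite S" and S_nonempty: "S \<noteq> {}" and K: "K \<ge> 1"
    and F_pos: "set w \<subseteq> S \<Longrightarrow> F w > 0"
    and F_append_le: "set u \<subseteq> S \<Longrightarrow> set v \<subseteq> S \<Longrightarrow> F (u @ v) \<le> K * F u * F v"
    and F_append_ge: "set u \<subseteq> S \<Longrightarrow> set v \<subseteq> S \<Longrightarrow> F u * F v \<le> K * F (u @ v)"
begin

lemma F_nonneg: "set w \<subseteq> S \<Longrightarrow> 0 \<le> F w"
  using F_pos by (simp add: less_imp_le)

definition Z :: "nat \<Rightarrow> real" where "Z n = (\<Sum>w\<in>lists_of S n. F w)"

lemma Z_pos: "Z n > 0"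
  unfolding Z_def by (rule sum_pos) (auto simp: lists_of_nonempty S_nonempty lists_ofD F_pos)

lemma Z_add_le: "Z (m + n) \<le> K * Z m * Z n"
proof -
  have "Z (m + n) \<le> (\<Sum>u\<in>lists_of S m. \<Sum>v\<in>lists_of S n. K * F u * F v)"
    unfolding Z_def sum_lists_of_append by (intro sum_mono F_append_le) (auto dest: lists_ofD)
  also have "\<dots> = K * Z m * Z n"
    by (simp add: Z_def sum_distrib_left sum_distrib_right mult.assoc) (rule sum.swap)
  finally show ?thesis .
qed

lemma Z_add_ge: "Z m * Z n \<le> K * Z (m + n)"
proof -
  have "Z m * Z n = (\<Sum>u\<in>lists_of S m. \<Sum>v\<in>lists_of S n. F u * F v)"
    by (simp add: Z_def sum_product)
  also have "\<dots> \<le> (\<Sum>u\<in>lists_of S m. \<Sum>v\<in>lists_of S n. K * F (u @ v))"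
    by (intro sum_mono F_append_ge) (auto dest: lists_ofD)
  also have "\<dots> = K * Z (m + n)"
    by (simp add: Z_def sum_lists_of_append sum_distrib_left)
  finally show ?thesis .
qed

text \<open>Divided by \<open>Z (i + length w + j)\<close>, this is the probability that
  \<open>w\<close> stands at position \<open>i\<close> of a random word drawn with probability
  proportional to \<open>F\<close>.\<close>

definition G :: "nat \<Rightarrow> nat \<Rightarrow> nat list \<Rightarrow> real" where
  "G i j w = (\<Sum>u\<in>lists_of S i. \<Sum>v\<in>lists_of S j. F (u @ w @ v))"

lemma G_Nil: "G i j [] = Z (i + j)"
  by (simp add: G_def Z_def sum_lists_of_append)

lemma G_right: "(\<Sum>a\<in>S. G i j (w @ [a])) = G i (Suc j) w"
  unfolding G_def sum_lists_of_Suc_left by (subst sum.swap) (simp add: sum.swap[of _ S])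

lemma G_left: "(\<Sum>a\<in>S. G i j (a # w)) = G (Suc i) j w"
  unfolding G_def sum_lists_of_Suc_right by (subst sum.swap) simp

lemma G_nonneg: "set w \<subseteq> S \<Longrightarrow> G i j w \<ge> 0"
  unfolding G_def by (intro sum_nonneg F_nonneg) (auto dest: lists_ofD)

text \<open>Two factors \<open>K\<close> cut \<open>w\<close> out of the long word; two more put
  \<open>Z i\<close>, \<open>Z (length w)\<close> and \<open>Z j\<close> together again. After
  division by the last factor the bound does not depend on the position, so it survives averaging
  and the limit.\<close>

lemma G_le:
  assumes "set w \<subseteq> S"
  shows "G i j w \<le> K ^ 4 * (F w / Z (length w)) * Z (i + length w + j)"
proof -
  let ?n = "length w"
  have "G i j w \<le> (\<Sum>u\<in>lists_of S i. \<Sum>v\<in>lists_of S j. K * F u * (K * F w * F v))"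
    unfolding G_def
  proof (intro sum_mono)
    fix u v assume "u \<in> lists_of S i" "v \<in> lists_of S j"
    then have uv: "set u \<subseteq> S" "set v \<subseteq> S" by (auto dest: lists_ofD)
    have "F (u @ w @ v) \<le> K * F u * F (w @ v)" using uv assms by (intro F_append_le) auto
    also have "\<dots> \<le> K * F u * (K * F w * F v)"
      using uv assms K F_pos[OF uv(1)] by (intro mult_left_mono F_append_le) auto
    finally show "F (u @ w @ v) \<le> K * F u * (K * F w * F v)" .
  qed
  also have "\<dots> = K^2 * F w * (Z i * Z j)"
    unfolding Z_def sum_product by (simp add: sum_distrib_left mult_ac power2_eq_square)
  also have "\<dots> = K^2 * (F w / Z ?n) * (Z i * Z ?n * Z j)"
    using Z_pos[of ?n] by simp
  also have "\<dots> \<le> K^2 * (F w / Z ?n) * (K^2 * Z (i + ?n + j))"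
  proof (rule mult_left_mono)
    have "Z i * Z ?n * Z j \<le> K * Z (i + ?n) * Z j"
      using Z_add_ge[of i ?n] Z_pos[of j] by (intro mult_right_mono) auto
    also have "\<dots> \<le> K * (K * Z (i + ?n + j))"
      using Z_add_ge[of "i + ?n" j] K by (simp add: mult.assoc mult_left_mono)
    finally show "Z i * Z ?n * Z j \<le> K^2 * Z (i + ?n + j)" by (simp add: power2_eq_square)
    show "0 \<le> K^2 * (F w / Z ?n)" using F_pos[OF assms] Z_pos[of ?n] by (simp add: less_imp_le)
  qed
  also have "\<dots> = K ^ 4 * (F w / Z ?n) * Z (i + ?n + j)"
    by (simp add: power2_eq_square power4_eq_xxxx)
  finally show ?thesis .
qed

lemma G_le_Z:
  assumes "w \<in> lists_of S n"
  shows "G i j w \<le> Z (i + n + j)"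
proof -
  have "G i j w \<le> (\<Sum>u\<in>lists_of S i. \<Sum>w\<in>lists_of S n. \<Sum>v\<in>lists_of S j. F (u @ w @ v))"
    unfolding G_def
  proof (intro sum_mono member_le_sum)
    fix u x assume "u \<in> lists_of S i" "x \<in> lists_of S n - {w}"
    then show "0 \<le> (\<Sum>v\<in>lists_of S j. F (u @ x @ v))"
      by (intro sum_nonneg F_nonneg) (auto dest: lists_ofD)
  qed (use assms in auto)
  also have "\<dots> = Z (i + (n + j))"
    by (simp add: Z_def sum_lists_of_append)
  finally show ?thesis by (simp add: add.assoc)
qed

text \<open>Positions are averaged because a fixed position does not give a shift invariant law.
  Extending \<open>w\<close> on the right leaves its position unchanged, so that marginal is exact
  before the limit; extending it on the left moves the position by one, and the averages then differ
  by a boundary term that vanishes.\<close>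

lemma stationary_weights:
  "\<exists>L :: nat list \<Rightarrow> real. L [] = 1 \<and> (\<forall>w. set w \<subseteq> S \<longrightarrow> 0 \<le> L w \<and> (\<Sum>a\<in>S. L (a # w)) = L w \<and>
      (\<Sum>a\<in>S. L (w @ [a])) = L w \<and> L w \<le> K ^ 4 * (F w / Z (length w)))"
proof -
  \<comment> \<open>The long words have length \<open>2 * N\<close>, so that for positions
    \<open>i < N\<close> and \<open>length w \<le> N\<close> the subtraction of naturals is exact
    and there is still room behind \<open>w\<close>.\<close>
  define b where "b N w = (if length w \<le> N \<and> N > 0 \<and> set w \<subseteq> S
    then (\<Sum>i<N. G i (2 * N - i - length w) w) / (real N * Z (2 * N)) else 0)" for N w
  have D: "real N * Z (2 * N) > 0" if "N > 0" for N using that Z_pos by simp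
  have b01: "b N w \<in> {0..1}" for N w
  proof (cases "length w \<le> N \<and> N > 0 \<and> set w \<subseteq> S")
    case True
    have "(\<Sum>i<N. G i (2 * N - i - length w) w) \<le> (\<Sum>i<N. Z (2 * N))"
    proof (rule sum_mono)
      fix i assume "i \<in> {..<N}"
      then have "i + length w + (2 * N - i - length w) = 2 * N" using True by auto
      then show "G i (2 * N - i - length w) w \<le> Z (2 * N)"
        using G_le_Z[of w "length w" i "2 * N - i - length w"] True by (simp add: lists_of_def)
    qed
    moreover have "0 \<le> (\<Sum>i<N. G i (2 * N - i - length w) w)"
      using True by (intro sum_nonneg G_nonneg) auto
    ultimately show ?thesis using True D[of N] by (simp add: b_def)
  next
    case False
    then have "b N w = 0" unfolding b_def by (rule if_not_P)
    then show ?thesis by simp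
  qed
  obtain L r where r: "strict_mono (r :: nat \<Rightarrow> nat)" and L: "\<And>w. (\<lambda>n. b (r n) w) \<longlonglongrightarrow> L w"
    using bounded_pointwise_subsequence[of b] b01 by blast
  have ev: "eventually (\<lambda>n. r n > k) sequentially" for k
  proof (rule eventually_sequentiallyI[of "Suc k"])
    fix n assume "Suc k \<le> n"
    then show "k < r n" using seq_suble[OF r, of n] by simp
  qed
  have L0: "L [] = 1"
  proof (rule LIMSEQ_unique[OF L])
    have "eventually (\<lambda>n. 1 = b (r n) []) sequentially"
      using ev[of 0]
    proof eventually_elim
      case (elim n)
      have "(\<Sum>i<r n. G i (2 * r n - i) []) = (\<Sum>i<r n. Z (2 * r n))"
        by (rule sum.cong) (auto simp: G_Nil)
      then show ?case using elim Z_pos[of "2 * r n"] by (simp add: b_def)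
    qed
    then show "(\<lambda>n. b (r n) []) \<longlonglongrightarrow> 1" by (rule Lim_transform_eventually[rotated]) simp
  qed
  have main: "0 \<le> L w \<and> (\<Sum>a\<in>S. L (a # w)) = L w \<and>
      (\<Sum>a\<in>S. L (w @ [a])) = L w \<and> L w \<le> K ^ 4 * (F w / Z (length w))" if w: "set w \<subseteq> S" for w
  proof (intro conjI)
    show "0 \<le> L w" by (rule LIMSEQ_le_const[OF L]) (use b01 in auto)
    show "(\<Sum>a\<in>S. L (w @ [a])) = L w"
    proof (rule LIMSEQ_unique)
      show "(\<lambda>n. \<Sum>a\<in>S. b (r n) (w @ [a])) \<longlonglongrightarrow> (\<Sum>a\<in>S. L (w @ [a]))"
        by (intro tendsto_sum L)
      have "eventually (\<lambda>n. b (r n) w = (\<Sum>a\<in>S. b (r n) (w @ [a]))) sequentially"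
        using ev[of "length w"]
      proof eventually_elim
        case (elim n)
        have "(\<Sum>a\<in>S. b (r n) (w @ [a])) = (\<Sum>a\<in>S. \<Sum>i<r n. G i (2 * r n - i - Suc (length w)) (w @ [a])) / (real (r n) * Z (2 * r n))"
          using elim w by (simp add: b_def sum_divide_distrib)
        also have "(\<Sum>a\<in>S. \<Sum>i<r n. G i (2 * r n - i - Suc (length w)) (w @ [a])) = (\<Sum>i<r n. G i (2 * r n - i - length w) w)"
        proof (subst sum.swap, rule sum.cong[OF refl])
          fix i assume "i \<in> {..<r n}"
          then have "Suc (2 * r n - i - Suc (length w)) = 2 * r n - i - length w" using elim by auto
          then show "(\<Sum>a\<in>S. G i (2 * r n - i - Suc (length w)) (w @ [a])) = G i (2 * r n - i - length w) w"
            using G_right[of i "2 * r n - i - Suc (length w)" w] by simp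
        qed
        finally show ?case using elim w by (simp add: b_def)
      qed
      then show "(\<lambda>n. \<Sum>a\<in>S. b (r n) (w @ [a])) \<longlonglongrightarrow> L w"
        using L[of w] by (rule Lim_transform_eventually[rotated])
    qed
    show "(\<Sum>a\<in>S. L (a # w)) = L w"
    proof (rule LIMSEQ_unique)
      show "(\<lambda>n. \<Sum>a\<in>S. b (r n) (a # w)) \<longlonglongrightarrow> (\<Sum>a\<in>S. L (a # w))"
        by (intro tendsto_sum L)
      \<comment> \<open>With \<open>N = r n\<close>, prepending a symbol turns the average over the
        positions \<open>i < N\<close> into the one over \<open>i + 1\<close>. All but two terms
        cancel; both lie between 0 and \<open>Z (2 * N)\<close>, and the average divides by
        \<open>N * Z (2 * N)\<close>.\<close>
      have 1: "eventually (\<lambda>n. norm ((\<Sum>a\<in>S. b (r n) (a # w)) - b (r n) w) \<le> 1 / real (r n)) sequentially"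
        using ev[of "length w"]
      proof eventually_elim
        case (elim n)
        let ?N = "r n"
        let ?g = "\<lambda>i. G i (2 * ?N - i - length w) w"
        have "(\<Sum>a\<in>S. b ?N (a # w)) = (\<Sum>a\<in>S. \<Sum>i<?N. G i (2 * ?N - i - Suc (length w)) (a # w)) / (real ?N * Z (2 * ?N))"
          using elim w by (simp add: b_def sum_divide_distrib)
        also have "(\<Sum>a\<in>S. \<Sum>i<?N. G i (2 * ?N - i - Suc (length w)) (a # w)) = (\<Sum>i<?N. ?g (Suc i))"
          by (subst sum.swap) (simp add: G_left)
        also have "\<dots> = (\<Sum>i<?N. ?g i) + (?g ?N - ?g 0)"
          using sum_lessThan_telescope[of ?g ?N] unfolding sum_subtractf by linarith
        finally have eq: "(\<Sum>a\<in>S. b ?N (a # w)) - b ?N w = (?g ?N - ?g 0) / (real ?N * Z (2 * ?N))"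
          using elim w by (simp add: b_def add_divide_distrib)
        have g: "0 \<le> ?g i \<and> ?g i \<le> Z (2 * ?N)" if "i \<le> ?N" for i
        proof -
          have "i + length w + (2 * ?N - i - length w) = 2 * ?N" using that elim by auto
          then show ?thesis using G_le_Z[of w "length w" i "2 * ?N - i - length w"] G_nonneg[OF w] w
            by (simp add: lists_of_def)
        qed
        have "\<bar>?g ?N - ?g 0\<bar> \<le> Z (2 * ?N)" using g[of ?N] g[of 0] by auto
        then have "\<bar>(?g ?N - ?g 0) / (real ?N * Z (2 * ?N))\<bar> \<le> Z (2 * ?N) / (real ?N * Z (2 * ?N))"
        proof -
          have "\<bar>(?g ?N - ?g 0) / (real ?N * Z (2 * ?N))\<bar> = \<bar>?g ?N - ?g 0\<bar> / (real ?N * Z (2 * ?N))"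
            unfolding abs_divide using D[of ?N] elim by (subst (2) abs_of_pos) auto
          then show ?thesis
            using \<open>\<bar>?g ?N - ?g 0\<bar> \<le> Z (2 * ?N)\<close> D[of ?N] elim by (simp only:) (intro divide_right_mono, auto)
        qed
        also have "\<dots> = 1 / real ?N" using Z_pos[of "2 * ?N"] by simp
        finally show ?case unfolding eq by simp
      qed
      have 2: "(\<lambda>n. 1 / real (r n)) \<longlonglongrightarrow> 0"
        using LIMSEQ_subseq_LIMSEQ[OF lim_1_over_n r] by (simp add: o_def)
      have "(\<lambda>n. (\<Sum>a\<in>S. b (r n) (a # w)) - b (r n) w) \<longlonglongrightarrow> 0"
        by (rule Lim_null_comparison[OF 1 2])
      from tendsto_add[OF this L[of w]] show "(\<lambda>n. \<Sum>a\<in>S. b (r n) (a # w)) \<longlonglongrightarrow> L w" by simp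
    qed
    show "L w \<le> K ^ 4 * (F w / Z (length w))"
    proof (rule tendsto_upperbound[OF L])
      show "eventually (\<lambda>n. b (r n) w \<le> K ^ 4 * (F w / Z (length w))) sequentially"
        using ev[of "length w"]
      proof eventually_elim
        case (elim n)
        let ?N = "r n"
        have "(\<Sum>i<?N. G i (2 * ?N - i - length w) w) \<le> (\<Sum>i<?N. K ^ 4 * (F w / Z (length w)) * Z (2 * ?N))"
        proof (rule sum_mono)
          fix i assume "i \<in> {..<?N}"
          then have "i + length w + (2 * ?N - i - length w) = 2 * ?N" using elim by auto
          then show "G i (2 * ?N - i - length w) w \<le> K ^ 4 * (F w / Z (length w)) * Z (2 * ?N)"
            using G_le[OF w, of i "2 * ?N - i - length w"] by simp
        qed
        also have "\<dots> = (K ^ 4 * (F w / Z (length w))) * (real ?N * Z (2 * ?N))" by simp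
        finally show ?case using elim w D[of ?N] by (simp add: b_def pos_divide_le_eq)
      qed
    qed simp
  qed
  show ?thesis using L0 main by blast
qed

end

section \<open>Hoelder potentials on full shifts\<close>

lemma funpow_shift: "(shift ^^ n) x = (\<lambda>i. x (i + int n))"
  by (induction n) (auto simp: shift_def ac_simps)

lemma shift_full_shift: "x \<in> full_shift S \<Longrightarrow> shift x \<in> full_shift S"
  by (auto simp: full_shift_def shift_def)

lemma funpow_shift_full_shift: "x \<in> full_shift S \<Longrightarrow> (shift ^^ n) x \<in> full_shift S"
  by (auto simp: full_shift_def funpow_shift)

lemma birkhoff_sum_add:
  "birkhoff_sum \<phi> (m + n) x = birkhoff_sum \<phi> m x + birkhoff_sum \<phi> n ((shift ^^ m) x)"
proof (induction n)
  case (Suc n)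
  have "(shift ^^ n) ((shift ^^ m) x) = (shift ^^ (m + n)) x"
    by (simp add: funpow_shift ac_simps)
  with Suc show ?case by (simp add: birkhoff_sum_def)
qed (simp add: birkhoff_sum_def)

lemma words_full_shift:
  assumes "S \<noteq> {}"
  shows "words (full_shift S) n = lists_of S n"
proof (intro equalityI subsetI)
  fix w assume "w \<in> words (full_shift S) n"
  then obtain x k where "length w = n" "x \<in> full_shift S" "\<forall>i<n. x (k + int i) = w ! i"
    by (auto simp: words_def)
  then show "w \<in> lists_of S n"
    by (auto simp: lists_of_def full_shift_def in_set_conv_nth) metis
next
  fix w assume w: "w \<in> lists_of S n"
  obtain a where a: "a \<in> S" using assms by blast
  define x where "x = (\<lambda>i. if 0 \<le> i \<and> nat i < length w then w ! nat i else a)"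
  have "x \<in> full_shift S" using w a by (auto simp: x_def full_shift_def lists_of_def subset_iff)
  moreover have "\<forall>i<n. x (0 + int i) = w ! i" using w by (simp add: x_def lists_of_def)
  ultimately show "w \<in> words (full_shift S) n" using w unfolding words_def lists_of_def by blast
qed

text \<open>Estimating \<open>z (m * n)\<close> in two ways shows that every lower slope
  \<open>(z n - c) / n\<close> is below every upper slope \<open>(z m + c) / m\<close>. Any number
  in between serves as \<open>P\<close>, with the same error \<open>c\<close> for all
  \<open>n\<close> and not merely o(n).\<close>

lemma almost_additive_linear:
  fixes z :: "nat \<Rightarrow> real"
  assumes z: "\<And>m n. \<bar>z (m + n) - z m - z n\<bar> \<le> c"
  shows "\<exists>P. \<forall>n. \<bar>z n - real n * P\<bar> \<le> c"
proof -
  have mult: "\<bar>z (Suc k * n) - real (Suc k) * z n\<bar> \<le> real k * c" for k n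
  proof (induction k)
    case (Suc k)
    then show ?case using z[of n "Suc k * n"] by (simp add: algebra_simps)
  qed simp
  have c: "c \<ge> 0" using z[of 0 0] by linarith
  have key: "(z n - c) / real n \<le> (z m + c) / real m" if "n > 0" "m > 0" for m n
  proof -
    obtain n' m' where nm: "n = Suc n'" "m = Suc m'"
      using \<open>n > 0\<close> \<open>m > 0\<close> unfolding gr0_conv_Suc by blast
    have "real m * z n - real m' * c \<le> z (m * n)"
      using mult[of m' n, folded nm] by linarith
    also have "\<dots> \<le> real n * z m + real n' * c"
      unfolding mult.commute[of m n] using mult[of n' m, folded nm] by linarith
    finally have "real m * z n - real m' * c \<le> real n * z m + real n' * c" .
    then have "real m * (z n - c) \<le> real n * (z m + c)" using c nm by (simp add: algebra_simps)
    then show ?thesis using that by (simp add: field_simps)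
  qed
  define P where "P = (SUP n\<in>{0<..}. (z n - c) / real n)"
  have bdd: "bdd_above ((\<lambda>n. (z n - c) / real n) ` {0<..})"
    using key[of _ 1] by (intro bdd_aboveI[of _ "z 1 + c"]) auto
  have "\<bar>z n - real n * P\<bar> \<le> c" for n
  proof (cases "n = 0")
    case True
    then show ?thesis using z[of 0 0] by simp
  next
    case False
    have "(z n - c) / real n \<le> P"
      unfolding P_def using False by (intro cSUP_upper bdd) auto
    moreover have "P \<le> (z n + c) / real n"
      unfolding P_def using False key by (intro cSUP_least) (auto intro: exI[of _ 1])
    ultimately show ?thesis using False by (simp add: field_simps abs_le_iff)
  qed
  then show ?thesis by blast
qed

text \<open>The upper error may grow with \<open>n\<close>, since the partition function of the
  two-coloured shift is bounded only by e^{nP} times a linear factor.\<close>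

lemma pressure_eqI:
  assumes "\<And>n. n > 0 \<Longrightarrow> real n * P - l \<le> ln (partition_function X \<phi> n)"
    and "\<And>n. n > 0 \<Longrightarrow> ln (partition_function X \<phi> n) \<le> real n * P + u n"
    and u: "(\<lambda>n. u n / real n) \<longlonglongrightarrow> 0"
  shows "pressure X \<phi> = P"
proof -
  have "(\<lambda>n. ln (partition_function X \<phi> n) / real n) \<longlonglongrightarrow> P"
  proof (rule tendsto_sandwich)
    show "eventually (\<lambda>n. P - l / real n \<le> ln (partition_function X \<phi> n) / real n) sequentially"
      using eventually_gt_at_top[of 0]
    proof eventually_elim
      case (elim n)
      then have "(real n * P - l) / real n \<le> ln (partition_function X \<phi> n) / real n"
        using assms(1)[of n] by (intro divide_right_mono) auto
      then show ?case using elim by (simp add: diff_divide_distrib)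
    qed
    show "eventually (\<lambda>n. ln (partition_function X \<phi> n) / real n \<le> P + u n / real n) sequentially"
      using eventually_gt_at_top[of 0]
    proof eventually_elim
      case (elim n)
      then have "ln (partition_function X \<phi> n) / real n \<le> (real n * P + u n) / real n"
        using assms(2)[of n] by (intro divide_right_mono) auto
      then show ?case using elim by (simp add: add_divide_distrib)
    qed
    show "(\<lambda>n. P - l / real n) \<longlonglongrightarrow> P"
      using tendsto_diff[OF tendsto_const[of P] tendsto_divide_0[OF tendsto_const[of l] filterlim_real_at_infinity_sequentially]]
      by simp
    show "(\<lambda>n. P + u n / real n) \<longlonglongrightarrow> P" using tendsto_add[OF tendsto_const[of P] u] by simp
  qed
  then have "limsup (\<lambda>n. ereal (ln (partition_function X \<phi> n) / real n)) = ereal P"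
    by (intro lim_imp_Limsup) auto
  then show ?thesis by (simp add: pressure_def)
qed

text \<open>Agreement up to distance \<open>n\<close> is assumed, without the disagreement at
  distance exactly \<open>n\<close> of the Hoelder definition: distortion estimates know only where
  two points agree.\<close>

locale holder_potential =
  fixes S :: "nat set" and \<phi> :: "point \<Rightarrow> real" and \<theta> C :: real
  assumes finite_symbols: "finite S" and symbols_nonempty: "S \<noteq> {}"
    and \<theta>: "0 < \<theta>" "\<theta> < 1" and C: "0 \<le> C"
    and holder: "x \<in> full_shift S \<Longrightarrow> y \<in> full_shift S \<Longrightarrow> n > 0 \<Longrightarrow>
      (\<And>i. \<bar>i\<bar> < int n \<Longrightarrow> x i = y i) \<Longrightarrow> \<bar>\<phi> x - \<phi> y\<bar> \<le> C * \<theta> ^ n"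

text \<open>If the first disagreement is at distance \<open>m \<ge> n\<close>, the definition gives
  \<theta>^m, which is at most \<theta>^n. Passing to the absolute value of \<open>C\<close> makes
  this last step monotone.\<close>

lemma holder_potentialI:
  assumes "finite S" "S \<noteq> {}" "holder_continuous_on (full_shift S) \<phi>"
  shows "\<exists>\<theta> C. holder_potential S \<phi> \<theta> C"
proof -
  obtain \<theta> C where \<theta>: "0 < \<theta>" "\<theta> < 1" and h: "\<forall>n>0. \<forall>x\<in>full_shift S. \<forall>y\<in>full_shift S.
      (\<forall>i. \<bar>i\<bar> < int n \<longrightarrow> x i = y i) \<and> (x (- int n) \<noteq> y (- int n) \<or> x (int n) \<noteq> y (int n)) \<longrightarrow>
      \<bar>\<phi> x - \<phi> y\<bar> \<le> C * \<theta> ^ n"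
    using assms(3) unfolding holder_continuous_on_def by (elim exE conjE) (rule that)
  have "holder_potential S \<phi> \<theta> \<bar>C\<bar>"
  proof
    fix x y n assume xy: "x \<in> full_shift S" "y \<in> full_shift S" and n: "(n::nat) > 0"
      and eq: "\<And>i. \<bar>i\<bar> < int n \<Longrightarrow> x i = y i"
    show "\<bar>\<phi> x - \<phi> y\<bar> \<le> \<bar>C\<bar> * \<theta> ^ n"
    proof (cases "x = y")
      case True
      then show ?thesis using \<theta> by simp
    next
      case False
      then obtain j where j: "x j \<noteq> y j" by blast
      define m where "m = (LEAST m. x (- int m) \<noteq> y (- int m) \<or> x (int m) \<noteq> y (int m))"
      have "\<exists>m. x (- int m) \<noteq> y (- int m) \<or> x (int m) \<noteq> y (int m)"
        by (rule exI[of _ "nat \<bar>j\<bar>"]) (use j in \<open>auto simp: abs_if\<close>)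
      then have m1: "x (- int m) \<noteq> y (- int m) \<or> x (int m) \<noteq> y (int m)"
        unfolding m_def by (rule LeastI_ex)
      have m2: "x i = y i" if "\<bar>i\<bar> < int m" for i
      proof -
        have "nat \<bar>i\<bar> < m" using that by simp
        then have "\<not> (x (- int (nat \<bar>i\<bar>)) \<noteq> y (- int (nat \<bar>i\<bar>)) \<or> x (int (nat \<bar>i\<bar>)) \<noteq> y (int (nat \<bar>i\<bar>)))"
          unfolding m_def by (rule not_less_Least)
        then show ?thesis by (cases "i \<ge> 0") auto
      qed
      have "n \<le> m"
      proof (rule ccontr)
        assume "\<not> n \<le> m"
        then show False using m1 eq[of "int m"] eq[of "- int m"] by auto
      qed
      have "\<bar>\<phi> x - \<phi> y\<bar> \<le> C * \<theta> ^ m" using h[rule_format, OF _ xy, of m] m1 m2 \<open>n \<le> m\<close> n by simp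
      also have "\<dots> \<le> \<bar>C\<bar> * \<theta> ^ m" using \<theta> by (intro mult_right_mono) auto
      also have "\<dots> \<le> \<bar>C\<bar> * \<theta> ^ n" using \<theta> \<open>n \<le> m\<close> by (intro mult_left_mono power_decreasing) auto
      finally show ?thesis .
    qed
  qed (use assms \<theta> in auto)
  then show ?thesis by blast
qed

context holder_potential
begin

text \<open>The Hoelder errors along a word, measured by the distance to its left and to its right
  end, form two geometric series, each of sum at most \<open>C / (1 - \<theta>)\<close>.\<close>

definition \<kappa> :: real where "\<kappa> = 2 * C / (1 - \<theta>)"

lemma \<kappa>_nonneg: "\<kappa> \<ge> 0"
  using \<theta> C by (simp add: \<kappa>_def)

text \<open>The exponent is the distance from \<open>j\<close> to the nearest coordinate outside the
  word. Only closeness of values is assumed, so the lemma serves for two points of a full shift and,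
  later, for a point of the larger subshift against a monochromatic one.\<close>

lemma birkhoff_sum_close:
  assumes "\<And>j. j < n \<Longrightarrow> \<bar>\<psi> ((shift ^^ j) x) - \<phi> ((shift ^^ j) y)\<bar> \<le> C * \<theta> ^ min (Suc j) (n - j)"
  shows "\<bar>birkhoff_sum \<psi> n x - birkhoff_sum \<phi> n y\<bar> \<le> \<kappa>"
proof -
  have geom: "(\<Sum>j<n. \<theta> ^ j) \<le> 1 / (1 - \<theta>)"
    using \<theta> by (subst sum_gp_strict) (auto simp: divide_right_mono)
  have "\<bar>birkhoff_sum \<psi> n x - birkhoff_sum \<phi> n y\<bar> \<le> (\<Sum>j<n. \<bar>\<psi> ((shift ^^ j) x) - \<phi> ((shift ^^ j) y)\<bar>)"
    unfolding birkhoff_sum_def sum_subtractf[symmetric] by (rule sum_abs)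
  also have "\<dots> \<le> (\<Sum>j<n. C * \<theta> ^ j + C * \<theta> ^ (n - Suc j))"
  proof (rule sum_mono)
    fix j assume "j \<in> {..<n}"
    have "\<theta> ^ min (Suc j) (n - j) \<le> \<theta> ^ j + \<theta> ^ (n - Suc j)"
    proof (cases "Suc j \<le> n - j")
      case True
      then have "\<theta> ^ min (Suc j) (n - j) \<le> \<theta> ^ j" using \<theta> by (intro power_decreasing) auto
      then show ?thesis using \<theta> by (simp add: add_increasing2)
    next
      case False
      then have "\<theta> ^ min (Suc j) (n - j) \<le> \<theta> ^ (n - Suc j)" using \<theta> by (intro power_decreasing) auto
      then show ?thesis using \<theta> by (simp add: add_increasing)
    qed
    then have "C * \<theta> ^ min (Suc j) (n - j) \<le> C * (\<theta> ^ j + \<theta> ^ (n - Suc j))"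
      using C by (rule mult_left_mono)
    then show "\<bar>\<psi> ((shift ^^ j) x) - \<phi> ((shift ^^ j) y)\<bar> \<le> C * \<theta> ^ j + C * \<theta> ^ (n - Suc j)"
      using assms[of j] \<open>j \<in> {..<n}\<close> by (simp add: distrib_left)
  qed
  also have "\<dots> = 2 * C * (\<Sum>j<n. \<theta> ^ j)"
    by (simp add: sum.distrib sum_distrib_left[symmetric] sum.nat_diff_reindex[of "\<lambda>j. \<theta> ^ j"])
  also have "\<dots> \<le> \<kappa>"
    unfolding \<kappa>_def using mult_left_mono[OF geom, of "2 * C"] C by simp
  finally show ?thesis .
qed

lemma birkhoff_sum_distortion:
  assumes "x \<in> full_shift S" "y \<in> full_shift S" and eq: "\<And>i. i < n \<Longrightarrow> x (int i) = y (int i)"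
  shows "\<bar>birkhoff_sum \<phi> n x - birkhoff_sum \<phi> n y\<bar> \<le> \<kappa>"
proof (rule birkhoff_sum_close)
  fix j assume j: "j < n"
  show "\<bar>\<phi> ((shift ^^ j) x) - \<phi> ((shift ^^ j) y)\<bar> \<le> C * \<theta> ^ min (Suc j) (n - j)"
  proof (rule holder)
    fix i assume i: "\<bar>i\<bar> < int (min (Suc j) (n - j))"
    then have "x (int (nat (i + int j))) = y (int (nat (i + int j)))" using j by (intro eq) auto
    moreover have "int (nat (i + int j)) = i + int j" using i by auto
    ultimately show "(shift ^^ j) x i = (shift ^^ j) y i" by (simp add: funpow_shift)
  qed (use assms j in \<open>auto intro: funpow_shift_full_shift\<close>)
qed

text \<open>Up to \<open>C * \<theta>\<close>, the value at \<open>x\<close> is the value at the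
  constant sequence with symbol \<open>x 0\<close>, and there are finitely many of these.\<close>

lemma bounded_potential: "\<exists>B. \<forall>x\<in>full_shift S. \<bar>\<phi> x\<bar> \<le> B"
proof -
  let ?c = "\<lambda>s::nat. (\<lambda>_::int. s)"
  have "\<bar>\<phi> x\<bar> \<le> (\<Sum>s\<in>S. \<bar>\<phi> (?c s)\<bar>) + C * \<theta>" if x: "x \<in> full_shift S" for x
  proof -
    have s: "x 0 \<in> S" using x by (simp add: full_shift_def)
    have "\<bar>\<phi> x - \<phi> (?c (x 0))\<bar> \<le> C * \<theta> ^ 1"
      by (rule holder) (use x s in \<open>auto simp: full_shift_def\<close>)
    moreover have "\<bar>\<phi> (?c (x 0))\<bar> \<le> (\<Sum>s\<in>S. \<bar>\<phi> (?c s)\<bar>)"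
      by (rule member_le_sum[OF s]) (auto simp: finite_symbols)
    ultimately show ?thesis by simp
  qed
  then show ?thesis by blast
qed

lemma bdd_above_potential: "bdd_above (\<phi> ` full_shift S)"
proof -
  obtain B where "\<forall>x\<in>full_shift S. \<bar>\<phi> x\<bar> \<le> B" using bounded_potential by blast
  then have "\<forall>x\<in>full_shift S. \<phi> x \<le> B" by (auto simp: abs_le_iff)
  then show ?thesis by (intro bdd_aboveI[of _ B]) auto
qed

text \<open>A fixed point of the cylinder of \<open>w\<close>; by bounded distortion the padding
  affects Birkhoff sums over the word by at most \<kappa>.\<close>

definition ext :: "nat list \<Rightarrow> point" where
  "ext w = (\<lambda>i. if 0 \<le> i \<and> nat i < length w then w ! nat i else (SOME s. s \<in> S))"

lemma ext_in: "set w \<subseteq> S \<Longrightarrow> ext w \<in> full_shift S"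
  using symbols_nonempty by (auto simp: ext_def full_shift_def some_in_eq subset_iff)

lemma ext_nth: "i < length w \<Longrightarrow> ext w (int i) = w ! i"
  by (simp add: ext_def)

definition weight :: "nat list \<Rightarrow> real" where
  "weight w = exp (birkhoff_sum \<phi> (length w) (ext w))"

lemma ln_weight: "ln (weight w) = birkhoff_sum \<phi> (length w) (ext w)"
  by (simp add: weight_def)

lemma ln_weight_append:
  assumes "set u \<subseteq> S" "set v \<subseteq> S"
  shows "\<bar>ln (weight (u @ v)) - (ln (weight u) + ln (weight v))\<bar> \<le> 2 * \<kappa>"
proof -
  let ?x = "ext (u @ v)"
  have x: "?x \<in> full_shift S" using assms by (intro ext_in) auto
  have 1: "\<bar>birkhoff_sum \<phi> (length u) ?x - birkhoff_sum \<phi> (length u) (ext u)\<bar> \<le> \<kappa>"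
    by (rule birkhoff_sum_distortion) (use assms x ext_in in \<open>auto simp: ext_nth nth_append\<close>)
  have 2: "\<bar>birkhoff_sum \<phi> (length v) ((shift ^^ length u) ?x) - birkhoff_sum \<phi> (length v) (ext v)\<bar> \<le> \<kappa>"
  proof (rule birkhoff_sum_distortion)
    fix i assume "i < length v"
    moreover have "int i + int (length u) = int (length u + i)" by simp
    ultimately show "(shift ^^ length u) ?x (int i) = ext v (int i)"
      by (simp only: funpow_shift) (subst ext_nth, auto simp: ext_nth)
  qed (use assms x ext_in funpow_shift_full_shift in auto)
  show ?thesis using 1 2 by (simp add: ln_weight birkhoff_sum_add)
qed

sublocale quasi_multiplicative S weight "exp (2 * \<kappa>)"
proof
  fix u v assume uv: "set u \<subseteq> S" "set v \<subseteq> S"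
  have "ln (weight (u @ v)) \<le> 2 * \<kappa> + ln (weight u) + ln (weight v)"
    using ln_weight_append[OF uv] by (simp add: abs_le_iff)
  then have "exp (ln (weight (u @ v))) \<le> exp (2 * \<kappa> + ln (weight u) + ln (weight v))" by simp
  then show "weight (u @ v) \<le> exp (2 * \<kappa>) * weight u * weight v" by (simp add: exp_add ln_weight) (simp add: weight_def)
  have "ln (weight u) + ln (weight v) \<le> 2 * \<kappa> + ln (weight (u @ v))"
    using ln_weight_append[OF uv] by (simp add: abs_le_iff)
  then have "exp (ln (weight u) + ln (weight v)) \<le> exp (2 * \<kappa> + ln (weight (u @ v)))" by simp
  then show "weight u * weight v \<le> exp (2 * \<kappa>) * weight (u @ v)" by (simp add: exp_add ln_weight) (simp add: weight_def)
qed (use finite_symbols symbols_nonempty \<kappa>_nonneg in \<open>auto simp: weight_def\<close>)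

lemma ln_Z_append: "\<bar>ln (Z (m + n)) - ln (Z m) - ln (Z n)\<bar> \<le> 2 * \<kappa>"
proof -
  have "ln (Z (m + n)) \<le> ln (exp (2 * \<kappa>) * Z m * Z n)"
    using Z_add_le[of m n] Z_pos by (subst ln_le_cancel_iff) auto
  moreover have "ln (Z m * Z n) \<le> ln (exp (2 * \<kappa>) * Z (m + n))"
    using Z_add_ge[of m n] Z_pos by (subst ln_le_cancel_iff) auto
  ultimately show ?thesis using Z_pos[of m] Z_pos[of n] Z_pos[of "m + n"] by (simp add: ln_mult)
qed

text \<open>Stated for arbitrary points \<open>c w\<close>, because the partition function picks an
  unspecified point of each cylinder, and a recoded shift picks its points through another
  alphabet.\<close>

lemma ln_partition_function:
  assumes "\<And>w. w \<in> lists_of S n \<Longrightarrow> \<bar>birkhoff_sum \<psi> n (c w) - birkhoff_sum \<phi> n (ext w)\<bar> \<le> k"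
  shows "\<bar>ln (\<Sum>w\<in>lists_of S n. exp (birkhoff_sum \<psi> n (c w))) - ln (Z n)\<bar> \<le> k"
proof -
  let ?Y = "\<Sum>w\<in>lists_of S n. exp (birkhoff_sum \<psi> n (c w))"
  have Y: "?Y > 0" by (rule sum_pos) (auto simp: lists_of_nonempty symbols_nonempty finite_symbols)
  have "?Y \<le> (\<Sum>w\<in>lists_of S n. exp k * weight w)"
  proof (rule sum_mono)
    fix w assume w: "w \<in> lists_of S n"
    then have "birkhoff_sum \<psi> n (c w) \<le> k + birkhoff_sum \<phi> n (ext w)" using assms[OF w] by (simp add: abs_le_iff)
    then show "exp (birkhoff_sum \<psi> n (c w)) \<le> exp k * weight w"
      using w by (simp add: weight_def lists_of_def exp_add[symmetric])
  qed
  then have 1: "?Y \<le> exp k * Z n" by (simp add: Z_def sum_distrib_left)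
  have "Z n \<le> (\<Sum>w\<in>lists_of S n. exp k * exp (birkhoff_sum \<psi> n (c w)))"
    unfolding Z_def
  proof (rule sum_mono)
    fix w assume w: "w \<in> lists_of S n"
    then have "birkhoff_sum \<phi> n (ext w) \<le> k + birkhoff_sum \<psi> n (c w)" using assms[OF w] by (simp add: abs_le_iff)
    then show "weight w \<le> exp k * exp (birkhoff_sum \<psi> n (c w))"
      using w by (simp add: weight_def lists_of_def exp_add[symmetric])
  qed
  then have 2: "Z n \<le> exp k * ?Y" by (simp add: sum_distrib_left)
  have "ln ?Y \<le> ln (exp k * Z n)" using 1 Y Z_pos[of n] by (subst ln_le_cancel_iff) auto
  moreover have "ln (Z n) \<le> ln (exp k * ?Y)" using 2 Y Z_pos[of n] by (subst ln_le_cancel_iff) auto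
  ultimately show ?thesis using Y Z_pos[of n] by (simp add: ln_mult)
qed

text \<open>Almost additivity of \<open>ln (Z n)\<close> with constant \<open>2 * \<kappa>\<close>
  bounds the error uniformly in \<open>n\<close>. This is what later makes the total normalised
  weight of monochromatic words bounded.\<close>

lemma ln_Z_pressure: "\<bar>ln (Z n) - real n * pressure (full_shift S) \<phi>\<bar> \<le> 2 * \<kappa>"
proof -
  obtain P where P: "\<And>n. \<bar>ln (Z n) - real n * P\<bar> \<le> 2 * \<kappa>"
    using almost_additive_linear[of "\<lambda>n. ln (Z n)", OF ln_Z_append] by blast
  have pf: "\<bar>ln (partition_function (full_shift S) \<phi> n) - ln (Z n)\<bar> \<le> \<kappa>" for n
    unfolding partition_function_def words_full_shift[OF symbols_nonempty]
  proof (rule ln_partition_function)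
    fix w assume w: "w \<in> lists_of S n"
    then have "ext w \<in> cylinder (full_shift S) w" by (auto simp: cylinder_def ext_nth ext_in lists_of_def)
    then have c: "(SOME x. x \<in> cylinder (full_shift S) w) \<in> cylinder (full_shift S) w"
      by (rule someI[of "\<lambda>x. x \<in> cylinder (full_shift S) w"])
    show "\<bar>birkhoff_sum \<phi> n (SOME x. x \<in> cylinder (full_shift S) w) - birkhoff_sum \<phi> n (ext w)\<bar> \<le> \<kappa>"
      by (rule birkhoff_sum_distortion) (use c w in \<open>auto simp: cylinder_def ext_nth ext_in lists_of_def\<close>)
  qed
  have "pressure (full_shift S) \<phi> = P"
  proof (rule pressure_eqI)
    show "real n * P - 3 * \<kappa> \<le> ln (partition_function (full_shift S) \<phi> n)"
      "ln (partition_function (full_shift S) \<phi> n) \<le> real n * P + 3 * \<kappa>" for n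
      using P[of n] pf[of n] by auto
    show "(\<lambda>n. 3 * \<kappa> / real n) \<longlonglongrightarrow> 0"
      by (rule tendsto_divide_0[OF tendsto_const filterlim_real_at_infinity_sequentially])
  qed
  with P show ?thesis by simp
qed

end

section \<open>Entropy of partitions\<close>

lemma (in prob_space) integral_partition:
  fixes u :: "'a \<Rightarrow> real"
  assumes \<xi>: "measurable_partition M \<xi>" and u: "integrable M u"
  shows "(\<integral>x. u x \<partial>M) = (\<Sum>A\<in>\<xi>. \<integral>x. indicator A x * u x \<partial>M)"
proof -
  have fin: "finite \<xi>" and sub: "\<xi> \<subseteq> sets M" and part: "partition_on (space M) \<xi>"
    using \<xi> by (auto simp: measurable_partition_def)
  have "u x = (\<Sum>A\<in>\<xi>. indicator A x * u x)" if x: "x \<in> space M" for x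
  proof -
    obtain A where A: "A \<in> \<xi>" "x \<in> A" using x partition_onD1[OF part] by blast
    have "indicator B x = (if B = A then 1 else 0 :: real)" if "B \<in> \<xi>" for B
      using partition_onD2[OF part] A that by (auto simp: disjoint_def indicator_def)
    then have "(\<Sum>B\<in>\<xi>. indicator B x * u x) = (\<Sum>B\<in>\<xi>. if B = A then u x else 0)"
      by (intro sum.cong) auto
    then show ?thesis using A fin by simp
  qed
  moreover have "integrable M (\<lambda>x. indicator A x * u x)" if "A \<in> \<xi>" for A
    using integrable_real_mult_indicator[OF _ u, of A] that sub by (auto simp: mult.commute)
  ultimately have "(\<integral>x. u x \<partial>M) = (\<integral>x. (\<Sum>A\<in>\<xi>. indicator A x * u x) \<partial>M)"
    by (intro Bochner_Integration.integral_cong) auto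
  also have "\<dots> = (\<Sum>A\<in>\<xi>. \<integral>x. indicator A x * u x \<partial>M)"
    by (intro Bochner_Integration.integral_sum) fact
  finally show ?thesis .
qed

lemma (in prob_space) sum_measure_partition:
  assumes \<xi>: "measurable_partition M \<xi>"
  shows "(\<Sum>A\<in>\<xi>. measure M A) = 1"
proof -
  have "\<xi> \<subseteq> sets M" using \<xi> by (auto simp: measurable_partition_def)
  then show ?thesis using integral_partition[OF \<xi>, of "\<lambda>_. 1"] by (auto simp: prob_space subset_iff intro!: sum.cong[symmetric])
qed

lemma (in prob_space) measure_times_le_integral:
  assumes A: "A \<in> sets M" and u: "integrable M u"
    and le: "measure M A > 0 \<Longrightarrow> AE x in M. x \<in> A \<longrightarrow> c \<le> u x"
  shows "measure M A * c \<le> (\<integral>x. indicator A x * u x \<partial>M)"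
proof (cases "measure M A = 0")
  case True
  then have "A \<in> null_sets M" using A by (auto simp: null_sets_def emeasure_eq_measure)
  then have "AE x in M. x \<notin> A" by (rule AE_not_in)
  then have "(\<integral>x. indicator A x * u x \<partial>M) = (\<integral>x. 0 \<partial>M)"
    using A u by (intro integral_cong_AE) auto
  then show ?thesis using True by simp
next
  case False
  then have pos: "measure M A > 0" by (simp add: zero_less_measure_iff)
  have "(\<integral>x. indicator A x * c \<partial>M) \<le> (\<integral>x. indicator A x * u x \<partial>M)"
  proof (rule integral_mono_AE)
    show "AE x in M. indicator A x * c \<le> indicator A x * u x"
      using le[OF pos] by eventually_elim (auto simp: indicator_def)
    show "integrable M (\<lambda>x. indicator A x * u x)"
      using integrable_real_mult_indicator[OF A u] by (simp add: mult.commute)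
    show "integrable M (\<lambda>x. indicator A x * c)"
      using A by (intro integrable_mult_left) (auto simp: integrable_indicator_iff emeasure_eq_measure)
  qed
  then show ?thesis using A by (simp add: sets.Int_space_eq2)
qed

text \<open>Entropy is the integral of the information function, which is
  \<open>- ln (measure M A)\<close> on \<open>A\<close>. Elements of measure zero contribute
  nothing, so the bound is asked only on the others.\<close>

lemma (in prob_space) partition_entropy_ge:
  assumes \<xi>: "measurable_partition M \<xi>" and u: "integrable M u"
    and le: "\<And>A. A \<in> \<xi> \<Longrightarrow> measure M A > 0 \<Longrightarrow> AE x in M. x \<in> A \<longrightarrow> u x \<le> - ln (measure M A)"
  shows "(\<integral>x. u x \<partial>M) \<le> partition_entropy M \<xi>"
proof -
  have iu: "integrable M (\<lambda>x. - u x)" using u by simp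
  have "measure M A * ln (measure M A) \<le> (\<integral>x. indicator A x * - u x \<partial>M)" if A: "A \<in> \<xi>" for A
  proof (rule measure_times_le_integral[OF _ iu])
    show "A \<in> sets M" using A \<xi> by (auto simp: measurable_partition_def)
    assume "measure M A > 0"
    from le[OF A this] show "AE x in M. x \<in> A \<longrightarrow> ln (measure M A) \<le> - u x" by eventually_elim auto
  qed
  then have "(\<Sum>A\<in>\<xi>. measure M A * ln (measure M A)) \<le> (\<Sum>A\<in>\<xi>. \<integral>x. indicator A x * - u x \<partial>M)"
    by (rule sum_mono)
  also have "\<dots> = (\<integral>x. - u x \<partial>M)" by (rule integral_partition[OF \<xi> iu, symmetric])
  finally show ?thesis by (simp add: partition_entropy_def)
qed

text \<open>Gibbs' inequality, from ln t <= t - 1 with t = q A / \<mu> A. The masses of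
  \<open>q\<close> enter only through their sum, so sub-probability weights are enough.\<close>

lemma (in prob_space) partition_entropy_le:
  assumes \<xi>: "measurable_partition M \<xi>" and u: "integrable M u"
    and q: "\<And>A. A \<in> \<xi> \<Longrightarrow> 0 < q A" "(\<Sum>A\<in>\<xi>. q A) \<le> 1"
    and le: "\<And>A. A \<in> \<xi> \<Longrightarrow> measure M A > 0 \<Longrightarrow> AE x in M. x \<in> A \<longrightarrow> - ln (q A) \<le> u x"
  shows "partition_entropy M \<xi> \<le> (\<integral>x. u x \<partial>M)"
proof -
  have term_le: "- (measure M A * ln (measure M A)) \<le> q A - measure M A + (\<integral>x. indicator A x * u x \<partial>M)" if A: "A \<in> \<xi>" for A
  proof -
    have "A \<in> sets M" using A \<xi> by (auto simp: measurable_partition_def)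
    then have "measure M A * - ln (q A) \<le> (\<integral>x. indicator A x * u x \<partial>M)"
      using u le[OF A] by (rule measure_times_le_integral)
    moreover have "- (measure M A * ln (measure M A)) \<le> q A - measure M A + measure M A * (- ln (q A))"
    proof (cases "measure M A = 0")
      case False
      then have pos: "measure M A > 0" by (simp add: zero_less_measure_iff)
      have "ln (q A / measure M A) \<le> q A / measure M A - 1"
        using q(1)[OF A] pos by (intro ln_le_minus_one) auto
      then have "measure M A * (ln (q A) - ln (measure M A)) \<le> measure M A * (q A / measure M A - 1)"
        using q(1)[OF A] pos by (intro mult_left_mono) (auto simp: ln_div)
      then show ?thesis using pos by (simp add: algebra_simps)
    qed (use q(1)[OF A] in simp)
    ultimately show ?thesis by linarith
  qed
  have "partition_entropy M \<xi> \<le> (\<Sum>A\<in>\<xi>. q A - measure M A + (\<integral>x. indicator A x * u x \<partial>M))"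
    unfolding partition_entropy_def sum_negf[symmetric] by (intro sum_mono term_le)
  also have "\<dots> = (\<Sum>A\<in>\<xi>. q A) - 1 + (\<integral>x. u x \<partial>M)"
    by (simp add: sum.distrib sum_subtractf integral_partition[OF \<xi> u] sum_measure_partition[OF \<xi>])
  finally show ?thesis using q(2) by simp
qed

lemma measurable_partition_refined:
  assumes \<xi>: "measurable_partition M \<xi>" and T: "T \<in> M \<rightarrow>\<^sub>M M"
  shows "measurable_partition M (refined_partition M T \<xi> n)"
proof -
  have fin: "finite \<xi>" and sub: "\<xi> \<subseteq> sets M" and part: "partition_on (space M) \<xi>"
    using \<xi> by (auto simp: measurable_partition_def)
  have Tn: "(T ^^ i) \<in> M \<rightarrow>\<^sub>M M" for i
    by (induction i) (use T in \<open>auto intro: measurable_comp\<close>)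
  let ?A = "\<lambda>F. {x \<in> space M. \<forall>i<n. (T ^^ i) x \<in> F i}"
  \<comment> \<open>An element depends only on \<open>F i\<close> for \<open>i < n\<close>, and
    restricting \<open>F\<close> to these indices leaves finitely many functions.\<close>
  have "refined_partition M T \<xi> n \<subseteq> ?A ` (PiE {..<n} (\<lambda>_. \<xi>))"
  proof
    fix A assume "A \<in> refined_partition M T \<xi> n"
    then obtain F where F: "A = ?A F" "\<forall>i<n. F i \<in> \<xi>" by (auto simp: refined_partition_def)
    then have "A = ?A (restrict F {..<n})" "restrict F {..<n} \<in> PiE {..<n} (\<lambda>_. \<xi>)" by auto
    then show "A \<in> ?A ` (PiE {..<n} (\<lambda>_. \<xi>))" by blast
  qed
  then have 1: "finite (refined_partition M T \<xi> n)"
    by (rule finite_subset) (intro finite_imageI finite_PiE fin, simp)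
  have 2: "refined_partition M T \<xi> n \<subseteq> sets M"
  proof
    fix A assume "A \<in> refined_partition M T \<xi> n"
    then obtain F where F: "A = ?A F" "\<forall>i<n. F i \<in> \<xi>" by (auto simp: refined_partition_def)
    have "{x \<in> space M. \<forall>i\<in>{..<n}. (T ^^ i) x \<in> F i} \<in> sets M"
    proof (rule sets.sets_Collect_finite_All)
      fix i assume "i \<in> {..<n}"
      then have "F i \<in> sets M" using F sub by auto
      from measurable_sets[OF Tn this] show "{x \<in> space M. (T ^^ i) x \<in> F i} \<in> sets M"
        by (simp add: vimage_def Int_def conj_commute)
    qed simp
    moreover have "A = {x \<in> space M. \<forall>i\<in>{..<n}. (T ^^ i) x \<in> F i}" using F by auto
    ultimately show "A \<in> sets M" by simp
  qed
  have 3: "partition_on (space M) (refined_partition M T \<xi> n)"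
  proof (rule partition_onI)
    show "\<Union> (refined_partition M T \<xi> n) = space M"
    proof (intro equalityI subsetI)
      fix x assume x: "x \<in> space M"
      have "\<exists>A. A \<in> \<xi> \<and> (T ^^ i) x \<in> A" for i
        using measurable_space[OF Tn x] partition_onD1[OF part] by blast
      then obtain F where F: "\<And>i. F i \<in> \<xi> \<and> (T ^^ i) x \<in> F i" by metis
      then have "x \<in> ?A F" using x by auto
      moreover have "?A F \<in> refined_partition M T \<xi> n"
        unfolding refined_partition_def using F \<open>x \<in> ?A F\<close> by blast
      ultimately show "x \<in> \<Union> (refined_partition M T \<xi> n)" by blast
    qed (auto simp: refined_partition_def)
    show "{} \<notin> refined_partition M T \<xi> n" by (simp add: refined_partition_def)
    fix A B assume A: "A \<in> refined_partition M T \<xi> n" and B: "B \<in> refined_partition M T \<xi> n" and "A \<noteq> B"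
    obtain F where F: "A = ?A F" "\<forall>i<n. F i \<in> \<xi>" using A by (auto simp: refined_partition_def)
    obtain G where G: "B = ?A G" "\<forall>i<n. G i \<in> \<xi>" using B by (auto simp: refined_partition_def)
    show "disjnt A B"
    proof (rule ccontr)
      assume "\<not> disjnt A B"
      then obtain x where x: "x \<in> A" "x \<in> B" by (auto simp: disjnt_def)
      have "F i = G i" if "i < n" for i
      proof -
        have "F i \<in> \<xi>" "G i \<in> \<xi>" "(T ^^ i) x \<in> F i \<inter> G i" using x F G that by auto
        then show ?thesis using partition_onD2[OF part] unfolding disjoint_def by blast
      qed
      then show False using \<open>A \<noteq> B\<close> F G by auto
    qed
  qed
  show ?thesis using 1 2 3 by (simp add: measurable_partition_def)
qed

section \<open>Approximation of measurable sets by finite windows\<close>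

definition window_determined :: "point set \<Rightarrow> nat \<Rightarrow> point set \<Rightarrow> bool" where
  "window_determined X m D \<longleftrightarrow> (\<forall>x\<in>X. \<forall>y\<in>X. (\<forall>i. \<bar>i\<bar> \<le> int m \<longrightarrow> x i = y i) \<longrightarrow> x \<in> D \<longrightarrow> y \<in> D)"

lemma window_determined_mono: "window_determined X m D \<Longrightarrow> m \<le> m' \<Longrightarrow> window_determined X m' D"
  unfolding window_determined_def by (meson of_nat_mono order_trans)

text \<open>The sets that can be approximated in measure form a sigma-algebra containing the
  one-coordinate cylinders, whence the induction over generated sets.\<close>

lemma approximation_by_window_determined:
  assumes M: "prob_space M" "sets M = sets (restrict_space borel X)"
    and B: "B \<in> sets (borel :: point measure)" and "\<delta> > 0"
  shows "\<exists>m. \<exists>D\<in>sets M. window_determined X m D \<and> measure M (B \<inter> X - D \<union> (D - B \<inter> X)) < \<delta>"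
proof -
  interpret prob_space M by fact
  have spM: "space M = X" using sets_eq_imp_space_eq[OF M(2)] by (simp add: space_restrict_space)
  have inM: "B \<inter> X \<in> sets M" if "B \<in> sets borel" for B
    unfolding M(2) sets_restrict_space using that by (auto simp: Int_commute)
  let ?gen = "{{f \<in> \<Pi>\<^sub>E i\<in>UNIV. space (borel::nat measure). f i \<in> A} | i A. i \<in> (UNIV::int set) \<and> A \<in> sets borel}"
  have sb: "sets (borel :: point measure) = sigma_sets UNIV ?gen"
    unfolding sets_borel_point sets_PiM_single by simp
  have "B \<in> sigma_sets UNIV ?gen" using B sb by simp
  then show ?thesis using \<open>\<delta> > 0\<close>
  proof (induction arbitrary: \<delta>)
    case (Basic a)
    then obtain i :: int and A where a: "a = {f. f i \<in> A}" by auto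
    have "a \<in> sets borel" using Basic sb by (auto intro: sigma_sets.Basic)
    moreover have "window_determined X (nat \<bar>i\<bar>) (a \<inter> X)" by (auto simp: window_determined_def a)
    ultimately show ?case using Basic inM by (intro exI[of _ "nat \<bar>i\<bar>"] bexI[of _ "a \<inter> X"]) auto
  next
    case Empty
    then show ?case by (intro exI[of _ 0] bexI[of _ "{}"]) (auto simp: window_determined_def)
  next
    case (Compl a)
    then obtain m D where D: "D \<in> sets M" "window_determined X m D" "measure M (a \<inter> X - D \<union> (D - a \<inter> X)) < \<delta>" by blast
    have "D \<subseteq> X" using D(1) sets.sets_into_space spM by blast
    then have "(UNIV - a) \<inter> X - (X - D) \<union> (X - D - (UNIV - a) \<inter> X) = a \<inter> X - D \<union> (D - a \<inter> X)" by blast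
    moreover have "window_determined X m (X - D)"
      using D(2) unfolding window_determined_def by (metis DiffD1 DiffD2 DiffI)
    moreover have "X - D \<in> sets M" using D(1) spM by (metis sets.compl_sets)
    ultimately show ?case using D(3) by (intro exI[of _ m] bexI[of _ "X - D"]) auto
  next
    case (Union a)
    let ?U = "\<lambda>k. \<Union>i<k. a i \<inter> X"
    have a: "a i \<in> sets borel" for i using Union(1) sb by auto
    have U: "?U k \<in> sets M" for k using inM[OF a] by (intro sets.finite_UN) auto
    have Uall: "(\<Union>k. ?U k) = (\<Union>i. a i) \<inter> X" by auto
    have "(\<lambda>k. measure M (?U k)) \<longlonglongrightarrow> measure M (\<Union>k. ?U k)"
    proof (rule finite_Lim_measure_incseq)
      show "range ?U \<subseteq> sets M" using U by blast
      show "incseq ?U" by (rule incseq_SucI) (auto simp: lessThan_Suc)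
    qed
    then have "eventually (\<lambda>k. measure M ((\<Union>i. a i) \<inter> X) - \<delta> / 2 < measure M (?U k)) sequentially"
      unfolding Uall using \<open>\<delta> > 0\<close> by (intro order_tendstoD(1)) auto
    \<comment> \<open>Half of \<delta> goes to the tail beyond the first \<open>k\<close> sets, the
      other half is shared among these; \<open>Suc k\<close> avoids a division by zero.\<close>
    then obtain k where k: "measure M ((\<Union>i. a i) \<inter> X) - \<delta> / 2 < measure M (?U k)"
      by (auto simp: eventually_sequentially)
    have "\<exists>m D. D \<in> sets M \<and> window_determined X m D \<and> measure M (a i \<inter> X - D \<union> (D - a i \<inter> X)) < \<delta> / (2 * real (Suc k))" for i
      using Union.IH[of "\<delta> / (2 * real (Suc k))" i] \<open>\<delta> > 0\<close> by (auto simp: Bex_def)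
    then obtain m D where D: "\<And>i. D i \<in> sets M" "\<And>i. window_determined X (m i) (D i)"
      "\<And>i. measure M (a i \<inter> X - D i \<union> (D i - a i \<inter> X)) < \<delta> / (2 * real (Suc k))" by metis
    define mm where "mm = (\<Sum>i<k. m i)"
    have wd: "window_determined X mm (D i)" if "i < k" for i
    proof (rule window_determined_mono[OF D(2)])
      show "m i \<le> mm" unfolding mm_def using that by (intro member_le_sum) auto
    qed
    let ?D = "\<Union>i<k. D i"
    have "window_determined X mm ?D"
      unfolding window_determined_def using wd unfolding window_determined_def by blast
    moreover have "?D \<in> sets M" using D(1) by auto
    moreover have "measure M ((\<Union>i. a i) \<inter> X - ?D \<union> (?D - (\<Union>i. a i) \<inter> X)) < \<delta>"
    proof -
      let ?E = "\<lambda>i. a i \<inter> X - D i \<union> (D i - a i \<inter> X)"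
      have E: "?E i \<in> sets M" for i using inM[OF a] D(1) by auto
      have tail: "((\<Union>i. a i) \<inter> X - ?U k) \<in> sets M" using U inM[OF sets.countable_UN[of a UNIV borel]] a by auto
      have "measure M ((\<Union>i. a i) \<inter> X - ?D \<union> (?D - (\<Union>i. a i) \<inter> X)) \<le> measure M (((\<Union>i. a i) \<inter> X - ?U k) \<union> (\<Union>i<k. ?E i))"
        using E tail by (intro finite_measure_mono) (blast, auto)
      also have "\<dots> \<le> measure M ((\<Union>i. a i) \<inter> X - ?U k) + measure M (\<Union>i<k. ?E i)"
        using E tail by (intro measure_Un_le) auto
      also have "measure M ((\<Union>i. a i) \<inter> X - ?U k) = measure M ((\<Union>i. a i) \<inter> X) - measure M (?U k)"
        using U inM[OF sets.countable_UN[of a UNIV borel]] a by (intro finite_measure_Diff) auto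
      also have "measure M (\<Union>i<k. ?E i) \<le> (\<Sum>i<k. measure M (?E i))"
        using E by (intro finite_measure_subadditive_finite) auto
      also have "\<dots> \<le> (\<Sum>i<k. \<delta> / (2 * real (Suc k)))"
        by (intro sum_mono less_imp_le D(3))
      also have "\<dots> \<le> \<delta> / 2"
        using \<open>\<delta> > 0\<close> by (simp add: field_simps)
      finally show ?thesis using k by simp
    qed
    ultimately show ?case by blast
  qed
qed

section \<open>The Gibbs measure\<close>

lemma full_shift_measurable: "full_shift S \<in> sets (borel :: point measure)"
proof -
  have "{x \<in> space borel. \<forall>i::int. (x::point) i \<in> S} \<in> sets borel"
    by measurable
  then show ?thesis by (simp add: full_shift_def)
qed

lemma window_measurable_restrict: "window a n \<in> restrict_space (borel :: point measure) X \<rightarrow>\<^sub>M count_space UNIV"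
  by (rule measurable_restrict_space1) (rule measurable_window)

context holder_potential
begin

text \<open>\<open>R n\<close> will be the law of words of length \<open>n\<close>; the two marginal
  identities of \<open>L\<close> are its consistency under deleting the first or the last letter.
  The constant is K^4 with K = e^{2\<kappa>}.\<close>

lemma gibbs_measure_borel:
  "\<exists>M :: point measure. prob_space M \<and> sets M = sets borel \<and> distr M borel shift = M \<and>
     (AE x in M. x \<in> full_shift S) \<and>
     (\<forall>w. set w \<subseteq> S \<longrightarrow> measure M {x. window 0 (length w) x = w} \<le> exp (8 * \<kappa>) * (weight w / Z (length w)))"
proof -
  obtain L where L0: "L [] = 1" and L: "\<And>w. set w \<subseteq> S \<Longrightarrow> 0 \<le> L w" "\<And>w. set w \<subseteq> S \<Longrightarrow> (\<Sum>a\<in>S. L (a # w)) = L w"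
    "\<And>w. set w \<subseteq> S \<Longrightarrow> (\<Sum>a\<in>S. L (w @ [a])) = L w"
    "\<And>w. set w \<subseteq> S \<Longrightarrow> L w \<le> exp (2 * \<kappa>) ^ 4 * (weight w / Z (length w))"
    using stationary_weights by blast
  define l where "l n w = (if w \<in> lists_of S n then L w else 0)" for n w
  define R where "R n = embed_pmf (l n)" for n
  have l_nonneg: "l n w \<ge> 0" for n w using L(1) by (auto simp: l_def lists_of_def)
  have sum1: "(\<Sum>w\<in>lists_of S n. L w) = 1" for n
  proof (induction n)
    case (Suc n)
    have "(\<Sum>w\<in>lists_of S (Suc n). L w) = (\<Sum>w\<in>lists_of S n. \<Sum>a\<in>S. L (w @ [a]))"
      by (rule sum_lists_of_Suc_right)
    also have "\<dots> = (\<Sum>w\<in>lists_of S n. L w)" by (intro sum.cong L(3)) (auto dest: lists_ofD)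
    finally show ?case using Suc by simp
  qed (simp add: L0)
  have pmfR: "pmf (R n) w = l n w" for n w
    unfolding R_def
  proof (rule pmf_embed_pmf)
    have "(\<integral>\<^sup>+ x. ennreal (l n x) \<partial>count_space UNIV) = (\<integral>\<^sup>+ x. ennreal (L x) * indicator (lists_of S n) x \<partial>count_space UNIV)"
      by (intro nn_integral_cong) (auto simp: l_def indicator_def)
    also have "\<dots> = (\<integral>\<^sup>+ x. ennreal (L x) \<partial>count_space (lists_of S n))"
      by (simp add: nn_integral_count_space_indicator)
    also have "\<dots> = (\<Sum>x\<in>lists_of S n. ennreal (L x))"
      by (rule nn_integral_count_space_finite) (simp add: finite_symbols)
    also have "\<dots> = 1" using sum1[of n] L(1) by (subst sum_ennreal) (auto dest: lists_ofD)
    finally show "(\<integral>\<^sup>+ x. ennreal (l n x) \<partial>count_space UNIV) = 1" .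
  qed (rule l_nonneg)
  have setR: "w \<in> lists_of S n" if "w \<in> set_pmf (R n)" for w n
    using that by (auto simp: set_pmf_iff pmfR l_def split: if_splits)
  \<comment> \<open>Both consistency conditions are instances of this: the mass of a word is the sum
    over its preimages under the map that deletes a letter.\<close>
  have lift: "map_pmf f (R (Suc n)) = R n"
    if f: "\<And>w. w \<in> lists_of S n \<Longrightarrow> (\<Sum>v\<in>{v\<in>lists_of S (Suc n). f v = w}. L v) = L w"
      and f': "\<And>v. v \<in> lists_of S (Suc n) \<Longrightarrow> f v \<in> lists_of S n" for f n
  proof (rule pmf_eqI)
    fix w
    have "pmf (map_pmf f (R (Suc n))) w = measure (measure_pmf (R (Suc n))) (f -` {w})"
      by (simp add: pmf_map)
    also have "\<dots> = measure (measure_pmf (R (Suc n))) {v\<in>lists_of S (Suc n). f v = w}"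
      by (rule measure_pmf.finite_measure_eq_AE) (auto simp: AE_measure_pmf_iff dest: setR)
    also have "\<dots> = (\<Sum>v\<in>{v\<in>lists_of S (Suc n). f v = w}. L v)"
      by (subst measure_measure_pmf_finite) (auto simp: pmfR l_def finite_symbols)
    also have "\<dots> = pmf (R n) w"
    proof (cases "w \<in> lists_of S n")
      case True
      then show ?thesis using f by (simp add: pmfR l_def)
    next
      case False
      then have "{v\<in>lists_of S (Suc n). f v = w} = {}" using f' by auto
      then show ?thesis using False by (simp add: pmfR l_def del: Collect_empty_eq)
    qed
    finally show "pmf (map_pmf f (R (Suc n))) w = pmf (R n) w" .
  qed
  have tl: "map_pmf tl (R (Suc n)) = R n" for n
  proof (rule lift)
    fix w assume w: "w \<in> lists_of S n"
    have "{v\<in>lists_of S (Suc n). tl v = w} = (\<lambda>a. a # w) ` S"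
    proof (intro equalityI subsetI)
      fix v assume v: "v \<in> {v\<in>lists_of S (Suc n). tl v = w}"
      then show "v \<in> (\<lambda>a. a # w) ` S" by (cases v) (auto simp: lists_of_def)
    qed (use w in \<open>auto simp: lists_of_def\<close>)
    then have "(\<Sum>v\<in>{v\<in>lists_of S (Suc n). tl v = w}. L v) = (\<Sum>a\<in>S. L (a # w))"
      by (simp add: sum.reindex inj_on_def)
    then show "(\<Sum>v\<in>{v\<in>lists_of S (Suc n). tl v = w}. L v) = L w" using L(2) w by (simp add: lists_of_def)
  next
    fix v assume "v \<in> lists_of S (Suc n)"
    then show "tl v \<in> lists_of S n" by (cases v) (auto simp: lists_of_def)
  qed
  have butlast: "map_pmf butlast (R (Suc n)) = R n" for n
  proof (rule lift)
    fix w assume w: "w \<in> lists_of S n"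
    have "{v\<in>lists_of S (Suc n). butlast v = w} = (\<lambda>a. w @ [a]) ` S"
    proof (intro equalityI subsetI)
      fix v assume v: "v \<in> {v\<in>lists_of S (Suc n). butlast v = w}"
      then have "v \<noteq> []" by (auto simp: lists_of_def)
      then have "v = w @ [last v]" "last v \<in> S" using v by (auto simp: lists_of_def)
      then show "v \<in> (\<lambda>a. w @ [a]) ` S" by blast
    qed (use w in \<open>auto simp: lists_of_def\<close>)
    then have "(\<Sum>v\<in>{v\<in>lists_of S (Suc n). butlast v = w}. L v) = (\<Sum>a\<in>S. L (w @ [a]))"
      by (simp add: sum.reindex inj_on_def)
    then show "(\<Sum>v\<in>{v\<in>lists_of S (Suc n). butlast v = w}. L v) = L w" using L(3) w by (simp add: lists_of_def)
  qed (auto simp: lists_of_def dest: in_set_butlastD)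
  obtain M :: "point measure" where M: "prob_space M" "sets M = sets borel" "distr M borel shift = M"
    and win: "\<And>a n. distr M (count_space UNIV) (window a n) = measure_pmf (R n)"
    using stationary_extension[of R] setR tl butlast lists_ofD(2) by metis
  interpret prob_space M by fact
  have wm: "window a n \<in> M \<rightarrow>\<^sub>M count_space UNIV" for a n
    unfolding measurable_cong_sets[OF M(2) refl] by (rule measurable_window)
  have sp: "space M = UNIV" using sets_eq_imp_space_eq[OF M(2)] by simp
  have law: "measure M (window a n -` W) = measure (measure_pmf (R n)) W" for a n W
    using measure_distr[OF wm[of a n], of W] by (simp add: win sp)
  have AE1: "AE x in M. x i \<in> S" for i
  proof -
    have "AE w in measure_pmf (R 1). set w \<subseteq> S"
      unfolding AE_measure_pmf_iff using setR[of _ 1] lists_ofD(1) by blast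
    then have "AE x in M. set (window i 1 x) \<subseteq> S"
      unfolding win[of i 1, symmetric] by (subst (asm) AE_distr_iff[OF wm]) auto
    then show ?thesis by eventually_elim (simp add: window_def)
  qed
  have "AE x in M. \<forall>i. x i \<in> S" using AE1 by (simp add: AE_all_countable)
  then have supp: "AE x in M. x \<in> full_shift S" by eventually_elim (simp add: full_shift_def)
  have bound: "measure M {x. window 0 (length w) x = w} \<le> exp (8 * \<kappa>) * (weight w / Z (length w))" if w: "set w \<subseteq> S" for w
  proof -
    have "measure M {x. window 0 (length w) x = w} = L w"
      using law[of 0 "length w" "{w}"] w by (simp add: vimage_def measure_pmf_single pmfR l_def lists_of_def)
    also have "\<dots> \<le> exp (8 * \<kappa>) * (weight w / Z (length w))"
      using L(4)[OF w] by (simp add: exp_of_nat_mult[symmetric])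
    finally show ?thesis .
  qed
  show ?thesis using M supp bound by blast
qed

text \<open>The measure above lives on all sequences, while an invariant probability on
  \<open>X\<close> needs the sigma-algebra of \<open>X\<close>. It is pushed forward by a map into
  \<open>X\<close> that is the identity almost everywhere.\<close>

lemma gibbs_measure:
  assumes X: "full_shift S \<subseteq> X" and shX: "\<And>x. x \<in> X \<Longrightarrow> shift x \<in> X"
  shows "\<exists>M. invariant_probability X M \<and> (AE x in M. x \<in> full_shift S) \<and> full_shift S \<in> sets M \<and>
     (\<forall>w. set w \<subseteq> S \<longrightarrow> measure M {x\<in>X. window 0 (length w) x = w} \<le> exp (8 * \<kappa>) * (weight w / Z (length w)))"
proof -
  obtain M :: "point measure" where M: "prob_space M" "sets M = sets borel" "distr M borel shift = M"
    and supp: "AE x in M. x \<in> full_shift S"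
    and bound: "\<And>w. set w \<subseteq> S \<Longrightarrow> measure M {x. window 0 (length w) x = w} \<le> exp (8 * \<kappa>) * (weight w / Z (length w))"
    using gibbs_measure_borel by blast
  interpret prob_space M by fact
  have sp: "space M = UNIV" using sets_eq_imp_space_eq[OF M(2)] by simp
  obtain s where s: "s \<in> S" using symbols_nonempty by blast
  \<comment> \<open>Outside the full shift every point goes to one constant sequence, which
    \<open>shift\<close> fixes. As a point lies in the full shift exactly when its shift does,
    \<iota> commutes with \<open>shift\<close> everywhere.\<close>
  define \<iota> where "\<iota> x = (if x \<in> full_shift S then x else (\<lambda>_::int. s))" for x :: point
  have \<iota>_in: "\<iota> x \<in> full_shift S" for x using s by (auto simp: \<iota>_def full_shift_def)
  let ?X = "restrict_space borel X"
  have \<iota>b: "\<iota> \<in> borel \<rightarrow>\<^sub>M borel"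
    unfolding \<iota>_def using full_shift_measurable[of S] by (intro measurable_If_set) auto
  have \<iota>0: "\<iota> \<in> borel \<rightarrow>\<^sub>M ?X"
    by (rule measurable_restrict_space2) (use \<iota>_in X \<iota>b in auto)
  have \<iota>: "\<iota> \<in> M \<rightarrow>\<^sub>M ?X" unfolding measurable_cong_sets[OF M(2) refl] by (rule \<iota>0)
  define N where "N = distr M ?X \<iota>"
  have N: "prob_space N" unfolding N_def by (rule prob_space_distr) (rule \<iota>)
  have setsN: "sets N = sets ?X" by (simp add: N_def)
  have \<iota>_shift: "shift (\<iota> x) = \<iota> (shift x)" for x
  proof -
    have "x \<in> full_shift S" if "shift x \<in> full_shift S"
      unfolding full_shift_def
    proof (safe)
      fix i
      have "shift x (i - 1) \<in> S" using that by (simp add: full_shift_def)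
      then show "x i \<in> S" by (simp add: shift_def)
    qed
    then show ?thesis using shift_full_shift[of x S] by (auto simp: \<iota>_def) (simp add: shift_def)
  qed
  have shX': "shift \<in> ?X \<rightarrow>\<^sub>M ?X"
    by (rule measurable_restrict_space3) (use shX measurable_shift in auto)
  then have sh: "shift \<in> N \<rightarrow>\<^sub>M N" unfolding measurable_cong_sets[OF setsN setsN] .
  have inv: "distr N N shift = N"
  proof -
    have "distr N N shift = distr N ?X shift" by (rule distr_cong) (simp_all add: setsN)
    also have "\<dots> = distr M ?X (shift \<circ> \<iota>)" unfolding N_def by (rule distr_distr[OF shX' \<iota>])
    also have "shift \<circ> \<iota> = \<iota> \<circ> shift" using \<iota>_shift by (simp add: fun_eq_iff)
    also have "distr M ?X (\<iota> \<circ> shift) = distr (distr M borel shift) ?X \<iota>"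
      by (rule distr_distr[symmetric, OF \<iota>0]) (unfold measurable_cong_sets[OF M(2) refl], rule measurable_shift)
    also have "\<dots> = N" by (simp add: M(3) N_def)
    finally show ?thesis .
  qed
  have fsX: "full_shift S \<in> sets ?X" unfolding sets_restrict_space
    using full_shift_measurable[of S] X by (intro image_eqI[of _ _ "full_shift S"]) auto
  have suppN: "AE x in N. x \<in> full_shift S"
    unfolding N_def
  proof (subst AE_distr_iff[OF \<iota>])
    have "{x \<in> space ?X. x \<in> full_shift S} = full_shift S" using X by (auto simp: space_restrict_space)
    then show "{x \<in> space ?X. x \<in> full_shift S} \<in> sets ?X" using fsX by simp
  qed (simp add: \<iota>_in)
  have "measure N {x\<in>X. window 0 (length w) x = w} \<le> exp (8 * \<kappa>) * (weight w / Z (length w))" if w: "set w \<subseteq> S" for w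
  proof -
    have c: "{x\<in>X. window 0 (length w) x = w} \<in> sets ?X"
    proof -
      have "window 0 (length w) -` {w} \<inter> space ?X \<in> sets ?X"
        by (rule measurable_sets[OF window_measurable_restrict]) simp
      moreover have "window 0 (length w) -` {w} \<inter> space ?X = {x\<in>X. window 0 (length w) x = w}"
        by (auto simp: space_restrict_space)
      ultimately show ?thesis by simp
    qed
    have "measure N {x\<in>X. window 0 (length w) x = w} = measure M (\<iota> -` {x\<in>X. window 0 (length w) x = w} \<inter> space M)"
      unfolding N_def by (rule measure_distr[OF \<iota> c])
    also have "\<dots> = measure M {x. window 0 (length w) x = w}"
    proof (rule finite_measure_eq_AE)
      show "AE x in M. (x \<in> \<iota> -` {x\<in>X. window 0 (length w) x = w} \<inter> space M) = (x \<in> {x. window 0 (length w) x = w})"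
        using supp by eventually_elim (use X in \<open>auto simp: \<iota>_def sp\<close>)
      show "\<iota> -` {x\<in>X. window 0 (length w) x = w} \<inter> space M \<in> sets M" by (rule measurable_sets[OF \<iota> c])
      have "window 0 (length w) -` {w} \<inter> space (borel :: point measure) \<in> sets borel"
        by (rule measurable_sets[OF measurable_window]) simp
      then show "{x. window 0 (length w) x = w} \<in> sets M" by (simp add: M(2) vimage_def)
    qed
    also have "\<dots> \<le> exp (8 * \<kappa>) * (weight w / Z (length w))" by (rule bound[OF w])
    finally show ?thesis .
  qed
  then show ?thesis using N setsN sh inv suppN fsX unfolding invariant_probability_def by (intro exI[of _ N]) simp
qed

text \<open>The integrand is arbitrary because this is applied to the potential and also to the
  coding cost in the upper bound for the entropy.\<close>

lemma birkhoff_sum_integral: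
  assumes inv: "invariant_probability X M" and int: "integrable M \<psi>"
  shows "integrable M (birkhoff_sum \<psi> n)" "(\<integral>x. birkhoff_sum \<psi> n x \<partial>M) = real n * (\<integral>x. \<psi> x \<partial>M)"
proof -
  have sh: "shift \<in> M \<rightarrow>\<^sub>M M" and d: "distr M M shift = M" using inv by (auto simp: invariant_probability_def)
  have k: "(shift ^^ k) \<in> M \<rightarrow>\<^sub>M M \<and> distr M M (shift ^^ k) = M" for k
  proof (induction k)
    case (Suc k)
    have "distr M M (shift ^^ Suc k) = distr (distr M M (shift ^^ k)) M shift"
      using Suc sh by (subst distr_distr) auto
    then have "distr M M (shift ^^ Suc k) = M" using Suc d by simp
    moreover have "(shift ^^ Suc k) \<in> M \<rightarrow>\<^sub>M M" using Suc sh by (auto intro: measurable_comp)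
    ultimately show ?case by blast
  qed (auto simp: distr_id[unfolded id_def] id_def)
  have i: "integrable M (\<lambda>x. \<psi> ((shift ^^ k) x))" for k
    using int k[of k] integrable_distr[of "shift ^^ k" M M \<psi>] by simp
  have e: "(\<integral>x. \<psi> ((shift ^^ k) x) \<partial>M) = (\<integral>x. \<psi> x \<partial>M)" for k
    using int k[of k] integral_distr[of "shift ^^ k" M M \<psi>] by simp
  show "integrable M (birkhoff_sum \<psi> n)" unfolding birkhoff_sum_def[abs_def] using i by auto
  show "(\<integral>x. birkhoff_sum \<psi> n x \<partial>M) = real n * (\<integral>x. \<psi> x \<partial>M)"
    unfolding birkhoff_sum_def using i e by (simp add: Bochner_Integration.integral_sum)
qed

lemma ln_Z_over_n: "(\<lambda>n. ln (Z n) / real n) \<longlonglongrightarrow> pressure (full_shift S) \<phi>"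
proof -
  let ?P = "pressure (full_shift S) \<phi>"
  have "(\<lambda>n. ln (Z n) / real n - ?P) \<longlonglongrightarrow> 0"
  proof (rule Lim_null_comparison)
    show "eventually (\<lambda>n. norm (ln (Z n) / real n - ?P) \<le> 2 * \<kappa> / real n) sequentially"
      using eventually_gt_at_top[of 0]
    proof eventually_elim
      case (elim n)
      then have "ln (Z n) / real n - ?P = (ln (Z n) - real n * ?P) / real n" by (simp add: field_simps)
      then show ?case using ln_Z_pressure[of n] elim by (simp add: divide_right_mono)
    qed
    show "(\<lambda>n. 2 * \<kappa> / real n) \<longlonglongrightarrow> 0"
      by (rule tendsto_divide_0[OF tendsto_const filterlim_real_at_infinity_sequentially])
  qed
  then show ?thesis using LIM_zero_iff by blast
qed

lemma limsup_ln_Z: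
  "limsup (\<lambda>n. ereal ((ln (Z n) + c - real n * b) / real n)) = ereal (pressure (full_shift S) \<phi> - b)"
proof -
  have "(\<lambda>n. ln (Z n) / real n + c / real n - b) \<longlonglongrightarrow> pressure (full_shift S) \<phi> + 0 - b"
    by (intro tendsto_intros ln_Z_over_n tendsto_divide_0[OF tendsto_const filterlim_real_at_infinity_sequentially])
  moreover have "eventually (\<lambda>n. ln (Z n) / real n + c / real n - b = (ln (Z n) + c - real n * b) / real n) sequentially"
    using eventually_gt_at_top[of 0] by eventually_elim (simp add: add_divide_distrib diff_divide_distrib)
  ultimately have "(\<lambda>n. (ln (Z n) + c - real n * b) / real n) \<longlonglongrightarrow> pressure (full_shift S) \<phi> - b"
    using Lim_transform_eventually by fastforce
  then show ?thesis by (intro lim_imp_Limsup) auto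
qed

lemma limsup_entropy_le:
  assumes "\<And>n. h n \<le> ln (Z n) + c - real n * b"
  shows "limsup (\<lambda>n. ereal (h n / real n)) \<le> ereal (pressure (full_shift S) \<phi> - b)"
  unfolding limsup_ln_Z[of c b, symmetric]
  by (intro Limsup_mono always_eventually allI) (use assms in \<open>simp add: divide_right_mono\<close>)

lemma limsup_entropy_ge:
  assumes "\<And>n. ln (Z n) + c - real n * b \<le> h n"
  shows "ereal (pressure (full_shift S) \<phi> - b) \<le> limsup (\<lambda>n. ereal (h n / real n))"
  unfolding limsup_ln_Z[of c b, symmetric]
  by (intro Limsup_mono always_eventually allI) (use assms in \<open>simp add: divide_right_mono\<close>)

end

section \<open>The Gibbs measure is an equilibrium state\<close>

lemma window_add: "window a (m + n) x = window a m x @ window (a + int m) n x"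
  by (rule nth_equalityI) (auto simp: nth_append)

lemma window_in_lists_of: "x \<in> full_shift S \<Longrightarrow> window a n x \<in> lists_of S n"
  by (auto simp: lists_of_def window_def full_shift_def)

definition shift_entropy :: "point measure \<Rightarrow> point set set \<Rightarrow> nat \<Rightarrow> real" where
  "shift_entropy M \<xi> n = partition_entropy M (refined_partition M shift \<xi> n)"

context holder_potential
begin

lemma integrable_potential:
  assumes inv: "invariant_probability X M" and supp: "AE x in M. x \<in> full_shift S"
    and meas: "\<phi> \<in> borel_measurable (restrict_space borel X)"
  shows "integrable M \<phi>"
proof -
  interpret prob_space M using inv by (simp add: invariant_probability_def)
  have setsM: "sets M = sets (restrict_space borel X)" using inv by (simp add: invariant_probability_def)
  have m: "\<phi> \<in> borel_measurable M" unfolding measurable_cong_sets[OF setsM refl] by (rule meas)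
  obtain B where B: "\<And>x. x \<in> full_shift S \<Longrightarrow> \<bar>\<phi> x\<bar> \<le> B" using bounded_potential by blast
  have "AE x in M. norm (\<phi> x) \<le> B" using supp by eventually_elim (use B in auto)
  then show ?thesis using m by (rule integrable_const_bound)
qed

lemma space_invariant: "invariant_probability X M \<Longrightarrow> space M = X"
  using sets_eq_imp_space_eq[of M "restrict_space borel X"]
  by (simp add: invariant_probability_def space_restrict_space)

text \<open>The witness is the coordinate partition, whose refinements consist of cylinders. In the
  constant, \<open>8 * \<kappa>\<close> comes from the Gibbs bound and one more \<kappa> from
  replacing \<open>ext w\<close> by \<open>x\<close>.\<close>

lemma entropy_lower_bound:
  assumes inv: "invariant_probability X M" and supp: "AE x in M. x \<in> full_shift S"
    and int: "integrable M \<phi>" and T: "finite T" "X \<subseteq> full_shift T"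
    and gibbs: "\<And>w. set w \<subseteq> S \<Longrightarrow> measure M {x\<in>X. window 0 (length w) x = w} \<le> exp (8 * \<kappa>) * (weight w / Z (length w))"
  shows "\<exists>\<xi>. measurable_partition M \<xi> \<and>
    (\<forall>n. ln (Z n) - 9 * \<kappa> - real n * (\<integral>x. \<phi> x \<partial>M) \<le> shift_entropy M \<xi> n)"
proof -
  interpret prob_space M using inv by (simp add: invariant_probability_def)
  have spM: "space M = X" using inv by (rule space_invariant)
  have setsM: "sets M = sets (restrict_space borel X)" and sh: "shift \<in> M \<rightarrow>\<^sub>M M"
    using inv by (auto simp: invariant_probability_def)
  define \<xi> where "\<xi> = (\<lambda>a. {x\<in>X. x 0 = a}) ` T - {{}}"
  have win: "window a n \<in> M \<rightarrow>\<^sub>M count_space UNIV" for a n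
    unfolding measurable_cong_sets[OF setsM refl] by (rule window_measurable_restrict)
  have cyl: "{x\<in>X. window a n x = w} \<in> sets M" for a n w
    using measurable_sets[OF win, of "{w}" a n] by (simp add: spM vimage_def Int_def conj_commute)
  have c0: "{x\<in>X. x 0 = a} \<in> sets M" for a
    using cyl[of 0 1 "[a]"] by (simp add: window_def)
  have \<xi>: "measurable_partition M \<xi>"
    unfolding measurable_partition_def spM
  proof (intro conjI partition_onI)
    show "\<Union> \<xi> = X" using T by (auto simp: \<xi>_def full_shift_def)
  qed (use T c0 in \<open>auto simp: \<xi>_def disjnt_def\<close>)
  have "ln (Z n) - 9 * \<kappa> - real n * (\<integral>x. \<phi> x \<partial>M) \<le> shift_entropy M \<xi> n" for n
  proof -
    have "(\<integral>x. ln (Z n) - 9 * \<kappa> - birkhoff_sum \<phi> n x \<partial>M) \<le> shift_entropy M \<xi> n"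
      unfolding shift_entropy_def
    proof (rule partition_entropy_ge[OF measurable_partition_refined[OF \<xi> sh]])
      show "integrable M (\<lambda>x. ln (Z n) - 9 * \<kappa> - birkhoff_sum \<phi> n x)"
        using birkhoff_sum_integral(1)[OF inv int] by auto
      fix A assume A: "A \<in> refined_partition M shift \<xi> n" and pos: "measure M A > 0"
      obtain F where F: "A = {x\<in>X. \<forall>i<n. (shift ^^ i) x \<in> F i}" "\<forall>i<n. F i \<in> \<xi>"
        using A by (auto simp: refined_partition_def spM)
      have "ln (Z n) - 9 * \<kappa> - birkhoff_sum \<phi> n x \<le> - ln (measure M A)" if x: "x \<in> full_shift S" "x \<in> A" for x
      proof -
        define w where "w = window 0 n x"
        have w: "set w \<subseteq> S" "length w = n" using window_in_lists_of[OF x(1)] by (auto simp: w_def lists_of_def)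
        have "A \<subseteq> {y\<in>X. window 0 n y = w}"
        proof
          fix y assume y: "y \<in> A"
          have "y (int i) = x (int i)" if "i < n" for i
          proof -
            obtain a where "F i = {z\<in>X. z 0 = a}" using F(2) \<open>i < n\<close> by (auto simp: \<xi>_def)
            moreover have "(shift ^^ i) y \<in> F i" "(shift ^^ i) x \<in> F i" using F(1) x(2) y \<open>i < n\<close> by auto
            ultimately show ?thesis by (simp add: funpow_shift)
          qed
          then show "y \<in> {y\<in>X. window 0 n y = w}" using F(1) y by (auto simp: w_def window_def)
        qed
        then have "measure M A \<le> measure M {y\<in>X. window 0 n y = w}"
          by (intro finite_measure_mono cyl)
        also have "\<dots> \<le> exp (8 * \<kappa>) * (weight w / Z n)" using gibbs[OF w(1)] w(2) by simp
        finally have "ln (measure M A) \<le> ln (exp (8 * \<kappa>) * (weight w / Z n))"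
          using pos F_pos[OF w(1)] Z_pos[of n] by (subst ln_le_cancel_iff) auto
        also have "\<dots> = 8 * \<kappa> + ln (weight w) - ln (Z n)"
          using F_pos[OF w(1)] Z_pos[of n] by (simp add: ln_mult ln_div)
        also have "ln (weight w) \<le> birkhoff_sum \<phi> n x + \<kappa>"
        proof -
          have "\<bar>birkhoff_sum \<phi> n (ext w) - birkhoff_sum \<phi> n x\<bar> \<le> \<kappa>"
            by (rule birkhoff_sum_distortion) (use w x ext_in in \<open>auto simp: ext_nth w_def\<close>)
          then show ?thesis using w(2) by (simp add: ln_weight)
        qed
        finally show ?thesis by simp
      qed
      then show "AE x in M. x \<in> A \<longrightarrow> ln (Z n) - 9 * \<kappa> - birkhoff_sum \<phi> n x \<le> - ln (measure M A)"
        using supp by (auto elim!: eventually_mono)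
    qed
    moreover have "(\<integral>x. ln (Z n) - 9 * \<kappa> - birkhoff_sum \<phi> n x \<partial>M) = ln (Z n) - 9 * \<kappa> - real n * (\<integral>x. \<phi> x \<partial>M)"
      using birkhoff_sum_integral[OF inv int, of n] by (simp add: prob_space)
    ultimately show ?thesis by simp
  qed
  with \<xi> show ?thesis by blast
qed

text \<open>
  By Gibbs' inequality, any sub-probability weights \<open>q\<close> on the refined partition bound its entropy. They
  are taken from a noisy channel: choose a word with probability proportional to its weight, and at
  each time emit the element of \<open>\<xi>\<close> that the window around this time most likely determines, or with
  probability \<open>\<epsilon>\<close> a uniformly chosen one. This takes the place of conditional entropies.
\<close>

lemma entropy_upper_bound:
  assumes inv: "invariant_probability X M" and supp: "AE x in M. x \<in> full_shift S"
    and int: "integrable M \<phi>" and X: "full_shift S \<subseteq> X"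
    and \<xi>: "measurable_partition M \<xi>" and \<eta>: "\<eta> > 0"
  shows "\<exists>c. \<forall>n. shift_entropy M \<xi> n \<le> ln (Z n) + c - real n * ((\<integral>x. \<phi> x \<partial>M) - \<eta>)"
proof -
  interpret prob_space M using inv by (simp add: invariant_probability_def)
  have spM: "space M = X" using inv by (rule space_invariant)
  have setsM: "sets M = sets (restrict_space borel X)" and sh: "shift \<in> M \<rightarrow>\<^sub>M M"
    using inv by (auto simp: invariant_probability_def)
  have fin: "finite \<xi>" and sub: "\<xi> \<subseteq> sets M" and part: "partition_on X \<xi>"
    using \<xi> by (auto simp: measurable_partition_def spM)
  have ne: "\<xi> \<noteq> {}" using partition_onD1[OF part] not_empty spM by auto
  define k where "k = card \<xi>"
  have k: "k \<ge> 1" using fin ne by (simp add: k_def Suc_le_eq card_gt_0_iff)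
  \<comment> \<open>A right guess of the channel costs \<open>c0\<close>, which this \<epsilon>
    keeps below \<open>\<eta> / 2\<close>; being at most 1/2 it also gives
    \<open>\<epsilon> / real k \<le> 1 - \<epsilon>\<close>, so a wrong guess costs at least as
    much.\<close>
  define \<epsilon> where "\<epsilon> = min (1/2) (1 - exp (- \<eta> / 2))"
  have "0 < \<epsilon>" using \<eta> by (simp add: \<epsilon>_def)
  moreover have "\<epsilon> \<le> 1/2" unfolding \<epsilon>_def by (rule min.cobounded1)
  moreover have "exp (- \<eta> / 2) \<le> 1 - \<epsilon>"
    unfolding \<epsilon>_def using min.cobounded2[of "1/2" "1 - exp (- \<eta> / 2)"] by linarith
  ultimately have \<epsilon>: "0 < \<epsilon>" "\<epsilon> \<le> 1/2" "exp (- \<eta> / 2) \<le> 1 - \<epsilon>" by blast+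
  define c0 where "c0 = - ln (1 - \<epsilon>)"
  define c1 where "c1 = - ln (\<epsilon> / real k)"
  have c0: "c0 \<le> \<eta> / 2"
  proof -
    have "ln (exp (- \<eta> / 2)) \<le> ln (1 - \<epsilon>)" using \<epsilon> by (subst ln_le_cancel_iff) auto
    then show ?thesis by (simp add: c0_def)
  qed
  have c0': "0 \<le> c0" using \<epsilon> by (simp add: c0_def)
  have ek: "\<epsilon> / real k \<le> 1 - \<epsilon>"
  proof -
    have "\<epsilon> / real k \<le> \<epsilon> / 1" using k \<epsilon> by (intro divide_left_mono) auto
    then show ?thesis using \<epsilon> by simp
  qed
  have ekpos: "\<epsilon> / real k > 0" using \<epsilon> k by simp
  have c01: "c0 \<le> c1" unfolding c0_def c1_def using ek ekpos \<epsilon> by simp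
  \<comment> \<open>With this \<delta>, wrong guesses add at most
    \<open>(c1 + 1) * \<delta> = \<eta> / 2\<close> to the mean cost; the 1 keeps the denominator
    positive.\<close>
  define \<delta> where "\<delta> = \<eta> / (2 * (c1 + 1))"
  have \<delta>: "\<delta> > 0" using \<eta> c0' c01 by (simp add: \<delta>_def)
  have "\<exists>m D. D \<in> sets M \<and> window_determined X m D \<and> measure M (A - D \<union> (D - A)) < \<delta> / real k" if "A \<in> \<xi>" for A
  proof -
    have "A \<in> sets (restrict_space borel X)" using that sub setsM by blast
    then obtain B where B: "B \<in> sets borel" "A = B \<inter> X" unfolding sets_restrict_space by auto
    show ?thesis
      using approximation_by_window_determined[OF prob_space_axioms setsM B(1), of "\<delta> / real k"] \<delta> k B(2) by auto
  qed
  then have "\<forall>A\<in>\<xi>. \<exists>m D. D \<in> sets M \<and> window_determined X m D \<and> measure M (A - D \<union> (D - A)) < \<delta> / real k" by blast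
  then obtain mm where "\<forall>A\<in>\<xi>. \<exists>D. D \<in> sets M \<and> window_determined X (mm A) D \<and> measure M (A - D \<union> (D - A)) < \<delta> / real k"
    by (rule bchoice[THEN exE])
  then obtain D where D: "\<And>A. A \<in> \<xi> \<Longrightarrow> D A \<in> sets M" "\<And>A. A \<in> \<xi> \<Longrightarrow> window_determined X (mm A) (D A)"
      "\<And>A. A \<in> \<xi> \<Longrightarrow> measure M (A - D A \<union> (D A - A)) < \<delta> / real k"
    by (rule bchoice[THEN exE]) blast
  define m where "m = (\<Sum>A\<in>\<xi>. mm A)"
  have wd: "window_determined X m (D A)" if "A \<in> \<xi>" for A
    using D(2)[OF that] by (rule window_determined_mono) (use fin that in \<open>simp add: m_def member_le_sum\<close>)
  define N where "N = (\<Union>A\<in>\<xi>. A - D A \<union> (D A - A))"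
  have NS: "N \<in> sets M" unfolding N_def using D(1) sub fin by (intro sets.finite_UN) auto
  have N\<delta>: "measure M N \<le> \<delta>"
  proof -
    have "measure M N \<le> (\<Sum>A\<in>\<xi>. measure M (A - D A \<union> (D A - A)))"
      unfolding N_def using D(1) sub fin by (intro finite_measure_subadditive_finite) auto
    also have "\<dots> \<le> (\<Sum>A\<in>\<xi>. \<delta> / real k)" by (intro sum_mono less_imp_le D(3))
    also have "\<dots> = \<delta>" using k by (simp add: k_def)
    finally show ?thesis .
  qed
  \<comment> \<open>The decoder: a guess for the element of \<xi> that contains \<open>x\<close>,
    made from the coordinates within distance \<open>m\<close>. It can err only on \<open>N\<close>;
    where no \<open>D A\<close> contains \<open>x\<close>, any fixed element will do.\<close>
  define \<psi> where "\<psi> x = (if \<exists>A\<in>\<xi>. x \<in> D A then SOME A. A \<in> \<xi> \<and> x \<in> D A else SOME A. A \<in> \<xi>)" for x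
  have \<psi>_in: "\<psi> x \<in> \<xi>" for x
  proof (cases "\<exists>A\<in>\<xi>. x \<in> D A")
    case True
    then have "(SOME A. A \<in> \<xi> \<and> x \<in> D A) \<in> \<xi> \<and> x \<in> D (SOME A. A \<in> \<xi> \<and> x \<in> D A)" by (intro someI_ex[of "\<lambda>A. A \<in> \<xi> \<and> x \<in> D A"]) auto
    then show ?thesis using True by (simp add: \<psi>_def)
  qed (use ne in \<open>simp add: \<psi>_def some_in_eq\<close>)
  have \<psi>_cong: "\<psi> x = \<psi> y" if xy: "x \<in> X" "y \<in> X" "\<And>i. \<bar>i\<bar> \<le> int m \<Longrightarrow> x i = y i" for x y
  proof -
    have "x \<in> D A \<longleftrightarrow> y \<in> D A" if A: "A \<in> \<xi>" for A
    proof -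
      have "\<forall>i. \<bar>i\<bar> \<le> int m \<longrightarrow> x i = y i" "\<forall>i. \<bar>i\<bar> \<le> int m \<longrightarrow> y i = x i" using xy(3) by auto
      then show ?thesis using wd[OF A] xy(1,2) unfolding window_determined_def by blast
    qed
    then have "(\<exists>A\<in>\<xi>. x \<in> D A) = (\<exists>A\<in>\<xi>. y \<in> D A)" "(\<lambda>A. A \<in> \<xi> \<and> x \<in> D A) = (\<lambda>A. A \<in> \<xi> \<and> y \<in> D A)" by auto
    then show ?thesis unfolding \<psi>_def by presburger
  qed
  have \<psi>_eq: "\<psi> x = A" if "x \<in> A" "A \<in> \<xi>" "x \<notin> N" for x A
  proof -
    have iff: "x \<in> D B \<longleftrightarrow> x \<in> B" if "B \<in> \<xi>" for B using \<open>x \<notin> N\<close> that by (auto simp: N_def)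
    have un: "B = A" if "B \<in> \<xi>" "x \<in> B" for B
      using partition_onD2[OF part] that \<open>x \<in> A\<close> \<open>A \<in> \<xi>\<close> unfolding disjoint_def by blast
    have "\<exists>A\<in>\<xi>. x \<in> D A" using iff that by blast
    then have "\<psi> x = (SOME A. A \<in> \<xi> \<and> x \<in> D A)" by (simp add: \<psi>_def)
    also have "\<dots> = A"
    proof (rule some_equality)
      show "A \<in> \<xi> \<and> x \<in> D A" using iff[OF that(2)] that(1,2) by blast
      show "B = A" if "B \<in> \<xi> \<and> x \<in> D B" for B using un[of B] iff[of B] that by blast
    qed
    finally show ?thesis .
  qed
  \<comment> \<open>The probability of emitting \<open>A\<close> when the guess is \<open>B\<close>.
    The total over \<open>A\<close> is at most (1 - \<epsilon>) + k (\<epsilon> / k) = 1.\<close>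
  define \<rho> where "\<rho> A B = (if A = B then 1 - \<epsilon> else \<epsilon> / real k)" for A B :: "point set"
  have \<rho>pos: "\<rho> A B > 0" for A B using \<epsilon> ekpos by (simp add: \<rho>_def)
  have \<rho>sum: "(\<Sum>A\<in>\<xi>. \<rho> A B) \<le> 1" if "B \<in> \<xi>" for B
  proof -
    have "(\<Sum>A\<in>\<xi>. \<rho> A B) \<le> (\<Sum>A\<in>\<xi>. (if A = B then 1 - \<epsilon> else 0) + \<epsilon> / real k)"
      using ekpos by (intro sum_mono) (auto simp: \<rho>_def)
    also have "\<dots> = 1" using fin that k ne by (simp add: sum.distrib k_def)
    finally show ?thesis .
  qed
  define cost where "cost x = c0 + (c1 - c0) * indicator N x" for x :: point
  have cost: "- ln (\<rho> A (\<psi> x)) \<le> cost x" if "x \<in> A" "A \<in> \<xi>" for x A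
    using \<psi>_eq[OF that] c01 by (cases "x \<in> N") (auto simp: cost_def \<rho>_def c0_def c1_def)
  have iN: "integrable M (indicator N :: point \<Rightarrow> real)" using NS by (simp add: integrable_indicator_iff emeasure_eq_measure)
  have icost: "integrable M cost" unfolding cost_def[abs_def] using iN by auto
  have Ecost: "(\<integral>x. cost x \<partial>M) \<le> \<eta>"
  proof -
    have "(\<integral>x. cost x \<partial>M) = c0 + (c1 - c0) * measure M N"
      unfolding cost_def using iN NS by (simp add: prob_space sets.Int_space_eq2)
    also have "\<dots> \<le> \<eta> / 2 + (c1 + 1) * \<delta>"
      using c0 c01 c0' N\<delta> by (intro add_mono mult_mono) auto
    also have "\<dots> = \<eta>" using c0' c01 by (simp add: \<delta>_def field_simps)
    finally show ?thesis .
  qed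
  define Nm where "Nm = real (card (lists_of S m))"
  have Nm: "Nm > 0" by (simp add: Nm_def card_gt_0_iff lists_of_nonempty symbols_nonempty finite_symbols)
  have "shift_entropy M \<xi> n \<le> ln (Z n) + (2 * ln Nm + \<kappa>) - real n * ((\<integral>x. \<phi> x \<partial>M) - \<eta>)" for n
  proof -
    \<comment> \<open>The decoder looks \<open>m\<close> symbols to either side, so a word for the
      times below \<open>n\<close> is padded by \<open>m\<close> symbols at both ends. The padding
      is chosen uniformly, which costs the constant \<open>2 * ln Nm\<close>.\<close>
    define W where "W = lists_of S m \<times> lists_of S n \<times> lists_of S m"
    have finW: "finite W" by (simp add: W_def finite_symbols)
    define p where "p v = weight v / (Z n * Nm * Nm)" for v
    have ppos: "p v > 0" if "set v \<subseteq> S" for v using F_pos[OF that] Z_pos[of n] Nm by (simp add: p_def)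
    have psum: "(\<Sum>(u,v,t)\<in>W. p v) = 1"
    proof -
      have "(\<Sum>(u,v,t)\<in>W. p v) = (\<Sum>u\<in>lists_of S m. \<Sum>v\<in>lists_of S n. \<Sum>t\<in>lists_of S m. p v)"
        unfolding W_def by (simp only: sum.cartesian_product)
      also have "\<dots> = Nm * Nm * (\<Sum>v\<in>lists_of S n. p v)"
        by (simp add: Nm_def sum_distrib_left[symmetric] sum_distrib_right[symmetric] mult_ac)
      also have "(\<Sum>v\<in>lists_of S n. p v) = Z n / (Z n * Nm * Nm)"
        by (simp add: p_def sum_divide_distrib[symmetric] Z_def)
      finally show ?thesis using Z_pos[of n] Nm by simp
    qed
    \<comment> \<open>Shifted by \<open>m\<close>, so that the middle word \<open>v\<close> starts
      at coordinate 0.\<close>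
    define e where "e w = (\<lambda>i. ext w (i + int m))" for w
    have e_in: "e w \<in> full_shift S" if "set w \<subseteq> S" for w
      using ext_in[OF that] by (simp add: e_def full_shift_def)
    define \<Xi> where "\<Xi> = refined_partition M shift \<xi> n"
    have "\<forall>A\<in>\<Xi>. \<exists>F. F \<in> PiE {..<n} (\<lambda>_. \<xi>) \<and> A = {x\<in>X. \<forall>i<n. (shift ^^ i) x \<in> F i}"
    proof
      fix A assume "A \<in> \<Xi>"
      then obtain F where F: "A = {x\<in>X. \<forall>i<n. (shift ^^ i) x \<in> F i}" "\<forall>i<n. F i \<in> \<xi>"
        by (auto simp: refined_partition_def spM \<Xi>_def)
      then show "\<exists>F. F \<in> PiE {..<n} (\<lambda>_. \<xi>) \<and> A = {x\<in>X. \<forall>i<n. (shift ^^ i) x \<in> F i}"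
        by (intro exI[of _ "restrict F {..<n}"]) auto
    qed
    then obtain F where F: "\<And>A. A \<in> \<Xi> \<Longrightarrow> F A \<in> PiE {..<n} (\<lambda>_. \<xi>)"
      "\<And>A. A \<in> \<Xi> \<Longrightarrow> A = {x\<in>X. \<forall>i<n. (shift ^^ i) x \<in> F A i}"
      by (rule bchoice[THEN exE]) blast
    have Finj: "inj_on F \<Xi>"
    proof (rule inj_onI)
      fix A B assume "A \<in> \<Xi>" "B \<in> \<Xi>" "F A = F B"
      then show "A = B" using F(2)[of A] F(2)[of B] by simp
    qed
    define r where "r A w = (\<Prod>i<n. \<rho> (F A i) (\<psi> ((shift ^^ i) (e w))))" for A w
    have rpos: "r A w > 0" for A w unfolding r_def by (intro prod_pos \<rho>pos ballI)
    have rsum: "(\<Sum>A\<in>\<Xi>. r A w) \<le> 1" for w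
    proof -
      have "(\<Sum>A\<in>\<Xi>. r A w) = (\<Sum>G\<in>F ` \<Xi>. \<Prod>i<n. \<rho> (G i) (\<psi> ((shift ^^ i) (e w))))"
        by (simp add: sum.reindex[OF Finj] r_def)
      also have "\<dots> \<le> (\<Sum>G\<in>PiE {..<n} (\<lambda>_. \<xi>). \<Prod>i<n. \<rho> (G i) (\<psi> ((shift ^^ i) (e w))))"
      proof (rule sum_mono2)
        show "finite (PiE {..<n} (\<lambda>_. \<xi>))" using fin by (intro finite_PiE) auto
        show "F ` \<Xi> \<subseteq> PiE {..<n} (\<lambda>_. \<xi>)" using F(1) by blast
        show "0 \<le> (\<Prod>i<n. \<rho> (G i) (\<psi> ((shift ^^ i) (e w))))" for G
          by (intro prod_nonneg less_imp_le[OF \<rho>pos] ballI)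
      qed
      also have "\<dots> = (\<Prod>i<n. \<Sum>A\<in>\<xi>. \<rho> A (\<psi> ((shift ^^ i) (e w))))"
        using fin by (intro prod_sum_PiE[symmetric]) auto
      also have "\<dots> \<le> (\<Prod>i<n. 1)"
        by (intro prod_mono conjI \<rho>sum \<psi>_in sum_nonneg less_imp_le[OF \<rho>pos])
      finally show ?thesis by simp
    qed
    define q where "q A = (\<Sum>(u,v,t)\<in>W. p v * r A (u @ v @ t))" for A
    have Wset: "set u \<subseteq> S \<and> set v \<subseteq> S \<and> set t \<subseteq> S" if "(u,v,t) \<in> W" for u v t
      using that by (auto simp: W_def lists_of_def)
    have term_pos: "p v * r A (u @ v @ t) > 0" if "(u,v,t) \<in> W" for u v t A
      using Wset[OF that] ppos rpos by simp
    have qge: "p v * r A (u @ v @ t) \<le> q A" if "(u,v,t) \<in> W" for u v t A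
      unfolding q_def using member_le_sum[OF that, of "\<lambda>(u,v,t). p v * r A (u @ v @ t)"] term_pos finW
      by (auto simp: less_imp_le)
    have Wne: "\<exists>u v t. (u,v,t) \<in> W"
      using lists_of_nonempty[OF symbols_nonempty] by (auto simp: W_def)
    have qpos: "q A > 0" for A
    proof -
      obtain u v t where "(u,v,t) \<in> W" using Wne by blast
      then show ?thesis using term_pos[of u v t A] qge[of u v t A] by linarith
    qed
    have qsum: "(\<Sum>A\<in>\<Xi>. q A) \<le> 1"
    proof -
      have "(\<Sum>A\<in>\<Xi>. q A) = (\<Sum>(u,v,t)\<in>W. p v * (\<Sum>A\<in>\<Xi>. r A (u @ v @ t)))"
        unfolding q_def by (subst sum.swap) (simp add: sum_distrib_left split_beta)
      also have "\<dots> \<le> (\<Sum>(u,v,t)\<in>W. p v)"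
      proof (rule sum_mono)
        fix z assume z: "z \<in> W"
        obtain u v t where [simp]: "z = (u,v,t)" by (cases z)
        have "p v * (\<Sum>A\<in>\<Xi>. r A (u @ v @ t)) \<le> p v * 1"
          using Wset[of u v t] z ppos[of v] rsum by (intro mult_left_mono) auto
        then show "(case z of (u,v,t) \<Rightarrow> p v * (\<Sum>A\<in>\<Xi>. r A (u @ v @ t))) \<le> (case z of (u,v,t) \<Rightarrow> p v)" by simp
      qed
      finally show ?thesis using psum by simp
    qed
    have "partition_entropy M \<Xi> \<le> (\<integral>x. ln (Z n) + (2 * ln Nm + \<kappa>) - birkhoff_sum \<phi> n x + birkhoff_sum cost n x \<partial>M)"
    proof (rule partition_entropy_le[where q = q])
      show "measurable_partition M \<Xi>" unfolding \<Xi>_def by (rule measurable_partition_refined[OF \<xi> sh])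
      show "integrable M (\<lambda>x. ln (Z n) + (2 * ln Nm + \<kappa>) - birkhoff_sum \<phi> n x + birkhoff_sum cost n x)"
        using birkhoff_sum_integral(1)[OF inv int] birkhoff_sum_integral(1)[OF inv icost] by auto
      show "(\<Sum>A\<in>\<Xi>. q A) \<le> 1" by (rule qsum)
      show "q A > 0" for A by (rule qpos)
      fix A assume A: "A \<in> \<Xi>"
      have "- ln (q A) \<le> ln (Z n) + (2 * ln Nm + \<kappa>) - birkhoff_sum \<phi> n x + birkhoff_sum cost n x" if x: "x \<in> full_shift S" "x \<in> A" for x
      proof -
        \<comment> \<open>Of the sum \<open>q A\<close> only one term is kept: that of the padded
          word which \<open>x\<close> itself shows. On it the decoder sees exactly the windows of
          \<open>x\<close>.\<close>
        define u v t where "u = window (- int m) m x" and "v = window 0 n x" and "t = window (int n) m x"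
        have uvt: "u @ v @ t = window (- int m) (m + (n + m)) x"
          by (simp add: u_def v_def t_def window_add)
        have inW: "(u,v,t) \<in> W" using x(1) by (auto simp: W_def u_def v_def t_def window_in_lists_of)
        have \<psi>e: "\<psi> ((shift ^^ i) (e (u @ v @ t))) = \<psi> ((shift ^^ i) x)" if i: "i < n" for i
        proof (rule \<psi>_cong)
          show "(shift ^^ i) (e (u @ v @ t)) \<in> X" "(shift ^^ i) x \<in> X"
            using Wset[OF inW] e_in[of "u @ v @ t"] x(1) X funpow_shift_full_shift[of _ S i] by auto
          fix j assume j: "\<bar>j\<bar> \<le> int m"
          define l where "l = nat (j + int i + int m)"
          have l: "int l = j + int i + int m" "l < m + (n + m)" using j i by (auto simp: l_def)
          have "(shift ^^ i) (e (u @ v @ t)) j = ext (u @ v @ t) (int l)"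
            unfolding l(1) by (simp add: funpow_shift e_def)
          also have "\<dots> = x (- int m + int l)" unfolding uvt using l(2) by (subst ext_nth) auto
          also have "\<dots> = (shift ^^ i) x j" unfolding l(1) by (simp add: funpow_shift)
          finally show "(shift ^^ i) (e (u @ v @ t)) j = (shift ^^ i) x j" .
        qed
        have "p v * r A (u @ v @ t) \<le> q A" by (rule qge[OF inW])
        then have "ln (p v * r A (u @ v @ t)) \<le> ln (q A)"
          using term_pos[OF inW, of A] qpos[of A] by (subst ln_le_cancel_iff) auto
        moreover have "ln (p v * r A (u @ v @ t)) = ln (p v) + (\<Sum>i<n. ln (\<rho> (F A i) (\<psi> ((shift ^^ i) (e (u @ v @ t))))))"
        proof -
          have "ln (r A (u @ v @ t)) = (\<Sum>i<n. ln (\<rho> (F A i) (\<psi> ((shift ^^ i) (e (u @ v @ t))))))"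
            unfolding r_def by (rule ln_prod) (use \<rho>pos in \<open>auto simp: less_imp_neq[symmetric]\<close>)
          then show ?thesis using ppos[of v] Wset[OF inW] rpos[of A "u @ v @ t"] by (subst ln_mult) auto
        qed
        moreover have "- (\<Sum>i<n. ln (\<rho> (F A i) (\<psi> ((shift ^^ i) (e (u @ v @ t)))))) \<le> birkhoff_sum cost n x"
          unfolding birkhoff_sum_def sum_negf[symmetric]
        proof (rule sum_mono)
          fix i assume "i \<in> {..<n}"
          then have i: "i < n" by simp
          have "(shift ^^ i) x \<in> F A i" using F(2)[OF A] x(2) i by blast
          moreover have "F A i \<in> \<xi>" using F(1)[OF A] i by (auto simp: PiE_iff)
          ultimately show "- ln (\<rho> (F A i) (\<psi> ((shift ^^ i) (e (u @ v @ t))))) \<le> cost ((shift ^^ i) x)"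
            unfolding \<psi>e[OF i] by (rule cost)
        qed
        moreover have "- ln (p v) \<le> ln (Z n) + 2 * ln Nm + \<kappa> - birkhoff_sum \<phi> n x"
        proof -
          have v: "set v \<subseteq> S" "length v = n" using Wset[OF inW] by (auto simp: v_def)
          have "ln (p v) = ln (weight v) - ln (Z n) - 2 * ln Nm"
            using F_pos[OF v(1)] Z_pos[of n] Nm by (simp add: p_def ln_div ln_mult)
          moreover have "\<bar>birkhoff_sum \<phi> n (ext v) - birkhoff_sum \<phi> n x\<bar> \<le> \<kappa>"
            by (rule birkhoff_sum_distortion) (use v x ext_in in \<open>auto simp: ext_nth v_def\<close>)
          ultimately show ?thesis using v(2) by (simp add: ln_weight abs_le_iff)
        qed
        ultimately show ?thesis by linarith
      qed
      then show "AE x in M. x \<in> A \<longrightarrow> - ln (q A) \<le> ln (Z n) + (2 * ln Nm + \<kappa>) - birkhoff_sum \<phi> n x + birkhoff_sum cost n x"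
        using supp by (auto elim!: eventually_mono)
    qed
    also have "\<dots> = ln (Z n) + (2 * ln Nm + \<kappa>) - real n * (\<integral>x. \<phi> x \<partial>M) + real n * (\<integral>x. cost x \<partial>M)"
      using birkhoff_sum_integral[OF inv int, of n] birkhoff_sum_integral[OF inv icost, of n] by (simp add: prob_space)
    also have "real n * (\<integral>x. cost x \<partial>M) \<le> real n * \<eta>" using Ecost by (intro mult_left_mono) auto
    finally show ?thesis unfolding \<Xi>_def shift_entropy_def by (simp add: algebra_simps)
  qed
  then show ?thesis by blast
qed

text \<open>The upper bound for the entropy carries an arbitrary \<eta>; letting it tend to 0 makes
  the two bounds meet.\<close>

theorem equilibrium_measure_exists:
  assumes X: "full_shift S \<subseteq> X" and shX: "\<And>x. x \<in> X \<Longrightarrow> shift x \<in> X"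
    and T: "finite T" "X \<subseteq> full_shift T" and meas: "\<phi> \<in> borel_measurable (restrict_space borel X)"
  shows "\<exists>M. invariant_probability X M \<and> integrable M \<phi> \<and> (AE x in M. x \<in> full_shift S) \<and> full_shift S \<in> sets M \<and>
    metric_entropy M shift + ereal (\<integral>x. \<phi> x \<partial>M) = ereal (pressure (full_shift S) \<phi>)"
proof -
  obtain M where inv: "invariant_probability X M" and supp: "AE x in M. x \<in> full_shift S"
    and fs: "full_shift S \<in> sets M"
    and gibbs: "\<And>w. set w \<subseteq> S \<Longrightarrow> measure M {x\<in>X. window 0 (length w) x = w} \<le> exp (8 * \<kappa>) * (weight w / Z (length w))"
    using gibbs_measure[OF X shX] by blast
  have int: "integrable M \<phi>" by (rule integrable_potential[OF inv supp meas])
  let ?I = "\<integral>x. \<phi> x \<partial>M" and ?P = "pressure (full_shift S) \<phi>"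
  let ?h = "\<lambda>\<xi>. limsup (\<lambda>n. ereal (shift_entropy M \<xi> n / real n))"
  have "metric_entropy M shift = ereal (?P - ?I)"
  proof (rule antisym)
    show "metric_entropy M shift \<le> ereal (?P - ?I)"
      unfolding metric_entropy_def shift_entropy_def[symmetric]
    proof (rule SUP_least)
      fix \<xi> assume "\<xi> \<in> {\<xi>. measurable_partition M \<xi>}"
      then have \<xi>: "measurable_partition M \<xi>" by simp
      show "?h \<xi> \<le> ereal (?P - ?I)"
      proof (rule ereal_le_epsilon2)
        fix \<eta> :: real assume "0 < \<eta>"
        then obtain c where c: "\<And>n. shift_entropy M \<xi> n \<le> ln (Z n) + c - real n * (?I - \<eta>)"
          using entropy_upper_bound[OF inv supp int X \<xi>] by blast
        have "?h \<xi> \<le> ereal (?P - (?I - \<eta>))" by (rule limsup_entropy_le) (rule c)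
        then show "?h \<xi> \<le> ereal (?P - ?I) + ereal \<eta>" by (simp add: algebra_simps)
      qed
    qed
    obtain \<xi> where \<xi>: "measurable_partition M \<xi>" and
      l: "\<And>n. ln (Z n) - 9 * \<kappa> - real n * ?I \<le> shift_entropy M \<xi> n"
      using entropy_lower_bound[OF inv supp int T gibbs] by blast
    have "ereal (?P - ?I) \<le> ?h \<xi>" by (rule limsup_entropy_ge[of "- 9 * \<kappa>"]) (use l in auto)
    also have "\<dots> \<le> metric_entropy M shift" unfolding metric_entropy_def shift_entropy_def[symmetric] by (rule SUP_upper) (simp add: \<xi>)
    finally show "ereal (?P - ?I) \<le> metric_entropy M shift" .
  qed
  then show ?thesis using inv int supp fs by (intro exI[of _ M]) simp
qed

end

section \<open>The two-coloured subshift and the extended potential\<close>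

lemma coloured_symbols: "green \<nu> \<union> yellow \<nu> = {1..2 * \<nu>}"
  by (auto simp: green_def yellow_def)

lemma green_yellow_disjoint: "green \<nu> \<inter> yellow \<nu> = {}"
  by (auto simp: green_def yellow_def)

lemma two_coloured_shift_symbols: "x \<in> two_coloured_shift \<nu> \<tau> \<Longrightarrow> x i \<le> 2 * \<nu>"
  by (auto simp: two_coloured_shift_def)

lemma coloured_iff: "x \<in> two_coloured_shift \<nu> \<tau> \<Longrightarrow> x i \<in> green \<nu> \<union> yellow \<nu> \<longleftrightarrow> x i \<noteq> 0"
  using two_coloured_shift_symbols[of x \<nu> \<tau> i] by (auto simp: coloured_symbols)

lemma full_shift_subset_two_coloured:
  "full_shift (green \<nu>) \<subseteq> two_coloured_shift \<nu> \<tau>" "full_shift (yellow \<nu>) \<subseteq> two_coloured_shift \<nu> \<tau>"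
  by (auto simp: two_coloured_shift_def full_shift_def green_def yellow_def) (metis add_leE trans_le_add1 mult_2)+

section \<open>Translation invariance of the subshift\<close>

definition translate :: "int \<Rightarrow> int set \<Rightarrow> int set" where
  "translate k B = (\<lambda>i. i + k) ` B"

lemma mem_translate: "i \<in> translate k B \<longleftrightarrow> i - k \<in> B"
  by (force simp: translate_def)

lemma translate_translate: "translate k (translate (- k) B) = B" "translate (- k) (translate k B) = B"
  by (auto simp: set_eq_iff mem_translate)

lemma translate_subset: "translate k B \<subseteq> translate k C \<longleftrightarrow> B \<subseteq> C"
  unfolding translate_def by (rule inj_image_subset_iff) (simp add: inj_def)

lemma image_translate: "x ` translate k B = (\<lambda>i. x (i + k)) ` B"
  by (simp add: translate_def image_image)

lemma card_translate: "card (translate k B) = card B" "finite (translate k B) = finite B"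
  unfolding translate_def by (auto intro!: card_image simp: inj_on_def finite_image_iff)

lemma ball_translate: "(\<forall>i\<in>translate k B. Q i) \<longleftrightarrow> (\<forall>i\<in>B. Q (i + k))"
  by (simp add: translate_def)

lemma coloured_interval_translate:
  "coloured_interval \<nu> (\<lambda>i. x (i + k)) B \<longleftrightarrow> coloured_interval \<nu> x (translate k B)"
proof -
  have "(\<forall>i\<in>translate k B. \<forall>l\<in>translate k B. {i..l} \<subseteq> translate k B) \<longleftrightarrow> (\<forall>i\<in>B. \<forall>l\<in>B. {i..l} \<subseteq> B)"
  proof -
    have "{i + k..l + k} = translate k {i..l}" for i l by (auto simp: set_eq_iff mem_translate)
    then show ?thesis by (simp only: ball_translate translate_subset)
  qed
  then show ?thesis by (auto simp: coloured_interval_def image_translate) (auto simp: translate_def)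
qed

lemma coloured_block_translate:
  "coloured_block \<nu> (\<lambda>i. x (i + k)) B \<longleftrightarrow> coloured_block \<nu> x (translate k B)"
  unfolding coloured_block_def coloured_interval_translate
  by (metis translate_subset translate_translate)

lemma gap_translate: "gap (translate k B) (translate k C) = translate k (gap B C)"
  by (auto simp: gap_def set_eq_iff mem_translate ball_translate less_diff_eq diff_less_eq)

lemma successive_blocks_translate:
  "successive_blocks \<nu> (\<lambda>i. x (i + k)) B C \<longleftrightarrow> successive_blocks \<nu> x (translate k B) (translate k C)"
  unfolding successive_blocks_def coloured_block_translate gap_translate
  by (auto simp: translate_def)

lemma translate_two_coloured_shift:
  assumes x: "x \<in> two_coloured_shift \<nu> \<tau>"
  shows "(\<lambda>i. x (i + k)) \<in> two_coloured_shift \<nu> \<tau>"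
proof (cases "x \<in> full_shift (green \<nu>) \<union> full_shift (yellow \<nu>)")
  case True
  then have "(\<lambda>i. x (i + k)) \<in> full_shift (green \<nu>) \<union> full_shift (yellow \<nu>)" by (auto simp: full_shift_def)
  then show ?thesis using full_shift_subset_two_coloured by blast
next
  case False
  then have 1: "coloured_block \<nu> x B \<Longrightarrow> x ` B \<subseteq> green \<nu> \<or> x ` B \<subseteq> yellow \<nu>"
    and 2: "successive_blocks \<nu> x B C \<Longrightarrow>
             (x ` B \<subseteq> green \<nu> \<and> x ` C \<subseteq> yellow \<nu> \<or> x ` B \<subseteq> yellow \<nu> \<and> x ` C \<subseteq> green \<nu>) \<and>
             finite B \<and> finite C \<and> real (card (gap B C)) \<ge> \<tau> * real (card B + card C)" for B C
    using x by (auto simp: two_coloured_shift_def)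
  have "\<forall>i. x (i + k) \<in> {0..2 * \<nu>}" using two_coloured_shift_symbols[OF x] by auto
  moreover have "(\<lambda>i. x (i + k)) ` B \<subseteq> green \<nu> \<or> (\<lambda>i. x (i + k)) ` B \<subseteq> yellow \<nu>" if "coloured_block \<nu> (\<lambda>i. x (i + k)) B" for B
    using 1[of "translate k B"] that unfolding coloured_block_translate image_translate by blast
  moreover have "((\<lambda>i. x (i + k)) ` B \<subseteq> green \<nu> \<and> (\<lambda>i. x (i + k)) ` C \<subseteq> yellow \<nu> \<or> (\<lambda>i. x (i + k)) ` B \<subseteq> yellow \<nu> \<and> (\<lambda>i. x (i + k)) ` C \<subseteq> green \<nu>) \<and>
             finite B \<and> finite C \<and> real (card (gap B C)) \<ge> \<tau> * real (card B + card C)" if "successive_blocks \<nu> (\<lambda>i. x (i + k)) B C" for B C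
    using 2[of "translate k B" "translate k C"] that
    unfolding successive_blocks_translate image_translate gap_translate card_translate by blast
  ultimately show ?thesis unfolding two_coloured_shift_def by blast
qed

lemma funpow_shift_two_coloured: "x \<in> two_coloured_shift \<nu> \<tau> \<Longrightarrow> (shift ^^ n) x \<in> two_coloured_shift \<nu> \<tau>"
  unfolding funpow_shift by (rule translate_two_coloured_shift)

section \<open>Blocks and gaps seen through finite stretches\<close>

text \<open>The block is the set of coordinates joined to \<open>i0\<close> by coloured symbols. The
  last clause is maximality in the form used later: a coloured stretch that reaches
  \<open>i0\<close> lies in the block.\<close>

lemma coloured_block_exists:
  assumes "x i0 \<in> green \<nu> \<union> yellow \<nu>"
  shows "\<exists>B. coloured_block \<nu> x B \<and> i0 \<in> B \<and> (\<forall>i. (\<forall>j\<in>{min i i0..max i i0}. x j \<in> green \<nu> \<union> yellow \<nu>) \<longrightarrow> i \<in> B)"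
proof -
  define B where "B = {i. \<forall>j\<in>{min i i0..max i i0}. x j \<in> green \<nu> \<union> yellow \<nu>}"
  have "i0 \<in> B" using assms by (simp add: B_def)
  have int: "{i..l} \<subseteq> B" if "i \<in> B" "l \<in> B" for i l
  proof
    fix m assume m: "m \<in> {i..l}"
    have "x j \<in> green \<nu> \<union> yellow \<nu>" if j: "j \<in> {min m i0..max m i0}" for j
    proof -
      have "j \<in> {min i i0..max i i0} \<or> j \<in> {min l i0..max l i0}" using m j by auto
      then show ?thesis using \<open>i \<in> B\<close> \<open>l \<in> B\<close> unfolding B_def by blast
    qed
    then show "m \<in> B" by (auto simp: B_def)
  qed
  have "x ` B \<subseteq> green \<nu> \<union> yellow \<nu>"
  proof
    fix s assume "s \<in> x ` B"
    then obtain i where "i \<in> B" "s = x i" by blast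
    then show "s \<in> green \<nu> \<union> yellow \<nu>" unfolding B_def by (auto dest: bspec[of _ _ i])
  qed
  then have ci: "coloured_interval \<nu> x B" using int \<open>i0 \<in> B\<close> by (auto simp: coloured_interval_def)
  have "B' = B" if B': "coloured_interval \<nu> x B'" "B \<subseteq> B'" for B'
  proof
    show "B' \<subseteq> B"
    proof
      fix i assume i: "i \<in> B'"
      have "i0 \<in> B'" using \<open>i0 \<in> B\<close> B' by blast
      then have "{i..i0} \<subseteq> B'" "{i0..i} \<subseteq> B'" using B'(1) i by (auto simp: coloured_interval_def)
      then have "{min i i0..max i i0} \<subseteq> B'" by (auto simp: min_def max_def)
      then show "i \<in> B" using B'(1) unfolding B_def coloured_interval_def by blast
    qed
  qed (rule B'(2))
  with ci \<open>i0 \<in> B\<close> show ?thesis unfolding coloured_block_def by (intro exI[of _ B]) (auto simp: B_def)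
qed

lemma coloured_run_monochromatic:
  assumes x: "x \<in> two_coloured_shift \<nu> \<tau>" and col: "\<And>i. i \<in> {p..q} \<Longrightarrow> x i \<noteq> 0"
  shows "x ` {p..q} \<subseteq> green \<nu> \<or> x ` {p..q} \<subseteq> yellow \<nu>"
proof (cases "x \<in> full_shift (green \<nu>) \<union> full_shift (yellow \<nu>) \<or> q < p")
  case True
  then show ?thesis by (auto simp: full_shift_def)
next
  case False
  then have pq: "p \<le> q" by simp
  note ci = coloured_iff[OF x]
  obtain B where B: "coloured_block \<nu> x B" "\<forall>i. (\<forall>j\<in>{min i p..max i p}. x j \<in> green \<nu> \<union> yellow \<nu>) \<longrightarrow> i \<in> B"
    using coloured_block_exists[of x p \<nu>] ci col[of p] pq by auto
  have "{p..q} \<subseteq> B"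
  proof
    fix i assume "i \<in> {p..q}"
    then show "i \<in> B" using B(2)[rule_format, of i] ci col by auto
  qed
  moreover have "x ` B \<subseteq> green \<nu> \<or> x ` B \<subseteq> yellow \<nu>"
    using x False B(1) by (auto simp: two_coloured_shift_def)
  ultimately show ?thesis by blast
qed

text \<open>The gap rule is weakened to what a word can show: \<open>p\<close> may lie inside its
  block, so \<open>q - p\<close> is only a lower bound for the length of that block, and the length
  of the next block is omitted. The zero at \<open>q\<close> excludes the monochromatic
  alternative.\<close>

lemma coloured_runs_separated:
  assumes x: "x \<in> two_coloured_shift \<nu> \<tau>" and \<tau>: "\<tau> > 0" and pqr: "p < q" "q < r"
    and col: "\<And>i. i \<in> {p..<q} \<Longrightarrow> x i \<noteq> 0" and zero: "\<And>i. i \<in> {q..<r} \<Longrightarrow> x i = 0" and r: "x r \<noteq> 0"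
  shows "(x p \<in> green \<nu> \<and> x r \<in> yellow \<nu> \<or> x p \<in> yellow \<nu> \<and> x r \<in> green \<nu>) \<and> \<tau> * real_of_int (q - p) \<le> real_of_int (r - q)"
proof -
  note ci = coloured_iff[OF x]
  have xq: "x q = 0" using zero pqr by auto
  have nm: "x \<notin> full_shift (green \<nu>) \<union> full_shift (yellow \<nu>)"
  proof -
    have "x q \<notin> green \<nu> \<union> yellow \<nu>" using xq by (simp add: coloured_symbols)
    then show ?thesis unfolding full_shift_def by blast
  qed
  obtain B where B: "coloured_block \<nu> x B" "q - 1 \<in> B" "\<forall>i. (\<forall>j\<in>{min i (q - 1)..max i (q - 1)}. x j \<in> green \<nu> \<union> yellow \<nu>) \<longrightarrow> i \<in> B"
    using coloured_block_exists[of x "q - 1" \<nu>] ci col[of "q - 1"] pqr by auto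
  obtain C where C: "coloured_block \<nu> x C" "r \<in> C"
    using coloured_block_exists[of x r \<nu>] ci r by auto
  have colB: "x i \<noteq> 0" if "i \<in> B" for i
  proof -
    have "x i \<in> green \<nu> \<union> yellow \<nu>" using B(1) that unfolding coloured_block_def coloured_interval_def by blast
    then show ?thesis using ci[of i] by blast
  qed
  have colC: "x i \<noteq> 0" if "i \<in> C" for i
  proof -
    have "x i \<in> green \<nu> \<union> yellow \<nu>" using C(1) that unfolding coloured_block_def coloured_interval_def by blast
    then show ?thesis using ci[of i] by blast
  qed
  have Ble: "i < q" if "i \<in> B" for i
  proof (rule ccontr)
    assume "\<not> i < q"
    have "{q - 1..i} \<subseteq> B" using B(1,2) that by (auto simp: coloured_block_def coloured_interval_def)
    then have "q \<in> B" using \<open>\<not> i < q\<close> by auto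
    then show False using colB xq by blast
  qed
  have Cge: "r \<le> j" if "j \<in> C" for j
  proof (rule ccontr)
    assume "\<not> r \<le> j"
    have "{j..r} \<subseteq> C" using C that by (auto simp: coloured_block_def coloured_interval_def)
    then have "max j q \<in> C" using \<open>\<not> r \<le> j\<close> pqr by auto
    moreover have "x (max j q) = 0" using zero \<open>\<not> r \<le> j\<close> pqr by auto
    ultimately show False using colC by blast
  qed
  have pB: "{p..<q} \<subseteq> B"
  proof
    fix i assume i: "i \<in> {p..<q}"
    then show "i \<in> B" using B(3)[rule_format, of i] ci col by auto
  qed
  have gap: "gap B C = {q..<r}"
  proof (intro equalityI subsetI)
    fix k assume "k \<in> gap B C"
    then show "k \<in> {q..<r}" using B(2) C(2) by (auto simp: gap_def)
  next
    fix k assume "k \<in> {q..<r}"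
    then show "k \<in> gap B C" using Ble Cge by (fastforce simp: gap_def)
  qed
  have "successive_blocks \<nu> x B C"
    unfolding successive_blocks_def gap using B(1) C(1) zero Ble Cge pqr by fastforce
  then have s: "x ` B \<subseteq> green \<nu> \<and> x ` C \<subseteq> yellow \<nu> \<or> x ` B \<subseteq> yellow \<nu> \<and> x ` C \<subseteq> green \<nu>" "finite B"
     "\<tau> * real (card B + card C) \<le> real (card (gap B C))"
    using x nm by (auto simp: two_coloured_shift_def)
  \<comment> \<open>Finiteness of \<open>B\<close>, supplied by the rule for successive blocks,
    matters: an infinite set has cardinality 0 here.\<close>
  have "card {p..<q} \<le> card B" by (rule card_mono[OF s(2) pB])
  then have "real_of_int (q - p) \<le> real (card B + card C)" using pqr by simp
  then have "\<tau> * real_of_int (q - p) \<le> \<tau> * real (card B + card C)" using \<tau> by (intro mult_left_mono) auto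
  also have "\<dots> \<le> real_of_int (r - q)" using s(3) pqr by (simp add: gap)
  finally show ?thesis using s(1) pB C(2) pqr by (auto simp: subset_iff image_subset_iff)
qed

section \<open>The extended potential\<close>

lemma longest_symmetric_bound:
  assumes "\<forall>i. \<bar>i\<bar> \<le> int m \<longrightarrow> x i \<in> S" "x j \<notin> S"
  shows "m \<le> nat \<bar>j\<bar>"
proof (rule ccontr)
  assume "\<not> m \<le> nat \<bar>j\<bar>"
  then have "\<bar>j\<bar> \<le> int m" by linarith
  then show False using assms by blast
qed

lemma longest_symmetric_exists:
  assumes "x 0 \<in> S" and j: "x j \<notin> S"
  shows "\<exists>N. longest_symmetric S x N"
proof -
  let ?Q = "\<lambda>m. \<forall>i. \<bar>i\<bar> \<le> int m \<longrightarrow> x i \<in> S"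
  have "?Q 0" using assms by simp
  then show ?thesis
    unfolding longest_symmetric_def
    using GreatestI_nat[of ?Q 0 "nat \<bar>j\<bar>"] Greatest_le_nat[of ?Q _ "nat \<bar>j\<bar>"] longest_symmetric_bound[where x = x, OF _ j] by blast
qed

text \<open>A point with \<open>x 0 \<in> S\<close> outside the full shift over \<open>S\<close> is
  monochromatic in neither colour and has \<open>x 0 \<noteq> 0\<close>, so the last clause of the
  extension applies. This form treats one colour at a time.\<close>

lemma extension_word_dependent:
  assumes ext: "is_extension \<nu> \<tau> f g" and S: "S = green \<nu> \<or> S = yellow \<nu>"
  shows "\<exists>Y. \<forall>x\<in>two_coloured_shift \<nu> \<tau>. \<forall>n. x \<notin> full_shift S \<and> x 0 \<in> S \<and> longest_symmetric S x n \<longrightarrow>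
    Y (map x [- int n..int n]) \<in> full_shift S \<and> (\<forall>i. \<bar>i\<bar> \<le> int n \<longrightarrow> Y (map x [- int n..int n]) i = x i) \<and>
    g x = g (Y (map x [- int n..int n]))"
proof -
  obtain Y where Y: "\<forall>x\<in>two_coloured_shift \<nu> \<tau>.
          x \<notin> full_shift (green \<nu>) \<union> full_shift (yellow \<nu>) \<and> x 0 \<noteq> 0 \<longrightarrow>
          (\<forall>S\<in>{green \<nu>, yellow \<nu>}. \<forall>n. longest_symmetric S x n \<longrightarrow>
             (let y = Y (map x [- int n..int n])
              in y \<in> full_shift S \<and> (\<forall>i. \<bar>i\<bar> \<le> int n \<longrightarrow> y i = x i) \<and> g x = g y))"
    using ext unfolding is_extension_def by blast
  have SS: "S \<in> {green \<nu>, yellow \<nu>}" using S by blast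
  have "x \<notin> full_shift (green \<nu>) \<union> full_shift (yellow \<nu>) \<and> x 0 \<noteq> 0" if "x \<notin> full_shift S" "x 0 \<in> S" for x
  proof
    show "x \<notin> full_shift (green \<nu>) \<union> full_shift (yellow \<nu>)"
      using that S green_yellow_disjoint[of \<nu>] unfolding full_shift_def by blast
    show "x 0 \<noteq> 0" using that(2) S by (auto simp: green_def yellow_def)
  qed
  then show ?thesis using Y[rule_format, OF _ _ SS] unfolding Let_def by (intro exI[of _ Y]) blast
qed

text \<open>Whether \<open>x\<close> is monochromatic or not, its value is also taken at a
  monochromatic point that agrees with \<open>x\<close> around 0. This carries estimates for
  \<open>g\<close> back to the full shifts.\<close>

lemma extension_approximation:
  assumes ext: "is_extension \<nu> \<tau> f g" and x: "x \<in> two_coloured_shift \<nu> \<tau>" and S: "S = green \<nu> \<or> S = yellow \<nu>"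
    and n: "\<And>i. \<bar>i\<bar> \<le> int n \<Longrightarrow> x i \<in> S"
  shows "\<exists>z\<in>full_shift S. (\<forall>i. \<bar>i\<bar> \<le> int n \<longrightarrow> z i = x i) \<and> g x = g z"
proof (cases "x \<in> full_shift S")
  case True
  then show ?thesis by blast
next
  case False
  have x0: "x 0 \<in> S" using n by simp
  obtain j where j: "x j \<notin> S" using False by (auto simp: full_shift_def)
  obtain N where N: "longest_symmetric S x N" using longest_symmetric_exists[OF x0 j] by blast
  obtain Y where "Y (map x [- int N..int N]) \<in> full_shift S" "\<forall>i. \<bar>i\<bar> \<le> int N \<longrightarrow> Y (map x [- int N..int N]) i = x i"
    "g x = g (Y (map x [- int N..int N]))"
    using extension_word_dependent[OF ext S] x False x0 N by blast
  moreover have "n \<le> N" using N n unfolding longest_symmetric_def by blast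
  ultimately show ?thesis by (intro bexI[of _ "Y (map x [- int N..int N])"]) auto
qed

lemma yellow_point:
  assumes "is_extension \<nu> \<tau> f g" "z \<in> full_shift (yellow \<nu>)"
  shows "(\<lambda>i. z i - \<nu>) \<in> full_shift (green \<nu>) \<and> g z = f (\<lambda>i. z i - \<nu>) \<and> (\<forall>i. z i - \<nu> + \<nu> = z i)"
proof -
  have zy: "\<And>i. z i \<in> yellow \<nu>" using assms by (simp add: full_shift_def)
  have *: "z i - \<nu> \<in> green \<nu> \<and> z i - \<nu> + \<nu> = z i" for i using zy[of i] by (auto simp: yellow_def green_def)
  then have "(\<lambda>i. z i - \<nu>) \<in> full_shift (green \<nu>)" by (simp add: full_shift_def)
  moreover have "\<forall>x\<in>full_shift (green \<nu>). g (\<lambda>i. x i + \<nu>) = f x" using assms(1) by (simp add: is_extension_def)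
  moreover have "(\<lambda>i. z i - \<nu> + \<nu>) = z" using * by simp
  ultimately show ?thesis using * by metis
qed

lemma extension_le_Sup:
  assumes ext: "is_extension \<nu> \<tau> f g" and bdd: "bdd_above (f ` full_shift (green \<nu>))"
    and x: "x \<in> two_coloured_shift \<nu> \<tau>"
  shows "g x \<le> (SUP z\<in>full_shift (green \<nu>). f z)"
proof (cases "x 0 = 0")
  case True
  then show ?thesis using ext x by (simp add: is_extension_def)
next
  case False
  then have "x 0 \<in> green \<nu> \<union> yellow \<nu>" using coloured_iff[OF x] by blast
  then obtain S where S: "S = green \<nu> \<or> S = yellow \<nu>" "x 0 \<in> S" by blast
  then obtain z where z: "z \<in> full_shift S" "g x = g z"
    using extension_approximation[OF ext x S(1), of 0] by auto
  obtain y where "y \<in> full_shift (green \<nu>)" "g z = f y"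
  proof (cases "S = green \<nu>")
    case True
    then show ?thesis using z ext that[of z] by (simp add: is_extension_def)
  next
    case False
    then show ?thesis using yellow_point[OF ext, of z] z S that by blast
  qed
  then show ?thesis using z bdd by (simp add: cSUP_upper)
qed

lemma holder_extension_green:
  assumes "is_extension \<nu> \<tau> f g" "holder_continuous_on (full_shift (green \<nu>)) f"
  shows "holder_continuous_on (full_shift (green \<nu>)) g"
proof -
  have "g x = f x" if "x \<in> full_shift (green \<nu>)" for x using assms(1) that by (simp add: is_extension_def)
  then show ?thesis using assms(2) by (simp add: holder_continuous_on_def)
qed

lemma holder_extension_yellow:
  assumes ext: "is_extension \<nu> \<tau> f g" and f: "holder_continuous_on (full_shift (green \<nu>)) f"
  shows "holder_continuous_on (full_shift (yellow \<nu>)) g"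
proof -
  obtain \<theta> C where \<theta>: "0 < \<theta>" "\<theta> < 1" and h: "\<forall>n>0. \<forall>x\<in>full_shift (green \<nu>). \<forall>y\<in>full_shift (green \<nu>).
      (\<forall>i. \<bar>i\<bar> < int n \<longrightarrow> x i = y i) \<and> (x (- int n) \<noteq> y (- int n) \<or> x (int n) \<noteq> y (int n)) \<longrightarrow>
      \<bar>f x - f y\<bar> \<le> C * \<theta> ^ n"
    using f unfolding holder_continuous_on_def by (elim exE conjE) (rule that)
  have "\<bar>g x - g y\<bar> \<le> C * \<theta> ^ n" if n: "n > 0" and x: "x \<in> full_shift (yellow \<nu>)" and y: "y \<in> full_shift (yellow \<nu>)"
    and eq: "\<forall>i. \<bar>i\<bar> < int n \<longrightarrow> x i = y i" and neq: "x (- int n) \<noteq> y (- int n) \<or> x (int n) \<noteq> y (int n)" for n x y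
  proof -
    note px = yellow_point[OF ext x] and py = yellow_point[OF ext y]
    have sub: "x i - \<nu> = y i - \<nu> \<longleftrightarrow> x i = y i" for i
    proof -
      have "x i - \<nu> + \<nu> = x i" "y i - \<nu> + \<nu> = y i" using px py by blast+
      then show ?thesis by linarith
    qed
    then have "\<bar>f (\<lambda>i. x i - \<nu>) - f (\<lambda>i. y i - \<nu>)\<bar> \<le> C * \<theta> ^ n"
      using px py n eq neq by (intro h[rule_format]) (simp_all add: sub)
    then show ?thesis using px py by simp
  qed
  then show ?thesis unfolding holder_continuous_on_def using \<theta> by blast
qed

text \<open>Continuity of \<open>g\<close>, in three cases. If \<open>x 0 = 0\<close>, or if
  \<open>x\<close> is not monochromatic, \<open>g\<close> is locally constant; near a monochromatic
  \<open>x\<close>, the point \<open>y\<close> is replaced by a monochromatic one and the Hoelder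
  estimate applies.\<close>

lemma extension_oscillation:
  assumes ext: "is_extension \<nu> \<tau> f g" and x: "x \<in> two_coloured_shift \<nu> \<tau>"
    and hg: "holder_potential (green \<nu>) g \<theta> C" and hy: "holder_potential (yellow \<nu>) g \<theta>' C'" and e: "e > 0"
  shows "\<exists>n. \<forall>y\<in>two_coloured_shift \<nu> \<tau>. (\<forall>i. \<bar>i\<bar> \<le> int n \<longrightarrow> y i = x i) \<longrightarrow> \<bar>g y - g x\<bar> < e"
proof (cases "x 0 = 0")
  case True
  have "g y = g x" if "y \<in> two_coloured_shift \<nu> \<tau>" "y 0 = 0" for y
    using ext x True that by (simp add: is_extension_def)
  then show ?thesis using e True by (intro exI[of _ 0]) auto
next
  case False
  then have "x 0 \<in> green \<nu> \<union> yellow \<nu>" using coloured_iff[OF x] by blast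
  then obtain S where S: "S = green \<nu> \<or> S = yellow \<nu>" "x 0 \<in> S" by blast
  obtain t c where hS: "holder_potential S g t c" using S hg hy by blast
  interpret S: holder_potential S g t c by fact
  show ?thesis
  proof (cases "x \<in> full_shift S")
    case True
    have "(\<lambda>n. c * t ^ Suc n) \<longlonglongrightarrow> c * 0"
      using S.\<theta> by (intro tendsto_mult tendsto_const LIMSEQ_Suc LIMSEQ_realpow_zero) auto
    then have "eventually (\<lambda>n. c * t ^ Suc n < e) sequentially" using e by (intro order_tendstoD(2)) auto
    then obtain n where n: "c * t ^ Suc n < e" by (auto simp: eventually_sequentially)
    have "\<bar>g y - g x\<bar> < e" if y: "y \<in> two_coloured_shift \<nu> \<tau>" "\<forall>i. \<bar>i\<bar> \<le> int n \<longrightarrow> y i = x i" for y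
    proof -
      have "y i \<in> S" if "\<bar>i\<bar> \<le> int n" for i using y(2) True that by (auto simp: full_shift_def)
      then obtain z where z: "z \<in> full_shift S" "\<forall>i. \<bar>i\<bar> \<le> int n \<longrightarrow> z i = y i" "g y = g z"
        using extension_approximation[OF ext y(1) S(1)] by blast
      have "\<bar>g z - g x\<bar> \<le> c * t ^ Suc n"
        by (rule S.holder) (use z y True in auto)
      then show ?thesis using z n by simp
    qed
    then show ?thesis by blast
  next
    case False
    then obtain j where j: "x j \<notin> S" by (auto simp: full_shift_def)
    obtain Y where Y: "\<forall>x\<in>two_coloured_shift \<nu> \<tau>. \<forall>n. x \<notin> full_shift S \<and> x 0 \<in> S \<and> longest_symmetric S x n \<longrightarrow>
        Y (map x [- int n..int n]) \<in> full_shift S \<and> (\<forall>i. \<bar>i\<bar> \<le> int n \<longrightarrow> Y (map x [- int n..int n]) i = x i) \<and>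
        g x = g (Y (map x [- int n..int n]))"
      using extension_word_dependent[OF ext S(1)] by blast
    have val: "g y = g (Y (map y [- int n..int n]))" if "y \<in> two_coloured_shift \<nu> \<tau>" "y j \<notin> S" "y 0 \<in> S" "longest_symmetric S y n" for y n
      using Y[rule_format, of y n] that by (auto simp: full_shift_def)
    let ?Q = "\<lambda>x m. \<forall>i. \<bar>i\<bar> \<le> int m \<longrightarrow> x i \<in> S"
    obtain N where N: "longest_symmetric S x N" using longest_symmetric_exists[OF S(2) j] by blast
    \<comment> \<open>The symbol \<open>x j \<notin> S\<close> caps the longest symmetric word, so
      agreement up to distance |j| fixes that word and hence the value.\<close>
    have "g y = g x" if y: "y \<in> two_coloured_shift \<nu> \<tau>" "\<forall>i. \<bar>i\<bar> \<le> int (nat \<bar>j\<bar>) \<longrightarrow> y i = x i" for y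
    proof -
      have yj: "y j \<notin> S" and y0: "y 0 \<in> S" using y(2) j S by auto
      have eq: "?Q y m = ?Q x m" for m
      proof (cases "m \<le> nat \<bar>j\<bar>")
        case True
        then show ?thesis using y(2) by (metis of_nat_mono order_trans)
      next
        case False
        then show ?thesis using longest_symmetric_bound[where x = y and m = m] longest_symmetric_bound[where x = x and m = m] yj j by blast
      qed
      then have "longest_symmetric S y N" using N unfolding longest_symmetric_def by simp
      moreover have "map y [- int N..int N] = map x [- int N..int N]"
      proof -
        have "N \<le> nat \<bar>j\<bar>" using N longest_symmetric_bound[where x = x, OF _ j] unfolding longest_symmetric_def by blast
        then show ?thesis using y(2) by auto
      qed
      ultimately show ?thesis using val[OF y(1) yj y0, of N] val[OF x j S(2) N] by (simp only:)
    qed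
    then show ?thesis using e by (intro exI[of _ "nat \<bar>j\<bar>"]) auto
  qed
qed

lemma extension_measurable:
  assumes ext: "is_extension \<nu> \<tau> f g"
    and hg: "holder_potential (green \<nu>) g \<theta> C" and hy: "holder_potential (yellow \<nu>) g \<theta>' C'"
  shows "g \<in> borel_measurable (restrict_space borel (two_coloured_shift \<nu> \<tau>))"
proof (rule borel_measurable_continuous_on_restrict)
  show "continuous_on (two_coloured_shift \<nu> \<tau>) g"
    unfolding continuous_on_topological
  proof (intro ballI allI impI)
    fix x B assume x: "x \<in> two_coloured_shift \<nu> \<tau>" and B: "open B" "g x \<in> B"
    obtain e where e: "e > 0" "ball (g x) e \<subseteq> B" using B open_contains_ball by blast
    obtain n where n: "\<forall>y\<in>two_coloured_shift \<nu> \<tau>. (\<forall>i. \<bar>i\<bar> \<le> int n \<longrightarrow> y i = x i) \<longrightarrow> \<bar>g y - g x\<bar> < e"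
      using extension_oscillation[OF ext x hg hy e(1)] by blast
    define A where "A = (\<Inter>i\<in>{- int n..int n}. (\<lambda>y::point. y i) -` {x i})"
    have "open A" unfolding A_def
      by (intro open_INT ballI open_vimage continuous_on_product_coordinates) (rule finite_atLeastAtMost_int, rule Topological_Spaces.open_discrete)
    moreover have "x \<in> A" by (simp add: A_def)
    moreover have "g y \<in> B" if "y \<in> two_coloured_shift \<nu> \<tau>" "y \<in> A" for y
    proof -
      have "\<forall>i. \<bar>i\<bar> \<le> int n \<longrightarrow> y i = x i" using that(2) by (auto simp: A_def abs_le_iff)
      then have "\<bar>g y - g x\<bar> < e" using n that(1) by blast
      then show ?thesis using e(2) by (auto simp: dist_real_def abs_minus_commute)
    qed
    ultimately show "\<exists>A. open A \<and> x \<in> A \<and> (\<forall>y\<in>two_coloured_shift \<nu> \<tau>. y \<in> A \<longrightarrow> g y \<in> B)" by blast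
  qed
qed

text \<open>At time \<open>j\<close> the largest symmetric window inside the word has radius
  \<open>r\<close>. There \<open>x\<close> shows only symbols of \<open>S\<close>, so its value is
  that of a monochromatic \<open>z\<close> which agrees with the shifted \<open>y\<close> up to
  distance \<open>r\<close>. Outside the word \<open>x\<close> may contain zeros and the other
  colour.\<close>

lemma (in holder_potential) birkhoff_sum_extension:
  assumes ext: "is_extension \<nu> \<tau> f \<phi>" and S: "S = green \<nu> \<or> S = yellow \<nu>" and x: "x \<in> two_coloured_shift \<nu> \<tau>"
    and y: "y \<in> full_shift S" and xy: "\<And>i. i < n \<Longrightarrow> x (int i) = y (int i)"
  shows "\<bar>birkhoff_sum \<phi> n x - birkhoff_sum \<phi> n y\<bar> \<le> \<kappa>"
proof (rule birkhoff_sum_close)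
  fix j assume j: "j < n"
  define r where "r = min j (n - Suc j)"
  have eq: "(shift ^^ j) x i = (shift ^^ j) y i" if "\<bar>i\<bar> \<le> int r" for i
  proof -
    have "i + int j = int (nat (i + int j))" "nat (i + int j) < n" using that j by (auto simp: r_def)
    then show ?thesis unfolding funpow_shift by (metis xy)
  qed
  have sy: "(shift ^^ j) y \<in> full_shift S" by (rule funpow_shift_full_shift[OF y])
  then have "(shift ^^ j) x i \<in> S" if "\<bar>i\<bar> \<le> int r" for i using eq[OF that] by (simp add: full_shift_def)
  then obtain z where z: "z \<in> full_shift S" "\<forall>i. \<bar>i\<bar> \<le> int r \<longrightarrow> z i = (shift ^^ j) x i" "\<phi> ((shift ^^ j) x) = \<phi> z"
    using extension_approximation[OF ext funpow_shift_two_coloured[OF x] S] by blast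
  have "\<bar>\<phi> z - \<phi> ((shift ^^ j) y)\<bar> \<le> C * \<theta> ^ Suc r"
    by (rule holder[OF z(1) sy]) (use z(2) eq in auto)
  moreover have "Suc r = min (Suc j) (n - j)" using j by (auto simp: r_def)
  ultimately show "\<bar>\<phi> ((shift ^^ j) x) - \<phi> ((shift ^^ j) y)\<bar> \<le> C * \<theta> ^ min (Suc j) (n - j)"
    using z(3) by simp
qed

section \<open>Counting words of the two-coloured subshift\<close>

definition normalized_weight :: "(point \<Rightarrow> real) \<Rightarrow> real \<Rightarrow> nat \<Rightarrow> point \<Rightarrow> real" where
  "normalized_weight g P n x = exp (birkhoff_sum g n x - real n * P)"

lemma sum_half_powers: "(\<Sum>z<n. (1/2) ^ z) \<le> (2 :: real)"
  by (subst sum_gp_strict) auto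

text \<open>What the counting needs of the potential: a bound \<open>s\<close> for one symbol, and a
  bound \<open>D\<close> for words of one colour, uniform in the length and in the choice of points.
  The last two assumptions express the hypotheses on the pressure and on \<tau>.\<close>

locale two_coloured_sums =
  fixes \<nu> :: nat and \<tau> :: real and g :: "point \<Rightarrow> real" and P s D :: real
  assumes \<nu>: "\<nu> \<ge> 1" and \<tau>: "\<tau> > 0"
    and g_le: "x \<in> two_coloured_shift \<nu> \<tau> \<Longrightarrow> g x \<le> s"
    and monochromatic: "S = green \<nu> \<or> S = yellow \<nu> \<Longrightarrow> U \<subseteq> lists_of S n \<Longrightarrow>
      (\<And>u. u \<in> U \<Longrightarrow> pt u \<in> two_coloured_shift \<nu> \<tau> \<and> window 0 n (pt u) = u) \<Longrightarrow>
      (\<Sum>u\<in>U. normalized_weight g P n (pt u)) \<le> D"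
    and D: "D \<ge> 0" and gap_entropy: "P - s \<ge> ln 2" and \<tau>_large: "ln (3 * real \<nu>) \<le> (1 + \<tau>) * (P - s)"
begin

abbreviation "\<Sigma> \<equiv> two_coloured_shift \<nu> \<tau>"
abbreviation "E \<equiv> normalized_weight g P"

definition rate :: real where "rate = P - s"

lemma E_nonneg: "E n x \<ge> 0"
  by (simp add: normalized_weight_def)

lemma exp_rate_le: "exp (- rate * real k) \<le> (1/2) ^ k"
proof -
  have "exp (- rate) \<le> exp (- ln 2)" using gap_entropy by (simp add: rate_def)
  then have "exp (- rate) \<le> 1/2" by (simp add: exp_minus)
  then have "exp (- rate) ^ k \<le> (1/2) ^ k" by (intro power_mono) auto
  then show ?thesis by (simp add: exp_of_nat_mult[symmetric] mult.commute)
qed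

text \<open>A choice of one point in the cylinder of each word, as arbitrary as in the partition
  function. Removing a prefix turns one choice into another.\<close>

definition selects :: "nat \<Rightarrow> nat list set \<Rightarrow> (nat list \<Rightarrow> point) \<Rightarrow> bool" where
  "selects n U pt \<longleftrightarrow> (\<forall>u\<in>U. pt u \<in> \<Sigma> \<and> window 0 n (pt u) = u)"

lemma selectsD:
  assumes "selects n U pt" "u \<in> U"
  shows "pt u \<in> \<Sigma>" "window 0 n (pt u) = u" "length u = n" "i < n \<Longrightarrow> pt u (int i) = u ! i"
proof -
  show 1: "pt u \<in> \<Sigma>" and 2: "window 0 n (pt u) = u" using assms by (auto simp: selects_def)
  show "length u = n" using arg_cong[OF 2, of length] by simp
  show "i < n \<Longrightarrow> pt u (int i) = u ! i" using arg_cong[OF 2, of "\<lambda>w. w ! i"] by simp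
qed

lemma selects_subset: "selects n U pt \<Longrightarrow> V \<subseteq> U \<Longrightarrow> selects n V pt"
  by (auto simp: selects_def)

lemma selects_finite: "selects n U pt \<Longrightarrow> finite U"
proof -
  assume s: "selects n U pt"
  have "U \<subseteq> lists_of {0..2 * \<nu>} n"
  proof
    fix u assume u: "u \<in> U"
    have "set (window 0 n (pt u)) \<subseteq> {0..2 * \<nu>}"
      using two_coloured_shift_symbols[OF selectsD(1)[OF s u]] by (auto simp: window_def)
    then show "u \<in> lists_of {0..2 * \<nu>} n" using selectsD(2,3)[OF s u] by (simp add: lists_of_def)
  qed
  then show ?thesis by (rule finite_subset) simp
qed

lemma birkhoff_sum_le: "x \<in> \<Sigma> \<Longrightarrow> birkhoff_sum g k x \<le> real k * s"
proof -
  assume x: "x \<in> \<Sigma>"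
  have "birkhoff_sum g k x \<le> (\<Sum>j<k. s)"
    unfolding birkhoff_sum_def by (intro sum_mono g_le funpow_shift_two_coloured x)
  then show ?thesis by simp
qed

lemma E_split_left:
  assumes "x \<in> \<Sigma>" "k \<le> n"
  shows "E n x \<le> exp (- rate * real k) * E (n - k) ((shift ^^ k) x)"
proof -
  have "birkhoff_sum g n x = birkhoff_sum g k x + birkhoff_sum g (n - k) ((shift ^^ k) x)"
    using birkhoff_sum_add[of g k "n - k" x] assms(2) by simp
  then show ?thesis using birkhoff_sum_le[OF assms(1), of k] assms(2)
    by (simp add: normalized_weight_def exp_add[symmetric] rate_def of_nat_diff algebra_simps)
qed

lemma E_split_right:
  assumes "x \<in> \<Sigma>" "k \<le> n"
  shows "E n x \<le> exp (- rate * real k) * E (n - k) x"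
proof -
  have "birkhoff_sum g n x = birkhoff_sum g (n - k) x + birkhoff_sum g k ((shift ^^ (n - k)) x)"
    using birkhoff_sum_add[of g "n - k" k x] assms(2) by simp
  then show ?thesis using birkhoff_sum_le[OF funpow_shift_two_coloured[OF assms(1)], of k "n - k"] assms(2)
    by (simp add: normalized_weight_def exp_add[symmetric] rate_def of_nat_diff algebra_simps)
qed

text \<open>With a common prefix \<open>w\<close>, a word is recovered from its remainder, so
  deleting the prefix is injective and \<open>pt'\<close> can reuse the point chosen for the whole
  word.\<close>

lemma strip_prefix:
  assumes s: "selects n U pt" and pre: "\<And>u. u \<in> U \<Longrightarrow> take k u = w" and k: "k \<le> n"
  defines "pt' \<equiv> \<lambda>v. (shift ^^ k) (pt (w @ v))"
  shows "selects (n - k) (drop k ` U) pt'"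
    "(\<Sum>u\<in>U. E n (pt u)) \<le> exp (- rate * real k) * (\<Sum>v\<in>drop k ` U. E (n - k) (pt' v))"
proof -
  have u: "w @ drop k u = u" if "u \<in> U" for u using pre[OF that] by (metis append_take_drop_id)
  show "selects (n - k) (drop k ` U) pt'"
    unfolding selects_def
  proof (intro ballI)
    fix v assume "v \<in> drop k ` U"
    then obtain y where y: "y \<in> U" "v = drop k y" by blast
    have pt': "pt' v = (shift ^^ k) (pt y)" using u[OF y(1)] y(2) by (simp add: pt'_def)
    have "window 0 (n - k) ((shift ^^ k) (pt y)) = v"
    proof (rule nth_equalityI)
      show "length (window 0 (n - k) ((shift ^^ k) (pt y))) = length v"
        using y(2) selectsD(3)[OF s y(1)] by simp
      fix i assume "i < length (window 0 (n - k) ((shift ^^ k) (pt y)))"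
      then have i: "k + i < n" by simp
      have "(shift ^^ k) (pt y) (int i) = pt y (int (k + i))" by (simp add: funpow_shift add.commute)
      also have "\<dots> = v ! i" using selectsD(4)[OF s y(1) i] selectsD(3)[OF s y(1)] i y(2) by simp
      finally show "window 0 (n - k) ((shift ^^ k) (pt y)) ! i = v ! i" using i by simp
    qed
    then show "pt' v \<in> \<Sigma> \<and> window 0 (n - k) (pt' v) = v"
      unfolding pt' using funpow_shift_two_coloured[OF selectsD(1)[OF s y(1)]] by simp
  qed
  have inj: "inj_on (drop k) U" using u by (metis inj_onI)
  have "(\<Sum>u\<in>U. E n (pt u)) \<le> (\<Sum>u\<in>U. exp (- rate * real k) * E (n - k) (pt' (drop k u)))"
  proof (rule sum_mono)
    fix y assume y: "y \<in> U"
    show "E n (pt y) \<le> exp (- rate * real k) * E (n - k) (pt' (drop k y))"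
      using E_split_left[OF selectsD(1)[OF s y] k] u[OF y] by (simp add: pt'_def)
  qed
  then show "(\<Sum>u\<in>U. E n (pt u)) \<le> exp (- rate * real k) * (\<Sum>v\<in>drop k ` U. E (n - k) (pt' v))"
    by (simp add: sum.reindex[OF inj] sum_distrib_left)
qed

section \<open>Peeling off the first block and the gap behind it\<close>

definition run :: "nat list \<Rightarrow> nat" where "run u = length (takeWhile (\<lambda>a. a \<noteq> 0) u)"
definition zeros :: "nat list \<Rightarrow> nat" where "zeros u = length (takeWhile (\<lambda>a. a = 0) u)"

lemma takeWhile_length_nth:
  "i < length (takeWhile Q u) \<Longrightarrow> Q (u ! i)"
  "length (takeWhile Q u) < length u \<Longrightarrow> \<not> Q (u ! length (takeWhile Q u))"
proof -
  show "i < length (takeWhile Q u) \<Longrightarrow> Q (u ! i)"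
    using nth_mem[of i "takeWhile Q u"] set_takeWhileD[of _ Q u] takeWhile_nth[of i Q u] by auto
qed (rule nth_length_takeWhile)

lemma run_nth: "i < run u \<Longrightarrow> u ! i \<noteq> 0" "run u < length u \<Longrightarrow> u ! run u = 0" "run u \<le> length u"
  using takeWhile_length_nth[where Q = "\<lambda>a. a \<noteq> 0" and u = u] by (auto simp: run_def length_takeWhile_le)

lemma zeros_nth: "i < zeros u \<Longrightarrow> u ! i = 0" "zeros u < length u \<Longrightarrow> u ! zeros u \<noteq> 0" "zeros u \<le> length u"
  using takeWhile_length_nth[where Q = "\<lambda>a. a = 0" and u = u] by (auto simp: zeros_def length_takeWhile_le)

lemma coloured_prefix:
  assumes S: "S = green \<nu> \<or> S = yellow \<nu>" and s: "selects n U pt" and u: "u \<in> U" and hd: "u \<noteq> []" "hd u \<in> S"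
  shows "run u \<ge> 1" "take (run u) u \<in> lists_of S (run u)"
proof -
  have x: "pt u \<in> \<Sigma>" and len: "length u = n" using selectsD[OF s u] by auto
  have n0: "0 < n" using hd len by auto
  have h: "u ! 0 \<in> S" using hd by (simp add: hd_conv_nth)
  then have nz: "u ! 0 \<noteq> 0" using S by (auto simp: green_def yellow_def)
  show r1: "run u \<ge> 1"
  proof (rule ccontr)
    assume "\<not> run u \<ge> 1"
    then have "run u = 0" by simp
    then show False using run_nth(2)[of u] n0 len nz by simp
  qed
  have val: "pt u (int i) = u ! i" if "i < run u" for i using selectsD(4)[OF s u] that run_nth(3)[of u] len by simp
  have "pt u i \<noteq> 0" if "i \<in> {0..int (run u) - 1}" for i
    using val[of "nat i"] run_nth(1)[of "nat i" u] that by auto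
  then have "pt u ` {0..int (run u) - 1} \<subseteq> green \<nu> \<or> pt u ` {0..int (run u) - 1} \<subseteq> yellow \<nu>"
    by (rule coloured_run_monochromatic[OF x])
  moreover have "pt u 0 \<in> S" using val[of 0] r1 h by simp
  moreover have "0 \<in> {0..int (run u) - 1}" using r1 by simp
  ultimately have mono: "pt u ` {0..int (run u) - 1} \<subseteq> S" using S green_yellow_disjoint[of \<nu>] by blast
  have "u ! i \<in> S" if "i < run u" for i
    using mono val[OF that] that by (auto simp: image_subset_iff dest!: bspec[of _ _ "int i"])
  then show "take (run u) u \<in> lists_of S (run u)"
    using run_nth(3)[of u] by (auto simp: lists_of_def in_set_conv_nth)
qed

text \<open>As run and zeros do not fill the word, another block begins inside it. The zeros are
  then a complete gap, to which the rule applies.\<close>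

lemma coloured_gap:
  assumes S: "S = green \<nu> \<or> S = yellow \<nu>" and s: "selects n U pt" and u: "u \<in> U" and hd: "u \<noteq> []" "hd u \<in> S"
  defines "a \<equiv> run u" and "b \<equiv> zeros (drop (run u) u)"
  assumes nt: "a + b < n"
  shows "\<tau> * real a \<le> real b" "u ! (a + b) \<in> (green \<nu> \<union> yellow \<nu>) - S" "take (a + b) u = take a u @ replicate b 0"
proof -
  have x: "pt u \<in> \<Sigma>" and len: "length u = n" using selectsD[OF s u] by auto
  have a1: "a \<ge> 1" unfolding a_def by (rule coloured_prefix[OF S s u hd])
  have h: "u ! 0 \<in> S" using hd by (simp add: hd_conv_nth)
  have ua: "u ! a = 0" using run_nth(2)[of u] nt len by (simp add: a_def)
  have z: "u ! (a + i) = 0" if "i < b" for i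
    using zeros_nth(1)[of i "drop a u"] that nt len unfolding a_def b_def by simp
  have ze: "u ! (a + b) \<noteq> 0"
    using zeros_nth(2)[of "drop a u"] nt len unfolding a_def b_def by simp
  have b1: "b \<ge> 1" using ua ze by (cases b) auto
  have val: "pt u (int i) = u ! i" if "i < n" for i using selectsD(4)[OF s u that] .
  have sep: "(pt u 0 \<in> green \<nu> \<and> pt u (int (a + b)) \<in> yellow \<nu> \<or> pt u 0 \<in> yellow \<nu> \<and> pt u (int (a + b)) \<in> green \<nu>) \<and>
     \<tau> * real_of_int (int a - 0) \<le> real_of_int (int (a + b) - int a)"
  proof (rule coloured_runs_separated[OF x \<tau>])
    show "0 < int a" "int a < int (a + b)" using a1 b1 by auto
    show "pt u i \<noteq> 0" if "i \<in> {0..<int a}" for i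
      using val[of "nat i"] run_nth(1)[of "nat i" u] that nt by (auto simp: a_def)
    show "pt u i = 0" if i: "i \<in> {int a..<int (a + b)}" for i
    proof -
      define j where "j = nat (i - int a)"
      have j: "i = int (a + j)" "j < b" using i by (auto simp: j_def)
      show ?thesis unfolding j(1) using val[of "a + j"] z[OF j(2)] j(2) nt by simp
    qed
    show "pt u (int (a + b)) \<noteq> 0" using val[OF nt] ze by simp
  qed
  then show "\<tau> * real a \<le> real b" by simp
  have "pt u 0 \<in> S" using val[of 0] nt h by simp
  then show "u ! (a + b) \<in> (green \<nu> \<union> yellow \<nu>) - S"
    using sep S green_yellow_disjoint[of \<nu>] unfolding val[OF nt] by blast
  show "take (a + b) u = take a u @ replicate b 0"
  proof (rule nth_equalityI)
    fix i assume "i < length (take (a + b) u)"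
    then show "take (a + b) u ! i = (take a u @ replicate b 0) ! i"
      using z[of "i - a"] len nt by (auto simp: nth_append)
  qed (use len nt in auto)
qed

text \<open>The shortest gap weighs at most e^{-rate t}, and every further zero at least halves the
  weight, whence the factor 2.\<close>

lemma gap_sum:
  assumes "\<And>l. l \<in> \<Lambda> \<Longrightarrow> t \<le> real l" "finite \<Lambda>"
  shows "(\<Sum>l\<in>\<Lambda>. exp (- rate * real l)) \<le> 2 * exp (- rate * t)"
proof -
  have "0 \<le> ln (2 :: real)" by simp
  then have rate0: "rate \<ge> 0" using gap_entropy unfolding rate_def by linarith
  define k where "k = nat \<lceil>t\<rceil>"
  have k: "k \<le> l" if "l \<in> \<Lambda>" for l using assms(1)[OF that] by (simp add: k_def ceiling_le_iff nat_le_iff)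
  have kt: "t \<le> real k" by (simp add: k_def real_nat_ceiling_ge)
  obtain N where N: "\<And>l. l \<in> \<Lambda> \<Longrightarrow> l < N" using finite_nat_set_iff_bounded[THEN iffD1, OF assms(2)] by blast
  have "(\<Sum>l\<in>\<Lambda>. exp (- rate * real l)) \<le> (\<Sum>l\<in>\<Lambda>. exp (- rate * t) * (1/2) ^ (l - k))"
  proof (rule sum_mono)
    fix l assume l: "l \<in> \<Lambda>"
    have "exp (- rate * real l) = exp (- rate * real k) * exp (- rate * real (l - k))"
      using k[OF l] by (simp add: exp_add[symmetric] of_nat_diff algebra_simps)
    also have "\<dots> \<le> exp (- rate * t) * (1/2) ^ (l - k)"
    proof (rule mult_mono[OF _ exp_rate_le])
      show "exp (- rate * real k) \<le> exp (- rate * t)" using mult_left_mono[OF kt rate0] by simp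
    qed simp_all
    finally show "exp (- rate * real l) \<le> exp (- rate * t) * (1/2) ^ (l - k)" .
  qed
  also have "\<dots> = exp (- rate * t) * (\<Sum>l\<in>\<Lambda>. (1/2) ^ (l - k))" by (simp add: sum_distrib_left)
  also have "(\<Sum>l\<in>\<Lambda>. (1/2 :: real) ^ (l - k)) = (\<Sum>j\<in>(\<lambda>l. l - k) ` \<Lambda>. (1/2) ^ j)"
  proof -
    have "inj_on (\<lambda>l. l - k) \<Lambda>" using k eq_diff_iff by (intro inj_onI) blast
    then show ?thesis by (simp add: sum.reindex)
  qed
  also have "\<dots> \<le> (\<Sum>j<N. (1/2) ^ j)"
    by (rule sum_mono2) (auto dest!: N)
  also have "\<dots> \<le> 2" by (rule sum_half_powers)
  finally show ?thesis by (simp add: mult_left_mono mult.commute)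
qed

text \<open>The hypothesis on \<tau> says that \<nu> e^{-(1 + \<tau>) rate} is at most 1/3; this is
  its power a.\<close>

lemma run_gap_weight: "real \<nu> ^ a * exp (- rate * real a) * exp (- rate * (\<tau> * real a)) \<le> (1/3) ^ a"
proof -
  have "exp (- rate * real a) * exp (- rate * (\<tau> * real a)) = exp (- ((1 + \<tau>) * rate)) ^ a"
    by (simp add: exp_add[symmetric] exp_of_nat_mult[symmetric] algebra_simps)
  also have "\<dots> \<le> exp (- ln (3 * real \<nu>)) ^ a"
    using \<tau>_large by (intro power_mono) (auto simp: rate_def)
  also have "\<dots> = (1 / (3 * real \<nu>)) ^ a" using \<nu> by (simp add: exp_minus inverse_eq_divide)
  finally have "real \<nu> ^ a * (exp (- rate * real a) * exp (- rate * (\<tau> * real a))) \<le> real \<nu> ^ a * (1 / (3 * real \<nu>)) ^ a"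
    by (rule mult_left_mono) simp
  also have "\<dots> = (1/3) ^ a" using \<nu> by (simp add: power_mult_distrib[symmetric])
  finally show ?thesis by (simp add: mult.assoc)
qed

lemma card_colour: "S = green \<nu> \<or> S = yellow \<nu> \<Longrightarrow> finite S \<and> card S = \<nu>"
  by (auto simp: green_def yellow_def)

text \<open>Twice the geometric series of 1/3, from its first power on, is exactly 1; this is the
  origin of the number 3 in the hypothesis on \<tau>.\<close>

lemma block_gap_sum:
  assumes S: "S = green \<nu> \<or> S = yellow \<nu>"
  shows "(\<Sum>(a, B, l)\<in>(SIGMA a:{1..n}. lists_of S a \<times> {l. l < n \<and> \<tau> * real a \<le> real l}). exp (- rate * real (a + l))) \<le> 1"
proof -
  let ?L = "\<lambda>a. {l. l < n \<and> \<tau> * real a \<le> real l}"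
  have "(\<Sum>(a, B, l)\<in>(SIGMA a:{1..n}. lists_of S a \<times> ?L a). exp (- rate * real (a + l)))
     = (\<Sum>a=1..n. \<Sum>(B, l)\<in>lists_of S a \<times> ?L a. exp (- rate * real (a + l)))"
    by (rule sum.Sigma[symmetric]) (use card_colour[OF S] in auto)
  also have "\<dots> = (\<Sum>a=1..n. real \<nu> ^ a * exp (- rate * real a) * (\<Sum>l\<in>?L a. exp (- rate * real l)))"
  proof (rule sum.cong[OF refl])
    fix a
    have "card (lists_of S a) = \<nu> ^ a" unfolding lists_of_def using card_colour[OF S] by (simp add: card_lists_length_eq)
    moreover have "(\<Sum>(B, l)\<in>lists_of S a \<times> ?L a. exp (- rate * real (a + l))) = (\<Sum>B\<in>lists_of S a. \<Sum>l\<in>?L a. exp (- rate * real (a + l)))"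
      by (rule sum.cartesian_product[symmetric])
    moreover have "exp (- rate * real (a + l)) = exp (- rate * real a) * exp (- rate * real l)" for l
      by (simp add: exp_add[symmetric] algebra_simps)
    ultimately show "(\<Sum>(B, l)\<in>lists_of S a \<times> ?L a. exp (- rate * real (a + l))) = real \<nu> ^ a * exp (- rate * real a) * (\<Sum>l\<in>?L a. exp (- rate * real l))"
      by (simp add: sum_distrib_left[symmetric])
  qed
  also have "\<dots> \<le> (\<Sum>a=1..n. 2 * (1/3) ^ a)"
  proof (rule sum_mono)
    fix a
    have "real \<nu> ^ a * exp (- rate * real a) * (\<Sum>l\<in>?L a. exp (- rate * real l))
       \<le> real \<nu> ^ a * exp (- rate * real a) * (2 * exp (- rate * (\<tau> * real a)))"
      by (intro mult_left_mono gap_sum) auto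
    also have "\<dots> \<le> 2 * (1/3) ^ a" using run_gap_weight[of a] by simp
    finally show "real \<nu> ^ a * exp (- rate * real a) * (\<Sum>l\<in>?L a. exp (- rate * real l)) \<le> 2 * (1/3) ^ a" .
  qed
  also have "\<dots> \<le> 1"
  proof -
    have "(\<Sum>a=1..n. 2 * (1/3 :: real) ^ a) = 1 - (1/3) ^ n" by (induction n) (auto simp: field_simps)
    then show ?thesis by simp
  qed
  finally show ?thesis .
qed

text \<open>These are the words in which no second block begins. Their trailing zeros obey no lower
  bound, because the next block lies outside if there is one; but \<open>z\<close> of them weigh at
  most 2^{-z}, so summing over \<open>z\<close> only doubles \<open>D\<close>.\<close>

lemma terminal_sum:
  assumes S: "S = green \<nu> \<or> S = yellow \<nu>" and s: "selects n U pt"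
    and hd: "\<And>u. u \<in> U \<Longrightarrow> u \<noteq> [] \<and> hd u \<in> S" and t: "\<And>u. u \<in> U \<Longrightarrow> run u + zeros (drop (run u) u) = n"
  shows "(\<Sum>u\<in>U. E n (pt u)) \<le> 2 * D"
proof -
  let ?z = "\<lambda>u. zeros (drop (run u) u)"
  have fin: "finite U" by (rule selects_finite[OF s])
  have zn: "?z u < n" if "u \<in> U" for u
    using coloured_prefix(1)[OF S s that] hd[OF that] t[OF that] by simp
  have "(\<Sum>u\<in>U. E n (pt u)) = (\<Sum>z\<in>?z ` U. \<Sum>u\<in>{u\<in>U. ?z u = z}. E n (pt u))"
    by (rule sum.image_gen[OF fin])
  also have "\<dots> \<le> (\<Sum>z\<in>?z ` U. D * (1/2) ^ z)"
  proof (rule sum_mono)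
    fix z assume "z \<in> ?z ` U"
    then have z: "z < n" using zn by auto
    let ?V = "{u\<in>U. ?z u = z}"
    have run: "run u = n - z" if "u \<in> ?V" for u using t[of u] that by auto
    have u: "take (n - z) u @ replicate z 0 = u" if "u \<in> ?V" for u
    proof (rule nth_equalityI)
      have len: "length u = n" using selectsD(3)[OF s] that by auto
      then show "length (take (n - z) u @ replicate z 0) = length u" using z by simp
      fix i assume "i < length (take (n - z) u @ replicate z 0)"
      then show "(take (n - z) u @ replicate z 0) ! i = u ! i"
        using zeros_nth(1)[of "i - (n - z)" "drop (n - z) u"] run[OF that] that len z by (auto simp: nth_append)
    qed
    \<comment> \<open>The shortened word determines the original one, whose chosen point is
      kept.\<close>
    define pt' where "pt' v = pt (v @ replicate z 0)" for v
    have inj: "inj_on (take (n - z)) ?V" using u by (metis (no_types, lifting) inj_onI)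
    have "(\<Sum>u\<in>?V. E n (pt u)) \<le> (\<Sum>u\<in>?V. exp (- rate * real z) * E (n - z) (pt' (take (n - z) u)))"
    proof (rule sum_mono)
      fix v assume v: "v \<in> ?V"
      then have "pt v \<in> \<Sigma>" using selectsD(1)[OF s] by auto
      then show "E n (pt v) \<le> exp (- rate * real z) * E (n - z) (pt' (take (n - z) v))"
        using E_split_right[of "pt v" z n] z u[OF v] by (simp add: pt'_def)
    qed
    also have "\<dots> = exp (- rate * real z) * (\<Sum>v\<in>take (n - z) ` ?V. E (n - z) (pt' v))"
      by (simp add: sum.reindex[OF inj] sum_distrib_left)
    also have "\<dots> \<le> (1/2) ^ z * D"
    proof (rule mult_mono[OF exp_rate_le])
      show "(\<Sum>v\<in>take (n - z) ` ?V. E (n - z) (pt' v)) \<le> D"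
      proof (rule monochromatic[OF S])
        show "take (n - z) ` ?V \<subseteq> lists_of S (n - z)"
        proof
          fix v assume "v \<in> take (n - z) ` ?V"
          then obtain y where y: "y \<in> ?V" "v = take (n - z) y" by blast
          then show "v \<in> lists_of S (n - z)"
            using coloured_prefix(2)[OF S s, of y] hd[of y] run[OF y(1)] by auto
        qed
        fix v assume "v \<in> take (n - z) ` ?V"
        then obtain y where y: "y \<in> ?V" "v = take (n - z) y" by blast
        have "pt' v = pt y" using u[OF y(1)] y(2) by (simp add: pt'_def)
        moreover have "window 0 (n - z) (pt y) = v"
          using selectsD(3,4)[OF s, of y] y z by (intro nth_equalityI) auto
        ultimately show "pt' v \<in> \<Sigma> \<and> window 0 (n - z) (pt' v) = v"
          using selectsD(1)[OF s, of y] y(1) by auto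
      qed
    qed (auto intro: sum_nonneg E_nonneg)
    finally show "(\<Sum>u\<in>?V. E n (pt u)) \<le> D * (1/2) ^ z" by (simp add: mult.commute)
  qed
  also have "\<dots> \<le> (\<Sum>z<n. D * (1/2) ^ z)"
    by (rule sum_mono2) (use zn D in auto)
  also have "\<dots> \<le> 2 * D" using mult_left_mono[OF sum_half_powers[of n] D] by (simp add: sum_distrib_left mult.commute)
  finally show ?thesis .
qed

text \<open>Words in which no second block begins contribute \<open>2 * D\<close>. The others lose
  their first block and gap, of total weight at most 1, and leave shorter words that begin with the
  other colour. So a step of the induction adds \<open>2 * D\<close> instead of multiplying by a
  constant.\<close>

lemma coloured_sum:
  assumes "S = green \<nu> \<or> S = yellow \<nu>" and "selects n U pt"
    and "\<And>u. u \<in> U \<Longrightarrow> u \<noteq> [] \<and> hd u \<in> S"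
  shows "(\<Sum>u\<in>U. E n (pt u)) \<le> 2 * D * real n"
  using assms
proof (induction n arbitrary: S U pt rule: less_induct)
  case (less n S U pt)
  note S = less.prems(1) and s = less.prems(2) and hd = less.prems(3)
  show ?case
  proof (cases "U = {}")
    case True
    then show ?thesis using D by simp
  next
    case False
    let ?a = run and ?b = "\<lambda>u. zeros (drop (run u) u)"
    have fin: "finite U" by (rule selects_finite[OF s])
    have n1: "n \<ge> 1" using False hd selectsD(3)[OF s] by (metis Suc_leI One_nat_def ex_in_conv length_greater_0_conv)
    have ab: "?a u + ?b u \<le> n" if "u \<in> U" for u
      using zeros_nth(3)[of "drop (run u) u"] run_nth(3)[of u] selectsD(3)[OF s that] by simp
    define V where "V = {u\<in>U. ?a u + ?b u = n}"
    define W where "W = {u\<in>U. ?a u + ?b u < n}"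
    have UV: "U = V \<union> W" "V \<inter> W = {}" using ab by (auto simp: V_def W_def le_less)
    have finW: "finite W" "finite V" using fin by (auto simp: V_def W_def)
    have 1: "(\<Sum>u\<in>V. E n (pt u)) \<le> 2 * D"
      by (rule terminal_sum[OF S selects_subset[OF s]]) (use hd in \<open>auto simp: V_def\<close>)
    \<comment> \<open>Words with the same key share the prefix to be removed, so each fibre is
      stripped as a whole.\<close>
    define key where "key u = (?a u, take (?a u) u, ?b u)" for u
    let ?K = "SIGMA a:{1..n}. lists_of S a \<times> {l. l < n \<and> \<tau> * real a \<le> real l}"
    have sW: "selects n W pt" by (rule selects_subset[OF s]) (auto simp: W_def)
    have hdW: "u \<noteq> []" "hd u \<in> S" if "u \<in> W" for u using hd[of u] that by (auto simp: W_def)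
    have keyK: "key u \<in> ?K" if u: "u \<in> W" for u
      using coloured_prefix[OF S sW u hdW[OF u]] coloured_gap(1)[OF S sW u hdW[OF u]] u
      by (auto simp: key_def W_def)
    have "(\<Sum>u\<in>W. E n (pt u)) = (\<Sum>k\<in>key ` W. \<Sum>u\<in>{u\<in>W. key u = k}. E n (pt u))"
      by (rule sum.image_gen[OF finW(1)])
    also have "\<dots> \<le> (\<Sum>(a, B, l)\<in>key ` W. exp (- rate * real (a + l)) * (2 * D * real (n - 1)))"
    proof (rule sum_mono)
      fix k assume kW: "k \<in> key ` W"
      obtain a B l where k: "k = (a, B, l)" by (cases k)
      have al: "a \<ge> 1" "a + l < n" using kW keyK unfolding k by (auto simp: key_def W_def)
      let ?V = "{u\<in>W. key u = k}"
      have V: "u \<in> W \<and> run u = a \<and> take a u = B \<and> zeros (drop (run u) u) = l" if "u \<in> ?V" for u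
        using that by (auto simp: key_def k)
      have sV: "selects n ?V pt" by (rule selects_subset[OF sW]) auto
      have pre: "take (a + l) u = B @ replicate l 0" if u: "u \<in> ?V" for u
      proof -
        have r: "u \<in> W" "run u = a" "take a u = B" "zeros (drop a u) = l" using V[OF u] by auto
        show ?thesis using coloured_gap(3)[OF S sW r(1) hdW[OF r(1)]] r al by simp
      qed
      define S' where "S' = (green \<nu> \<union> yellow \<nu>) - S"
      have S': "S' = green \<nu> \<or> S' = yellow \<nu>" using S green_yellow_disjoint[of \<nu>] by (auto simp: S'_def)
      note strip = strip_prefix[OF sV pre less_imp_le[OF al(2)]]
      have "(\<Sum>v\<in>drop (a + l) ` ?V. E (n - (a + l)) ((shift ^^ (a + l)) (pt ((B @ replicate l 0) @ v)))) \<le> 2 * D * real (n - (a + l))"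
      proof (rule less.IH[OF _ S' strip(1)])
        show "n - (a + l) < n" using al n1 by simp
        fix v assume "v \<in> drop (a + l) ` ?V"
        then obtain y where y: "y \<in> ?V" "v = drop (a + l) y" by blast
        have len: "length y = n" using selectsD(3)[OF sV y(1)] .
        have "y ! (a + l) \<in> S'"
        proof -
          have r: "y \<in> W" "run y = a" "zeros (drop a y) = l" using V[OF y(1)] by auto
          show ?thesis unfolding S'_def using coloured_gap(2)[OF S sW r(1) hdW[OF r(1)]] r al by simp
        qed
        then show "v \<noteq> [] \<and> hd v \<in> S'" using y(2) len al by (simp add: hd_drop_conv_nth)
      qed simp_all
      also have "\<dots> \<le> 2 * D * real (n - 1)" using D al by (intro mult_left_mono) auto
      finally have "(\<Sum>u\<in>?V. E n (pt u)) \<le> exp (- rate * real (a + l)) * (2 * D * real (n - 1))"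
        using strip(2) by (meson exp_ge_zero mult_left_mono order_trans)
      then show "(\<Sum>u\<in>?V. E n (pt u)) \<le> (case k of (a, B, l) \<Rightarrow> exp (- rate * real (a + l)) * (2 * D * real (n - 1)))"
        by (simp add: k)
    qed
    also have "\<dots> \<le> (\<Sum>(a, B, l)\<in>?K. exp (- rate * real (a + l)) * (2 * D * real (n - 1)))"
    proof (rule sum_mono2)
      show "finite ?K" using card_colour[OF S] by auto
      show "key ` W \<subseteq> ?K" using keyK by blast
    qed (use D in auto)
    also have "\<dots> = (\<Sum>(a, B, l)\<in>?K. exp (- rate * real (a + l))) * (2 * D * real (n - 1))"
      by (simp add: sum_distrib_right split_beta)
    also have "\<dots> \<le> 1 * (2 * D * real (n - 1))"
      by (rule mult_right_mono[OF block_gap_sum[OF S]]) (use D in auto)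
    finally have 2: "(\<Sum>u\<in>W. E n (pt u)) \<le> 2 * D * real (n - 1)" by simp
    have "(\<Sum>u\<in>U. E n (pt u)) = (\<Sum>u\<in>V. E n (pt u)) + (\<Sum>u\<in>W. E n (pt u))"
      unfolding UV(1) by (rule sum.union_disjoint[OF finW(2,1) UV(2)])
    also have "\<dots> \<le> 2 * D * real n" using 1 2 n1 by (simp add: of_nat_diff algebra_simps)
    finally show ?thesis .
  qed
qed

text \<open>Summing over the number of leading zeros costs a factor 2, the two colours of the first
  coloured symbol another 2. The 1 is for the word of zeros.\<close>

lemma all_words_sum:
  assumes s: "selects n U pt"
  shows "(\<Sum>u\<in>U. E n (pt u)) \<le> 1 + 8 * D * real n"
proof -
  have fin: "finite U" by (rule selects_finite[OF s])
  define V where "V = {u\<in>U. zeros u = n}"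
  define W where "W = {u\<in>U. zeros u < n}"
  have UV: "U = V \<union> W" "V \<inter> W = {}" using zeros_nth(3) selectsD(3)[OF s] by (auto simp: V_def W_def le_less)
  have finW: "finite W" "finite V" using fin by (auto simp: V_def W_def)
  have "V \<subseteq> {replicate n 0}"
  proof
    fix u assume "u \<in> V"
    then have "length u = n" "zeros u = n" using selectsD(3)[OF s] by (auto simp: V_def)
    then show "u \<in> {replicate n 0}" using zeros_nth(1)[of _ u] by (auto intro!: nth_equalityI)
  qed
  moreover have "E n (pt u) \<le> 1" if "u \<in> U" for u
  proof -
    have "E n (pt u) \<le> exp (- rate * real n) * E 0 ((shift ^^ n) (pt u))"
      using E_split_left[OF selectsD(1)[OF s that], of n n] by simp
    also have "\<dots> = exp (- rate * real n)" by (simp add: normalized_weight_def birkhoff_sum_def)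
    also have "\<dots> \<le> (1/2) ^ n" by (rule exp_rate_le)
    also have "\<dots> \<le> 1" by (simp add: power_le_one)
    finally show ?thesis .
  qed
  ultimately have 1: "(\<Sum>u\<in>V. E n (pt u)) \<le> 1"
  proof -
    assume V: "V \<subseteq> {replicate n 0}" and E: "\<And>u. u \<in> U \<Longrightarrow> E n (pt u) \<le> 1"
    show ?thesis
    proof (cases "V = {}")
      case False
      then have "V = {replicate n 0}" using V by blast
      then show ?thesis using E[of "replicate n 0"] by (auto simp: V_def)
    qed simp
  qed
  have sW: "selects n W pt" by (rule selects_subset[OF s]) (auto simp: W_def)
  have "(\<Sum>u\<in>W. E n (pt u)) = (\<Sum>z\<in>zeros ` W. \<Sum>u\<in>{u\<in>W. zeros u = z}. E n (pt u))"
    by (rule sum.image_gen[OF finW(1)])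
  also have "\<dots> \<le> (\<Sum>z\<in>zeros ` W. (1/2) ^ z * (4 * D * real n))"
  proof (rule sum_mono)
    fix z assume "z \<in> zeros ` W"
    then have z: "z < n" by (auto simp: W_def)
    let ?V = "{u\<in>W. zeros u = z}"
    have sV: "selects n ?V pt" by (rule selects_subset[OF sW]) auto
    have pre: "take z u = replicate z 0" if u: "u \<in> ?V" for u
    proof (rule nth_equalityI)
      show "length (take z u) = length (replicate z 0)" using selectsD(3)[OF sV u] z by simp
      fix i assume "i < length (take z u)"
      then show "take z u ! i = replicate z 0 ! i" using zeros_nth(1)[of i u] u by auto
    qed
    note strip = strip_prefix[OF sV pre less_imp_le[OF z]]
    let ?pt = "\<lambda>v. (shift ^^ z) (pt (replicate z 0 @ v))"
    let ?U = "\<lambda>S. {v\<in>drop z ` ?V. v \<noteq> [] \<and> hd v \<in> S}"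
    have col: "(\<Sum>v\<in>?U S. E (n - z) (?pt v)) \<le> 2 * D * real n" if S: "S = green \<nu> \<or> S = yellow \<nu>" for S
    proof -
      have "(\<Sum>v\<in>?U S. E (n - z) (?pt v)) \<le> 2 * D * real (n - z)"
        by (rule coloured_sum[OF S selects_subset[OF strip(1)]]) auto
      also have "\<dots> \<le> 2 * D * real n" using D by (intro mult_left_mono) auto
      finally show ?thesis .
    qed
    have "drop z ` ?V \<subseteq> ?U (green \<nu>) \<union> ?U (yellow \<nu>)"
    proof
      fix v assume v: "v \<in> drop z ` ?V"
      then obtain y where y: "y \<in> ?V" "v = drop z y" by blast
      have len: "length y = n" using selectsD(3)[OF sV y(1)] .
      have "y ! z \<noteq> 0" using zeros_nth(2)[of y] y len z by auto
      then have "pt y (int z) \<noteq> 0" using selectsD(4)[OF sV y(1) z] by simp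
      then have "y ! z \<in> green \<nu> \<union> yellow \<nu>"
        using coloured_iff[OF selectsD(1)[OF sV y(1)], of "int z"] selectsD(4)[OF sV y(1) z] by simp
      then have "v \<noteq> [] \<and> hd v \<in> green \<nu> \<union> yellow \<nu>" using y(2) len z by (simp add: hd_drop_conv_nth)
      then show "v \<in> ?U (green \<nu>) \<union> ?U (yellow \<nu>)" using v by blast
    qed
    then have "(\<Sum>v\<in>drop z ` ?V. E (n - z) (?pt v)) \<le> (\<Sum>v\<in>?U (green \<nu>) \<union> ?U (yellow \<nu>). E (n - z) (?pt v))"
      using finW(1) by (intro sum_mono2) (auto intro: E_nonneg)
    also have "\<dots> \<le> (\<Sum>v\<in>?U (green \<nu>). E (n - z) (?pt v)) + (\<Sum>v\<in>?U (yellow \<nu>). E (n - z) (?pt v))"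
    proof -
      have "(\<Sum>v\<in>?U (green \<nu>). E (n - z) (?pt v)) + (\<Sum>v\<in>?U (yellow \<nu>). E (n - z) (?pt v)) =
        (\<Sum>v\<in>?U (green \<nu>) \<union> ?U (yellow \<nu>). E (n - z) (?pt v)) + (\<Sum>v\<in>?U (green \<nu>) \<inter> ?U (yellow \<nu>). E (n - z) (?pt v))"
        using finW(1) by (intro sum.union_inter[symmetric]) auto
      moreover have "0 \<le> (\<Sum>v\<in>?U (green \<nu>) \<inter> ?U (yellow \<nu>). E (n - z) (?pt v))" by (intro sum_nonneg E_nonneg)
      ultimately show ?thesis by linarith
    qed
    also have "\<dots> \<le> 4 * D * real n" using col[of "green \<nu>"] col[of "yellow \<nu>"] by simp
    finally have "exp (- rate * real z) * (\<Sum>v\<in>drop z ` ?V. E (n - z) (?pt v)) \<le> (1/2) ^ z * (4 * D * real n)"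
      by (intro mult_mono exp_rate_le) (auto intro: sum_nonneg E_nonneg)
    then show "(\<Sum>u\<in>?V. E n (pt u)) \<le> (1/2) ^ z * (4 * D * real n)" using strip(2) by linarith
  qed
  also have "\<dots> \<le> (\<Sum>z<n. (1/2) ^ z * (4 * D * real n))"
    by (rule sum_mono2) (use D in \<open>auto simp: W_def\<close>)
  also have "\<dots> = (\<Sum>z<n. (1/2) ^ z) * (4 * D * real n)" by (simp add: sum_distrib_right)
  also have "\<dots> \<le> 2 * (4 * D * real n)" by (rule mult_right_mono[OF sum_half_powers]) (use D in auto)
  finally have 2: "(\<Sum>u\<in>W. E n (pt u)) \<le> 8 * D * real n" by simp
  have "(\<Sum>u\<in>U. E n (pt u)) = (\<Sum>u\<in>V. E n (pt u)) + (\<Sum>u\<in>W. E n (pt u))"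
    unfolding UV(1) by (rule sum.union_disjoint[OF finW(2,1) UV(2)])
  then show ?thesis using 1 2 by simp
qed

end

section \<open>Pressures and the theorem\<close>

text \<open>A word may occur anywhere, while its cylinder asks for it at coordinate 0. Translation
  invariance makes the cylinder nonempty, so that \<open>SOME\<close> picks a genuine point.\<close>

lemma some_in_cylinder:
  assumes X: "\<And>x k. x \<in> X \<Longrightarrow> (\<lambda>i. x (i + k)) \<in> X" and \<alpha>: "\<alpha> \<in> words X n"
  shows "(SOME x. x \<in> cylinder X \<alpha>) \<in> X" "window 0 n (SOME x. x \<in> cylinder X \<alpha>) = \<alpha>"
proof -
  obtain x k where x: "length \<alpha> = n" "x \<in> X" "\<And>i. i < n \<Longrightarrow> x (k + int i) = \<alpha> ! i" using \<alpha> by (auto simp: words_def)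
  have "x (int i + k) = \<alpha> ! i" if "i < n" for i using x(3)[OF that] by (simp add: add.commute)
  then have "(\<lambda>i. x (i + k)) \<in> cylinder X \<alpha>" using X[OF x(2)] x(1) by (simp add: cylinder_def)
  then have c: "(SOME x. x \<in> cylinder X \<alpha>) \<in> cylinder X \<alpha>" by (rule someI[of "\<lambda>x. x \<in> cylinder X \<alpha>"])
  show "(SOME x. x \<in> cylinder X \<alpha>) \<in> X" using c by (simp add: cylinder_def)
  show "window 0 n (SOME x. x \<in> cylinder X \<alpha>) = \<alpha>"
    using c x(1) by (intro nth_equalityI) (auto simp: cylinder_def)
qed

lemma translate_full_shift: "x \<in> full_shift S \<Longrightarrow> (\<lambda>i. x (i + k)) \<in> full_shift S"
  by (simp add: full_shift_def)

text \<open>Renaming symbols preserves Birkhoff sums. With \<open>c = 0\<close> this passes from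
  \<open>f\<close> to \<open>g\<close> on the green shift, with \<open>c = \<nu>\<close> to
  \<open>g\<close> on the yellow one, so both have the pressure of \<open>f\<close>.\<close>

lemma (in holder_potential) pressure_recoded:
  assumes A: "S = (\<lambda>a. a + c) ` A" and f: "\<And>x. x \<in> full_shift A \<Longrightarrow> \<phi> (\<lambda>i. x i + c) = f x"
  shows "pressure (full_shift A) f = pressure (full_shift S) \<phi>"
proof -
  have wA: "words (full_shift A) n = lists_of A n" for n
    using A symbols_nonempty by (intro words_full_shift) auto
  have bs: "birkhoff_sum \<phi> n (\<lambda>i. x i + c) = birkhoff_sum f n x" if x: "x \<in> full_shift A" for n x
    unfolding birkhoff_sum_def
  proof (rule sum.cong[OF refl])
    fix k
    have "\<phi> (\<lambda>i. (shift ^^ k) x i + c) = f ((shift ^^ k) x)" by (rule f[OF funpow_shift_full_shift[OF x]])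
    then show "\<phi> ((shift ^^ k) (\<lambda>i. x i + c)) = f ((shift ^^ k) x)" by (simp add: funpow_shift)
  qed
  define p where "p w = (SOME x. x \<in> cylinder (full_shift A) w)" for w
  have p: "p w \<in> full_shift A \<and> window 0 n (p w) = w" if "w \<in> lists_of A n" for w n
    using some_in_cylinder[of "full_shift A" w n] that translate_full_shift wA by (simp add: p_def)
  have pf: "\<bar>ln (partition_function (full_shift A) f n) - ln (Z n)\<bar> \<le> \<kappa>" for n
  proof -
    \<comment> \<open>The point chosen for the word over \<open>A\<close>, renamed. Symbols of
      \<open>S\<close> are at least \<open>c\<close>, so the subtraction of naturals is exact on
      words over \<open>S\<close>.\<close>
    define q where "q v = (\<lambda>i. p (map (\<lambda>b. b - c) v) i + c)" for v
    have "partition_function (full_shift A) f n = (\<Sum>w\<in>lists_of A n. exp (birkhoff_sum f n (p w)))"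
      by (simp add: partition_function_def wA p_def)
    also have "\<dots> = (\<Sum>v\<in>lists_of S n. exp (birkhoff_sum \<phi> n (q v)))"
    proof (rule sum.reindex_bij_witness[of _ "map (\<lambda>b. b - c)" "map (\<lambda>a. a + c)"])
      fix w assume w: "w \<in> lists_of A n"
      show "map (\<lambda>b. b - c) (map (\<lambda>a. a + c) w) = w" by (simp add: o_def)
      then show "exp (birkhoff_sum \<phi> n (q (map (\<lambda>a. a + c) w))) = exp (birkhoff_sum f n (p w))"
        using bs p[OF w] by (simp add: q_def)
      show "map (\<lambda>a. a + c) w \<in> lists_of S n" using w by (auto simp: lists_of_def A)
    next
      fix v assume v: "v \<in> lists_of S n"
      then have "set v \<subseteq> (\<lambda>a. a + c) ` A" by (simp add: lists_of_def A)
      then show "map (\<lambda>a. a + c) (map (\<lambda>b. b - c) v) = v" "map (\<lambda>b. b - c) v \<in> lists_of A n"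
        using v by (auto simp: lists_of_def intro!: map_idI)
    qed
    finally have eq: "partition_function (full_shift A) f n = (\<Sum>v\<in>lists_of S n. exp (birkhoff_sum \<phi> n (q v)))" .
    show ?thesis unfolding eq
    proof (rule ln_partition_function)
      fix v assume v: "v \<in> lists_of S n"
      then have sv: "set v \<subseteq> (\<lambda>a. a + c) ` A" "length v = n" by (auto simp: lists_of_def A)
      then have v': "map (\<lambda>b. b - c) v \<in> lists_of A n" by (auto simp: lists_of_def)
      show "\<bar>birkhoff_sum \<phi> n (q v) - birkhoff_sum \<phi> n (ext v)\<bar> \<le> \<kappa>"
      proof (rule birkhoff_sum_distortion)
        show "q v \<in> full_shift S" using p[OF v'] by (auto simp: q_def full_shift_def A)
        show "ext v \<in> full_shift S" using v by (intro ext_in) (simp add: lists_of_def)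
        fix i assume i: "i < n"
        have "p (map (\<lambda>b. b - c) v) (int i) = v ! i - c"
          using arg_cong[OF conjunct2[OF p[OF v']], of "\<lambda>w. w ! i"] i sv(2) by simp
        moreover have "v ! i \<in> (\<lambda>a. a + c) ` A" using sv i by (auto simp: subset_iff)
        ultimately show "q v (int i) = ext v (int i)" using i sv(2) by (auto simp: q_def ext_nth)
      qed
    qed
  qed
  show ?thesis
  proof (rule pressure_eqI)
    let ?P = "pressure (full_shift S) \<phi>"
    show "real n * ?P - 3 * \<kappa> \<le> ln (partition_function (full_shift A) f n)"
      "ln (partition_function (full_shift A) f n) \<le> real n * ?P + 3 * \<kappa>" for n
      using ln_Z_pressure[of n] pf[of n] by auto
    show "(\<lambda>n. 3 * \<kappa> / real n) \<longlonglongrightarrow> 0"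
      by (rule tendsto_divide_0[OF tendsto_const filterlim_real_at_infinity_sequentially])
  qed
qed

text \<open>One \<kappa> replaces the chosen points by \<open>ext u\<close>, even where they leave
  the colour outside the word; \<open>2 * \<kappa>\<close> more compares \<open>ln (Z n)\<close>
  with \<open>n\<close> times the pressure.\<close>

lemma (in holder_potential) monochromatic_words_sum:
  assumes ext: "is_extension \<nu> \<tau> f \<phi>" and S: "S = green \<nu> \<or> S = yellow \<nu>"
    and U: "U \<subseteq> lists_of S n" and pt: "\<And>u. u \<in> U \<Longrightarrow> pt u \<in> two_coloured_shift \<nu> \<tau> \<and> window 0 n (pt u) = u"
  shows "(\<Sum>u\<in>U. normalized_weight \<phi> (pressure (full_shift S) \<phi>) n (pt u)) \<le> exp (3 * \<kappa>)"
proof -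
  let ?P = "pressure (full_shift S) \<phi>"
  have "(\<Sum>u\<in>U. normalized_weight \<phi> ?P n (pt u)) \<le> (\<Sum>u\<in>U. exp (\<kappa> - real n * ?P) * weight u)"
  proof (rule sum_mono)
    fix u assume u: "u \<in> U"
    then have l: "set u \<subseteq> S" "length u = n" using U by (auto simp: lists_of_def)
    have "\<bar>birkhoff_sum \<phi> n (pt u) - birkhoff_sum \<phi> n (ext u)\<bar> \<le> \<kappa>"
    proof (rule birkhoff_sum_extension[OF ext S])
      show "pt u \<in> two_coloured_shift \<nu> \<tau>" using pt[OF u] by blast
      show "ext u \<in> full_shift S" by (rule ext_in[OF l(1)])
      show "pt u (int i) = ext u (int i)" if "i < n" for i
        using arg_cong[OF conjunct2[OF pt[OF u]], of "\<lambda>w. w ! i"] that l(2) by (simp add: ext_nth)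
    qed
    then have "birkhoff_sum \<phi> n (pt u) - real n * ?P \<le> (\<kappa> - real n * ?P) + birkhoff_sum \<phi> n (ext u)" by linarith
    then show "normalized_weight \<phi> ?P n (pt u) \<le> exp (\<kappa> - real n * ?P) * weight u"
      by (simp add: normalized_weight_def weight_def l(2) exp_add[symmetric])
  qed
  also have "\<dots> \<le> (\<Sum>u\<in>lists_of S n. exp (\<kappa> - real n * ?P) * weight u)"
    using U by (intro sum_mono2) (auto simp: finite_symbols weight_def)
  also have "\<dots> = exp (\<kappa> - real n * ?P) * Z n" by (simp add: Z_def sum_distrib_left)
  also have "\<dots> = exp (\<kappa> - real n * ?P + ln (Z n))" using Z_pos[of n] by (simp add: exp_add)
  also have "\<dots> \<le> exp (3 * \<kappa>)" using ln_Z_pressure[of n] by simp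
  finally show ?thesis .
qed

text \<open>The lower bound holds because green words occur in the larger subshift; for the upper
  one, a sum that is linear in \<open>n\<close> has logarithm o(n).\<close>

lemma (in holder_potential) pressure_two_coloured:
  assumes ext: "is_extension \<nu> \<tau> f \<phi>" and S: "S = green \<nu>"
    and D: "D \<ge> 0" and sum: "\<And>n U pt. (\<And>u. u \<in> U \<Longrightarrow> pt u \<in> two_coloured_shift \<nu> \<tau> \<and> window 0 n (pt u) = u) \<Longrightarrow>
      (\<Sum>u\<in>U. normalized_weight \<phi> (pressure (full_shift S) \<phi>) n (pt u)) \<le> 1 + D * real n"
  shows "pressure (two_coloured_shift \<nu> \<tau>) \<phi> = pressure (full_shift S) \<phi>"
proof (rule pressure_eqI)
  let ?\<Sigma> = "two_coloured_shift \<nu> \<tau>" and ?P = "pressure (full_shift S) \<phi>"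
  define p where "p w = (SOME x. x \<in> cylinder ?\<Sigma> w)" for w
  have p: "p w \<in> ?\<Sigma> \<and> window 0 n (p w) = w" if "w \<in> words ?\<Sigma> n" for w n
    using some_in_cylinder[of ?\<Sigma> w n] that translate_two_coloured_shift by (simp add: p_def)
  have pf: "partition_function ?\<Sigma> \<phi> n = (\<Sum>w\<in>words ?\<Sigma> n. exp (birkhoff_sum \<phi> n (p w)))" for n
    by (simp add: partition_function_def p_def)
  have fin: "finite (words ?\<Sigma> n)" for n
  proof (rule finite_subset)
    show "words ?\<Sigma> n \<subseteq> lists_of {0..2 * \<nu>} n"
    proof
      fix w assume "w \<in> words ?\<Sigma> n"
      then obtain x k where x: "length w = n" "x \<in> ?\<Sigma>" "\<forall>i<n. x (k + int i) = w ! i" by (auto simp: words_def)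
      have "w ! i \<le> 2 * \<nu>" if "i < n" for i using two_coloured_shift_symbols[OF x(2), of "k + int i"] x(3) that by simp
      then show "w \<in> lists_of {0..2 * \<nu>} n" using x(1) by (auto simp: lists_of_def in_set_conv_nth)
    qed
  qed simp
  have sub: "lists_of S n \<subseteq> words ?\<Sigma> n" for n
    unfolding words_full_shift[OF symbols_nonempty, symmetric] using full_shift_subset_two_coloured(1)[of \<nu> \<tau>] S by (auto simp: words_def)
  have low: "ln (Z n) - \<kappa> \<le> ln (partition_function ?\<Sigma> \<phi> n)" and pos: "partition_function ?\<Sigma> \<phi> n > 0" for n
  proof -
    let ?Y = "\<Sum>w\<in>lists_of S n. exp (birkhoff_sum \<phi> n (p w))"
    have "\<bar>ln ?Y - ln (Z n)\<bar> \<le> \<kappa>"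
    proof (rule ln_partition_function)
      fix w assume w: "w \<in> lists_of S n"
      then have pw: "p w \<in> ?\<Sigma>" "window 0 n (p w) = w" using p sub by blast+
      show "\<bar>birkhoff_sum \<phi> n (p w) - birkhoff_sum \<phi> n (ext w)\<bar> \<le> \<kappa>"
      proof (rule birkhoff_sum_extension[OF ext _ pw(1)])
        show "ext w \<in> full_shift S" using w by (intro ext_in) (simp add: lists_of_def)
        show "p w (int i) = ext w (int i)" if "i < n" for i
          using arg_cong[OF pw(2), of "\<lambda>w. w ! i"] that w by (simp add: ext_nth lists_of_def)
      qed (use S in simp)
    qed
    moreover have "?Y \<le> partition_function ?\<Sigma> \<phi> n" unfolding pf by (rule sum_mono2[OF fin sub]) simp
    moreover have "?Y > 0" by (rule sum_pos) (auto simp: lists_of_nonempty symbols_nonempty finite_symbols)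
    ultimately show "partition_function ?\<Sigma> \<phi> n > 0" "ln (Z n) - \<kappa> \<le> ln (partition_function ?\<Sigma> \<phi> n)"
      using ln_le_cancel_iff[of ?Y "partition_function ?\<Sigma> \<phi> n"] by linarith+
  qed
  show "real n * ?P - 3 * \<kappa> \<le> ln (partition_function ?\<Sigma> \<phi> n)" for n
    using low[of n] ln_Z_pressure[of n] by (simp add: abs_le_iff)
  show "ln (partition_function ?\<Sigma> \<phi> n) \<le> real n * ?P + (ln (1 + D) + ln (real n))" if n: "n > 0" for n
  proof -
    have "partition_function ?\<Sigma> \<phi> n = exp (real n * ?P) * (\<Sum>w\<in>words ?\<Sigma> n. normalized_weight \<phi> ?P n (p w))"
      unfolding pf by (simp add: sum_distrib_left normalized_weight_def exp_add[symmetric])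
    also have "\<dots> \<le> exp (real n * ?P) * (1 + D * real n)"
      by (intro mult_left_mono sum) (use p in auto)
    also have "\<dots> \<le> exp (real n * ?P) * ((1 + D) * real n)"
      using n D by (intro mult_left_mono) (auto simp: algebra_simps)
    finally have "ln (partition_function ?\<Sigma> \<phi> n) \<le> ln (exp (real n * ?P) * ((1 + D) * real n))"
      using pos[of n] n D by (subst ln_le_cancel_iff) auto
    then show ?thesis using n D by (simp add: ln_mult)
  qed
  have "(\<lambda>n. ln (1 + D) / real n + ln (real n) / real n) \<longlonglongrightarrow> 0 + 0"
    by (intro tendsto_add tendsto_divide_0[OF tendsto_const filterlim_real_at_infinity_sequentially] lim_ln_over_n)
  then show "(\<lambda>n. (ln (1 + D) + ln (real n)) / real n) \<longlonglongrightarrow> 0" by (simp add: add_divide_distrib)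
qed

theorem mainTheorem5:
  fixes \<nu> :: nat and \<tau> :: real and f g :: "point \<Rightarrow> real"
  assumes "\<nu> \<ge> 3"
    and "\<tau> > 0"
    and "holder_continuous_on (full_shift (green \<nu>)) f"
    and "pressure (full_shift (green \<nu>)) f > (SUP x\<in>full_shift (green \<nu>). f x) + ln 2"
    and "is_extension \<nu> \<tau> f g"
    and "\<tau> \<ge> ln (3 * real \<nu>) /
           (pressure (full_shift (green \<nu>)) f - (SUP x\<in>full_shift (green \<nu>). f x)) - 1"
  shows "\<exists>\<mu>1 \<mu>2. equilibrium_state (two_coloured_shift \<nu> \<tau>) g \<mu>1 \<and>
                equilibrium_state (two_coloured_shift \<nu> \<tau>) g \<mu>2 \<and>
                mutually_singular \<mu>1 \<mu>2"
proof -
  note hf = assms(3) and ext = assms(5)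
  define s where "s = (SUP x\<in>full_shift (green \<nu>). f x)"
  define P where "P = pressure (full_shift (green \<nu>)) f"
  let ?\<Sigma> = "two_coloured_shift \<nu> \<tau>"
  have ne: "finite (green \<nu>)" "green \<nu> \<noteq> {}" "finite (yellow \<nu>)" "yellow \<nu> \<noteq> {}"
    using assms(1) by (auto simp: green_def yellow_def)
  obtain t0 c0 where f: "holder_potential (green \<nu>) f t0 c0" using holder_potentialI[OF ne(1,2) hf] by blast
  obtain t1 c1 where gG: "holder_potential (green \<nu>) g t1 c1"
    using holder_potentialI[OF ne(1,2) holder_extension_green[OF ext hf]] by blast
  obtain t2 c2 where gY: "holder_potential (yellow \<nu>) g t2 c2"
    using holder_potentialI[OF ne(3,4) holder_extension_yellow[OF ext hf]] by blast
  interpret G: holder_potential "green \<nu>" g t1 c1 by (rule gG)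
  interpret Y: holder_potential "yellow \<nu>" g t2 c2 by (rule gY)
  have PG: "pressure (full_shift (green \<nu>)) g = P"
    unfolding P_def by (rule G.pressure_recoded[of 0, symmetric]) (use ext in \<open>auto simp: is_extension_def\<close>)
  have PY: "pressure (full_shift (yellow \<nu>)) g = P"
    unfolding P_def
  proof (rule Y.pressure_recoded[of \<nu>, symmetric])
    show "yellow \<nu> = (\<lambda>a. a + \<nu>) ` green \<nu>" by (auto simp: yellow_def green_def image_iff)
  qed (use ext in \<open>auto simp: is_extension_def\<close>)
  \<comment> \<open>One constant for both colours, since the counting alternates between
    them.\<close>
  define D where "D = max (exp (3 * G.\<kappa>)) (exp (3 * Y.\<kappa>))"
  have Ps: "P - s > ln 2" using assms(4) by (simp add: P_def s_def)
  interpret two_coloured_sums \<nu> \<tau> g P s D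
  proof
    show "1 \<le> \<nu>" "\<tau> > 0" using assms by auto
    show "g x \<le> s" if "x \<in> ?\<Sigma>" for x
      unfolding s_def by (rule extension_le_Sup[OF ext holder_potential.bdd_above_potential[OF f] that])
    show "D \<ge> 0" by (simp add: D_def le_max_iff_disj)
    show "ln 2 \<le> P - s" using Ps by simp
    have "0 \<le> ln (2 :: real)" by simp
    then have "P - s > 0" using Ps by linarith
    moreover have "ln (3 * real \<nu>) / (P - s) \<le> 1 + \<tau>" using assms(6) by (simp add: P_def s_def)
    ultimately show "ln (3 * real \<nu>) \<le> (1 + \<tau>) * (P - s)" by (simp add: pos_divide_le_eq)
    fix S U n and pt :: "nat list \<Rightarrow> point"
    assume S: "S = green \<nu> \<or> S = yellow \<nu>" and U: "U \<subseteq> lists_of S n"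
      and pt: "\<And>u. u \<in> U \<Longrightarrow> pt u \<in> ?\<Sigma> \<and> window 0 n (pt u) = u"
    show "(\<Sum>u\<in>U. normalized_weight g P n (pt u)) \<le> D"
    proof (cases "S = green \<nu>")
      case True
      then have "(\<Sum>u\<in>U. normalized_weight g P n (pt u)) \<le> exp (3 * G.\<kappa>)"
        unfolding PG[symmetric] using U pt by (intro G.monochromatic_words_sum[OF ext]) auto
      then show ?thesis by (simp add: D_def)
    next
      case False
      then have "(\<Sum>u\<in>U. normalized_weight g P n (pt u)) \<le> exp (3 * Y.\<kappa>)"
        unfolding PY[symmetric] using U pt S by (intro Y.monochromatic_words_sum[OF ext]) auto
      then show ?thesis by (simp add: D_def)
    qed
  qed
  have P\<Sigma>: "pressure ?\<Sigma> g = P"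
    unfolding PG[symmetric]
  proof (rule G.pressure_two_coloured[OF ext refl])
    show "0 \<le> 8 * D" using D by simp
    show "(\<Sum>u\<in>U. normalized_weight g (pressure (full_shift (green \<nu>)) g) n (pt u)) \<le> 1 + 8 * D * real n"
      if "\<And>u. u \<in> U \<Longrightarrow> pt u \<in> ?\<Sigma> \<and> window 0 n (pt u) = u" for n U and pt :: "nat list \<Rightarrow> point"
      unfolding PG by (rule all_words_sum) (use that in \<open>simp add: selects_def\<close>)
  qed
  have sh: "shift x \<in> ?\<Sigma>" if "x \<in> ?\<Sigma>" for x using funpow_shift_two_coloured[OF that, of 1] by simp
  have T: "finite {0..2 * \<nu>}" "?\<Sigma> \<subseteq> full_shift {0..2 * \<nu>}"
    using two_coloured_shift_symbols by (auto simp: full_shift_def)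
  have meas: "g \<in> borel_measurable (restrict_space borel ?\<Sigma>)" by (rule extension_measurable[OF ext gG gY])
  obtain M1 where M1: "invariant_probability ?\<Sigma> M1" "integrable M1 g" "AE x in M1. x \<in> full_shift (green \<nu>)"
    "metric_entropy M1 shift + ereal (\<integral>x. g x \<partial>M1) = ereal P"
    using G.equilibrium_measure_exists[OF full_shift_subset_two_coloured(1) sh T meas] unfolding PG by blast
  obtain M2 where M2: "invariant_probability ?\<Sigma> M2" "integrable M2 g" "AE x in M2. x \<in> full_shift (yellow \<nu>)"
    "full_shift (yellow \<nu>) \<in> sets M2" "metric_entropy M2 shift + ereal (\<integral>x. g x \<partial>M2) = ereal P"
    using Y.equilibrium_measure_exists[OF full_shift_subset_two_coloured(2) sh T meas] unfolding PY by blast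
  have sets: "sets M1 = sets M2" using M1(1) M2(1) by (simp add: invariant_probability_def)
  \<comment> \<open>The full yellow shift is the separating set: the green measure does not charge
    it, and the yellow one is concentrated on it.\<close>
  have "AE x in M1. \<not> x \<in> full_shift (yellow \<nu>)"
    using M1(3)
  proof eventually_elim
    fix x assume "x \<in> full_shift (green \<nu>)"
    then have "x 0 \<in> green \<nu>" by (simp add: full_shift_def)
    then have "x 0 \<notin> yellow \<nu>" using green_yellow_disjoint[of \<nu>] by blast
    then show "\<not> x \<in> full_shift (yellow \<nu>)" unfolding full_shift_def by blast
  qed
  then have "emeasure M1 {x \<in> space M1. x \<in> full_shift (yellow \<nu>)} = 0" by (rule emeasure_eq_0_AE)
  moreover have "{x \<in> space M1. x \<in> full_shift (yellow \<nu>)} = full_shift (yellow \<nu>)"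
    using sets.sets_into_space[OF M2(4)] sets_eq_imp_space_eq[OF sets] by blast
  ultimately have "emeasure M1 (full_shift (yellow \<nu>)) = 0" by simp
  moreover have "emeasure M2 (space M2 - full_shift (yellow \<nu>)) = 0"
    unfolding set_diff_eq by (rule emeasure_eq_0_AE) (use M2(3) in simp)
  ultimately have "mutually_singular M1 M2" using sets M2(4) unfolding mutually_singular_def by blast
  then show ?thesis using M1 M2 P\<Sigma> unfolding equilibrium_state_def by (intro exI[of _ M1] exI[of _ M2]) simp
qed

end
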